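(* Let $M$ be a matroid of rank $r$ on a finite set of $n$ elements. If $n=2r$, then $\omega(M)$ is either $0$ or $1$. If $n=2r+1$, then $0\le\omega(M)\le r$.
   Context: Let $M$ be a matroid of rank $r$ on a finite set $E$, $|E|=n$, and let $c(M)$ be its number of connected components. Speyer's $g$-polynomial $g_M(t)\in\mathbb Z[t]$ is given as follows (in the form of Berget–Eur–Spink–Tseng, equivalent to the original $K$-theoretic definition). If $E=\emptyset$, $g_M=1$. If $M$ has a loop or a coloop, $g_M=0$. Otherwise, for each total ordering $w=(w_1,\dots,w_n)$ of $E$ (thought of as the region $z_{w_1}>\dots>z_{w_n}$ of $\mathbb R^E$), let $B_w$ be the greedy basis: $w_k\in B_w$ iff $\operatorname{rank}\{w_1,\dots,w_k\}>\operatorname{rank}\{w_1,\dots,w_{k-1}\}$. In the polynomial ring $\mathbb Z[z_e:e\in E]$, let $x^w$ be the list of the $z_b$, $b\in B_w$; let $y^w=(y^w_1,\dots,y^w_{n-r})$ be the list of the $-z_c$, $c\in E\setminus B_w$, ordered so that $y^w_1$ corresponds to the $c$ occurring last in $w$; let $\alpha^w=-z_{w_n}$. For a family $f=(f_w)_w$ put $\deg f=\sum_w f_w/\prod_{i=1}^{n-1}(z_{w_i}-z_{w_{i+1}})$. With $\boldsymbol e_k$ the $k$-th elementary symmetric polynomial, $$g_M(t)=(-1)^{c(M)}\sum_{i=1}^{r}(-t)^i\sum_{j=0}^{i-1}\deg\big(\alpha^j\,\boldsymbol e_{i-j-1}(-y)\,\boldsymbol e_{r-i}(x)\,\boldsymbol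 e_{n-r}(y)\big),$$ each $\deg$ here being an integer constant. The invariant $\omega(M)$ is the coefficient of $t^r$ in $g_M(t)$, where $r=\operatorname{rank} M$. *)

theory Defs
  imports
    "HOL-Library.Poly_Mapping"
    "HOL-Computational_Algebra.Computational_Algebra"
    "HOL-Combinatorics.Multiset_Permutations"
begin

section \<open>Matroids\<close>

locale matroid =
  fixes E :: "'a set" and indep :: "'a set \<Rightarrow> bool"
  assumes finite_ground: "finite E"
    and indep_subset_ground: "indep X \<Longrightarrow> X \<subseteq> E"
    and indep_empty: "indep {}"
    and indep_mono: "indep Y \<Longrightarrow> X \<subseteq> Y \<Longrightarrow> indep X"
    and indep_augment: "indep X \<Longrightarrow> indep Y \<Longrightarrow> card X < card Y \<Longrightarrow>
      \<exists>y\<in>Y - X. indep (insert y X)"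

definition matroid_rank :: "('a set \<Rightarrow> bool) \<Rightarrow> 'a set \<Rightarrow> nat" where
  "matroid_rank indep X = Max (card ` {Y. Y \<subseteq> X \<and> indep Y})"

definition matroid_basis :: "('a set \<Rightarrow> bool) \<Rightarrow> 'a set \<Rightarrow> bool" where
  "matroid_basis indep B \<longleftrightarrow> indep B \<and> (\<forall>X. indep X \<and> B \<subseteq> X \<longrightarrow> X = B)"

definition matroid_circuit :: "'a set \<Rightarrow> ('a set \<Rightarrow> bool) \<Rightarrow> 'a set \<Rightarrow> bool" where
  "matroid_circuit E indep C \<longleftrightarrow> C \<subseteq> E \<and> \<not> indep C \<and> (\<forall>D. D \<subset> C \<longrightarrow> indep D)"

definition is_loop :: "'a set \<Rightarrow> ('a set \<Rightarrow> bool) \<Rightarrow> 'a \<Rightarrow> bool" where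
  "is_loop E indep e \<longleftrightarrow> e \<in> E \<and> \<not> indep {e}"

definition is_coloop :: "'a set \<Rightarrow> ('a set \<Rightarrow> bool) \<Rightarrow> 'a \<Rightarrow> bool" where
  "is_coloop E indep e \<longleftrightarrow> e \<in> E \<and> (\<forall>B. matroid_basis indep B \<longrightarrow> e \<in> B)"

text \<open>The connected components are the classes of the relation ``equal or lying on a common circuit''.\<close>

definition component_rel :: "'a set \<Rightarrow> ('a set \<Rightarrow> bool) \<Rightarrow> ('a \<times> 'a) set" where
  "component_rel E indep = {(e, f). e \<in> E \<and> f \<in> E \<and>
     (e = f \<or> (\<exists>C. matroid_circuit E indep C \<and> e \<in> C \<and> f \<in> C))}"

definition num_components :: "'a set \<Rightarrow> ('a set \<Rightarrow> bool) \<Rightarrow> nat" where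
  "num_components E indep = card (E // component_rel E indep)"


section \<open>Integer polynomials in variables indexed by an arbitrary type\<close>

text \<open>
  \<^typ>\<open>('a \<Rightarrow>\<^sub>0 nat) \<Rightarrow>\<^sub>0 int\<close> is the ring of integer polynomials in variables indexed by \<^typ>\<open>'a\<close>:
  a finitely supported map from monomials (exponent vectors) to coefficients. The library proves
  that it is an integral domain only when the variables are linearly ordered; the copy below is an
  integral domain for every \<^typ>\<open>'a\<close>, so that its field of fractions is available.
\<close>

typedef 'a zpoly = "UNIV :: (('a \<Rightarrow>\<^sub>0 nat) \<Rightarrow>\<^sub>0 int) set"
  by simp

setup_lifting type_definition_zpoly

instantiation zpoly :: (type) comm_ring_1
begin

lift_definition zero_zpoly :: "'a zpoly" is 0 .
lift_definition one_zpoly :: "'a zpoly" is 1 .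
lift_definition plus_zpoly :: "'a zpoly \<Rightarrow> 'a zpoly \<Rightarrow> 'a zpoly" is "(+)" .
lift_definition minus_zpoly :: "'a zpoly \<Rightarrow> 'a zpoly \<Rightarrow> 'a zpoly" is "(-)" .
lift_definition uminus_zpoly :: "'a zpoly \<Rightarrow> 'a zpoly" is uminus .
lift_definition times_zpoly :: "'a zpoly \<Rightarrow> 'a zpoly \<Rightarrow> 'a zpoly" is "(*)" .

instance
  by (intro_classes; transfer; simp add: algebra_simps)

end

text \<open>No zero divisors: order the finitely many variables that occur and compare leading terms.\<close>

lemma poly_mapping_mult_nonzero:
  fixes f g :: "('a \<Rightarrow>\<^sub>0 nat) \<Rightarrow>\<^sub>0 int"
  assumes "f \<noteq> 0" "g \<noteq> 0"
  shows "f * g \<noteq> 0"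
proof -
  define V where "V = (\<Union>m\<in>Poly_Mapping.keys f \<union> Poly_Mapping.keys g. Poly_Mapping.keys m)"
  have "finite V"
    unfolding V_def by (rule finite_UN_I) auto
  then obtain h :: "nat \<Rightarrow> 'a" and k where h: "V = h ` {i. i < k}"
    using finite_imp_nat_seg_image_inj_on by metis
  define L :: "('a \<Rightarrow>\<^sub>0 nat) \<Rightarrow> (nat \<Rightarrow>\<^sub>0 nat)"
    where "L m = (\<Sum>i<k. Poly_Mapping.single i (Poly_Mapping.lookup m (h i)))" for m
  have look: "Poly_Mapping.lookup (L m) j = (if j < k then Poly_Mapping.lookup m (h j) else 0)" for m j
    by (simp add: L_def lookup_sum lookup_single when_def)
  have L_add: "L (m + m') = L m + L m'" for m m'
    by (rule poly_mapping_eqI) (simp add: look lookup_add)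
  have L_inj: "m = m'" if "L m = L m'" "m \<in> Poly_Mapping.keys f \<union> Poly_Mapping.keys g" "m' \<in> Poly_Mapping.keys f \<union> Poly_Mapping.keys g" for m m'
  proof (rule poly_mapping_eqI)
    fix a
    show "Poly_Mapping.lookup m a = Poly_Mapping.lookup m' a"
    proof (cases "a \<in> V")
      case True
      then obtain j where j: "j < k" "a = h j" using h by auto
      from that(1) have "Poly_Mapping.lookup (L m) j = Poly_Mapping.lookup (L m') j" by simp
      then show ?thesis by (simp add: look j)
    next
      case False
      then have "a \<notin> Poly_Mapping.keys m" "a \<notin> Poly_Mapping.keys m'" using that(2,3) by (auto simp: V_def)
      then show ?thesis by (simp add: in_keys_iff)
    qed
  qed
  have max: "\<exists>m\<in>Poly_Mapping.keys p. \<forall>m'\<in>Poly_Mapping.keys p. L m' \<le> L m" if "p \<noteq> 0" for p :: "('a \<Rightarrow>\<^sub>0 nat) \<Rightarrow>\<^sub>0 int"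
  proof -
    have ne: "finite (L ` Poly_Mapping.keys p)" "L ` Poly_Mapping.keys p \<noteq> {}" using that by auto
    then have "Max (L ` Poly_Mapping.keys p) \<in> L ` Poly_Mapping.keys p" by (rule Max_in)
    then obtain m where "m \<in> Poly_Mapping.keys p" "L m = Max (L ` Poly_Mapping.keys p)" by auto
    then show ?thesis using ne(1) by (metis Max_ge imageI)
  qed
  obtain a where a: "a \<in> Poly_Mapping.keys f" "\<And>m. m \<in> Poly_Mapping.keys f \<Longrightarrow> L m \<le> L a"
    using max[OF assms(1)] by blast
  obtain b where b: "b \<in> Poly_Mapping.keys g" "\<And>m. m \<in> Poly_Mapping.keys g \<Longrightarrow> L m \<le> L b"
    using max[OF assms(2)] by blast
  have uniq: "m = a \<and> m' = b"
    if "m \<in> Poly_Mapping.keys f" "m' \<in> Poly_Mapping.keys g" "a + b = m + m'" for m m'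
  proof -
    have "L a + L b = L m + L m'" using that(3) L_add by metis
    moreover have "L m \<le> L a" "L m' \<le> L b" using a b that by auto
    ultimately have "L m = L a" "L m' = L b"
      by (metis add_less_le_mono add_le_less_mono order_le_less less_irrefl)+
    then show ?thesis using L_inj that a(1) b(1) by auto
  qed
  have "Poly_Mapping.lookup (f * g) (a + b) =
      (\<Sum>(m, m'). Poly_Mapping.lookup f m * Poly_Mapping.lookup g m' when a + b = m + m')"
    unfolding times_poly_mapping.rep_eq by (rule prod_fun_unfold_prod) auto
  also have "\<dots> = (\<Sum>mm'. (Poly_Mapping.lookup f a * Poly_Mapping.lookup g b) when (a, b) = mm')"
  proof (rule Sum_any.cong)
    fix mm' :: "('a \<Rightarrow>\<^sub>0 nat) \<times> ('a \<Rightarrow>\<^sub>0 nat)"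
    obtain m m' where mm': "mm' = (m, m')" by (cases mm')
    show "(case mm' of (m, m') \<Rightarrow> Poly_Mapping.lookup f m * Poly_Mapping.lookup g m' when a + b = m + m') =
        (Poly_Mapping.lookup f a * Poly_Mapping.lookup g b when (a, b) = mm')"
      using uniq[of m m'] by (auto simp: mm' when_def in_keys_iff)
  qed
  also have "\<dots> = Poly_Mapping.lookup f a * Poly_Mapping.lookup g b" by simp
  also have "\<dots> \<noteq> 0" using a(1) b(1) by (simp add: in_keys_iff)
  finally show ?thesis by auto
qed

instance zpoly :: (type) idom
  by (intro_classes; transfer) (rule poly_mapping_mult_nonzero)

instance zpoly :: (type) ring_char_0
proof
  have "Rep_zpoly (of_nat n) = (of_nat n :: ('a \<Rightarrow>\<^sub>0 nat) \<Rightarrow>\<^sub>0 int)" for n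
    by (induction n) (simp_all add: zero_zpoly.rep_eq one_zpoly.rep_eq plus_zpoly.rep_eq)
  then show "inj (of_nat :: nat \<Rightarrow> 'a zpoly)"
    by (metis injI of_nat_eq_iff)
qed

lift_definition zvar :: "'a \<Rightarrow> 'a zpoly" is
  "\<lambda>e. Poly_Mapping.single (Poly_Mapping.single e 1) 1" .

text \<open>The integer to which a rational function is equal; unspecified if there is none.\<close>

definition int_value :: "'a zpoly fract \<Rightarrow> int" where
  "int_value q = (THE d. q = of_int d)"

lemma of_int_fract_zpoly: "(of_int d :: 'a zpoly fract) = Fract (of_int d) 1"
  by (cases d) (simp_all add: of_nat_fract One_fract_def)

lemma int_value_of_int [simp]: "int_value (of_int d :: 'a zpoly fract) = d"
  by (auto simp: int_value_def of_int_fract_zpoly eq_fract)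


section \<open>Speyer's g-polynomial\<close>

definition elem_sym :: "nat \<Rightarrow> 'b::comm_ring_1 list \<Rightarrow> 'b" where
  "elem_sym k xs = (\<Sum>S | S \<subseteq> {..<length xs} \<and> card S = k. \<Prod>i\<in>S. xs ! i)"

definition greedy_basis :: "('a set \<Rightarrow> bool) \<Rightarrow> 'a list \<Rightarrow> 'a set" where
  "greedy_basis indep w = {w ! k |k. k < length w \<and>
     matroid_rank indep (set (take (Suc k) w)) > matroid_rank indep (set (take k w))}"

definition x_list :: "('a set \<Rightarrow> bool) \<Rightarrow> 'a list \<Rightarrow> 'a zpoly list" where
  "x_list indep w = map zvar (filter (\<lambda>e. e \<in> greedy_basis indep w) w)"

definition y_list :: "('a set \<Rightarrow> bool) \<Rightarrow> 'a list \<Rightarrow> 'a zpoly list" where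
  "y_list indep w = map (\<lambda>e. - zvar e) (filter (\<lambda>e. e \<notin> greedy_basis indep w) (rev w))"

definition alpha_class :: "'a list \<Rightarrow> 'a zpoly" where
  "alpha_class w = - zvar (last w)"

text \<open>
  \<^const>\<open>permutations_of_set\<close> lists the total orderings of \<open>E\<close>. The polynomial ring has a
  variable for every element of \<^typ>\<open>'a\<close>; only those of \<open>E\<close> occur in the classes used below.
\<close>

definition perm_deg :: "'a set \<Rightarrow> ('a list \<Rightarrow> 'a zpoly) \<Rightarrow> 'a zpoly fract" where
  "perm_deg E f = (\<Sum>w\<in>permutations_of_set E.
     Fract (f w) (\<Prod>i<length w - 1. zvar (w ! i) - zvar (w ! Suc i)))"

definition g_poly :: "'a set \<Rightarrow> ('a set \<Rightarrow> bool) \<Rightarrow> int poly" where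
  "g_poly E indep =
    (if E = {} then 1
     else if \<exists>e. is_loop E indep e \<or> is_coloop E indep e then 0
     else let n = card E; r = matroid_rank indep E in
       (- 1) ^ num_components E indep *
       (\<Sum>i=1..r. (- [:0, 1:]) ^ i *
         (\<Sum>j<i. [:int_value (perm_deg E (\<lambda>w.
            alpha_class w ^ j
            * elem_sym (i - j - 1) (map uminus (y_list indep w))
            * elem_sym (r - i) (x_list indep w)
            * elem_sym (n - r) (y_list indep w))):])))"

definition omega_invariant :: "'a set \<Rightarrow> ('a set \<Rightarrow> bool) \<Rightarrow> int" where
  "omega_invariant E indep = coeff (g_poly E indep) (matroid_rank indep E)"

end

theory Submission
  imports Defs "HOL-Library.Landau_Symbols"
begin

text \<open>
  For pairwise distinct real numbers \<open>z e\<close>, let \<open>F\<close> be the sum over all total orderings \<open>w\<close> of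
  \<open>(\<Prod>c\<notin>B w. z c * (z c - 1)) / ((z (last w) - 1) * (\<Prod>k. z (w k) - z (w (k + 1))))\<close>, where \<open>B w\<close> is the
  greedy basis. Removing an element \<open>e\<close> from all orderings expresses \<open>F\<close> by a formula without \<open>z e\<close>, so \<open>F\<close> does
  not depend on \<open>z\<close>; comparing degrees, \<open>\<omega> = (- 1) ^ c * F\<close>. Moreover \<open>F\<close> is multiplicative over connected
  components, so let the matroid be connected. If a nonempty proper \<open>S\<close> has \<open>card S \<ge> 2 * rank S + (n - 2 * r)\<close>,
  sending the coordinates outside \<open>S\<close> to infinity shows \<open>F = 0\<close>. Otherwise, if \<open>n = 2 * r\<close>, all but one term of the
  deletion formula vanish for reasons of degree and \<open>F = - 1\<close>. If \<open>n = 2 * r + 1\<close>, let \<open>a T\<close> be \<open>- F\<close> of the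
  contraction by a tight set \<open>T\<close>, that is \<open>card T = 2 * rank T < 2 * r\<close>. Cutting the orderings of the free coextension gives
  \<open>(\<Sum>T. a T) = r\<close>, and likewise for each contraction; as the complements of tight sets are odd and closed under
  unions and intersections of intersecting pairs, this forces \<open>0 \<le> a T\<close> for all \<open>T\<close>, hence \<open>0 \<le> a {} \<le> r\<close>.
\<close>

section \<open>Sums over total orderings, by their last element\<close>

text \<open>\<open>F\<close> packages the degrees in the definition. Without coloops the last
  element of an ordering is skipped by the greedy basis, so its pole cancels against its own weight.
  With \<open>z c - p\<close> for \<open>z c - 1\<close>, what remains is a polynomial in
  \<open>p\<close> whose coefficients are elementary symmetric in the other skipped elements; the
  sum over the powers of \<open>alpha_class\<close> collapses to one of these coefficients. The
  weight \<open>z * (z - p)\<close> is quadratic, so its difference quotient is linear, and a linear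
  term along an ordering is a sum of consecutive differences, each of which cancels a denominator
  and cuts the ordering in two. This is the source of all deletion formulas. The obstacle is that
  single orderings have poles that only cancel in the total. The deletion formula avoids them: it
  leads from end weights \<phi> that are polynomials or simple poles back to weights of these kinds.
  It serves twice, over the reals for the bounds and over polynomials in \<open>p\<close> with
  fractions as coefficients for the integrality of each degree; hence the general ring. The argument
  \<open>X\<close> is an initial segment already used up, so that contraction only changes an
  argument.\<close>

text \<open>
  For nonempty \<open>Y\<close> this is the sum over the orderings \<open>w\<close> of \<open>Y\<close> of
  \<open>(\<Prod>k. h (w k) (X \<union> {w 1, \<dots>, w (k - 1)})) * \<phi> (last w) * (\<Prod>k. u (w k) (w (k + 1)))\<close>.
  We use \<open>u a b = 1 / (z a - z b)\<close>; an explicit \<open>u\<close> allows rings that are not fields.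
\<close>

function end_sum :: "('a \<Rightarrow> 'a set \<Rightarrow> 'k::comm_ring_1) \<Rightarrow> ('a \<Rightarrow> 'a \<Rightarrow> 'k) \<Rightarrow> 'a set \<Rightarrow> 'a set \<Rightarrow> ('a \<Rightarrow> 'k) \<Rightarrow> 'k" where
  "end_sum h u X Y \<phi> = (if finite Y \<and> Y \<noteq> {} then
     (\<Sum>a\<in>Y. h a (X \<union> (Y - {a})) * \<phi> a * end_sum h u X (Y - {a}) (\<lambda>b. u b a)) else 1)"
  by auto
termination
  by (relation "measure (\<lambda>(h, u, X, Y, \<phi>). card Y)") (auto simp: card_gt_0_iff intro!: card_Diff1_less)

declare end_sum.simps [simp del]

lemma end_sum_empty [simp]: "end_sum h u X {} \<phi> = 1"
  by (simp add: end_sum.simps)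

lemma end_sum_rec:
  "finite Y \<Longrightarrow> Y \<noteq> {} \<Longrightarrow>
     end_sum h u X Y \<phi> = (\<Sum>a\<in>Y. h a (X \<union> (Y - {a})) * \<phi> a * end_sum h u X (Y - {a}) (\<lambda>b. u b a))"
  by (subst end_sum.simps) simp

lemma end_sum_singleton [simp]: "end_sum h u X {a} \<phi> = h a X * \<phi> a"
  by (simp add: end_sum_rec)

lemma end_sum_insert:
  assumes "finite Y" "e \<notin> Y"
  shows "end_sum h u X (insert e Y) \<phi> = h e (X \<union> Y) * \<phi> e * end_sum h u X Y (\<lambda>b. u b e) +
    (\<Sum>a\<in>Y. h a (X \<union> insert e (Y - {a})) * \<phi> a * end_sum h u X (insert e (Y - {a})) (\<lambda>b. u b a))"
proof -
  have "insert e Y - {a} = insert e (Y - {a})" if "a \<in> Y" for a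
    using that assms by auto
  then show ?thesis
    using assms by (subst end_sum_rec) (auto intro!: sum.cong)
qed

text \<open>Besides congruence, this serves to identify the end of an ordering of the coextension,
  embedded by \<open>Some\<close>, with an ordering in the original ground set.\<close>

lemma end_sum_embed:
  assumes "finite Y" "inj_on f Y"
    and "\<And>a A. a \<in> Y \<Longrightarrow> A \<subseteq> Y \<Longrightarrow> a \<notin> A \<Longrightarrow> h' (f a) (X' \<union> f ` A) = h a (X \<union> A)"
    and "\<And>a b. a \<in> Y \<Longrightarrow> b \<in> Y \<Longrightarrow> a \<noteq> b \<Longrightarrow> u' (f a) (f b) = u a b"
    and "\<And>a. a \<in> Y \<Longrightarrow> \<phi>' (f a) = \<phi> a"
  shows "end_sum h' u' X' (f ` Y) \<phi>' = end_sum h u X Y \<phi>"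
  using assms
proof (induction "card Y" arbitrary: Y \<phi> \<phi>' rule: less_induct)
  case less
  show ?case
  proof (cases "Y = {}")
    case False
    have step: "f ` Y - {f a} = f ` (Y - {a})" if "a \<in> Y" for a
      using that less.prems(2) by (auto simp: inj_on_def)
    have "end_sum h' u' X' (f ` Y) \<phi>' =
        (\<Sum>a\<in>Y. h' (f a) (X' \<union> (f ` Y - {f a})) * \<phi>' (f a) * end_sum h' u' X' (f ` Y - {f a}) (\<lambda>b. u' b (f a)))"
      using less.prems(1,2) False by (simp add: end_sum_rec sum.reindex)
    also have "\<dots> = (\<Sum>a\<in>Y. h a (X \<union> (Y - {a})) * \<phi> a * end_sum h u X (Y - {a}) (\<lambda>b. u b a))"
    proof (rule sum.cong[OF refl])
      fix a assume a: "a \<in> Y"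
      have "end_sum h' u' X' (f ` (Y - {a})) (\<lambda>b. u' b (f a)) = end_sum h u X (Y - {a}) (\<lambda>b. u b a)"
      proof (rule less.hyps)
        show "card (Y - {a}) < card Y"
          using less.prems(1) a by (intro card_Diff1_less)
        show "h' (f b) (X' \<union> f ` A) = h b (X \<union> A)" if "b \<in> Y - {a}" "A \<subseteq> Y - {a}" "b \<notin> A" for b A
          using that by (intro less.prems(3)) auto
      qed (use less.prems a in \<open>auto simp: inj_on_diff\<close>)
      then show "h' (f a) (X' \<union> (f ` Y - {f a})) * \<phi>' (f a) * end_sum h' u' X' (f ` Y - {f a}) (\<lambda>b. u' b (f a)) =
        h a (X \<union> (Y - {a})) * \<phi> a * end_sum h u X (Y - {a}) (\<lambda>b. u b a)"
        using a less.prems(3)[of a "Y - {a}"] less.prems(5) by (simp add: step)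
    qed
    finally show ?thesis
      using less.prems(1) False by (simp add: end_sum_rec)
  qed simp
qed

lemma end_sum_cong:
  assumes "finite Y" "\<And>a A. a \<in> Y \<Longrightarrow> A \<subseteq> Y \<Longrightarrow> a \<notin> A \<Longrightarrow> h' a (X' \<union> A) = h a (X \<union> A)"
    and "\<And>a b. a \<in> Y \<Longrightarrow> b \<in> Y \<Longrightarrow> a \<noteq> b \<Longrightarrow> u' a b = u a b"
    and "\<And>a. a \<in> Y \<Longrightarrow> \<phi>' a = \<phi> a"
  shows "end_sum h' u' X' Y \<phi>' = end_sum h u X Y \<phi>"
  using end_sum_embed[of Y id h' X' h X u' u \<phi>' \<phi>] assms by auto

lemma end_sum_add:
  assumes "finite Y" "Y \<noteq> {}"
  shows "end_sum h u X Y (\<lambda>b. \<phi> b + \<psi> b) = end_sum h u X Y \<phi> + end_sum h u X Y \<psi>"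
  using assms by (simp add: end_sum_rec algebra_simps sum.distrib)

lemma end_sum_mult:
  assumes "finite Y" "Y \<noteq> {}"
  shows "end_sum h u X Y (\<lambda>b. c * \<phi> b) = c * end_sum h u X Y \<phi>"
  using assms by (simp add: end_sum_rec mult_ac sum_distrib_left)

text \<open>The sums over \<open>A\<close> collect the orderings cut into an ordering of \<open>A\<close> and one of the rest.\<close>

lemma sum_cuts_by_last:
  assumes "finite Y"
  shows "(\<Sum>a\<in>Y. h a (X \<union> (Y - {a})) * \<phi> a *
      (\<Sum>A | A \<subseteq> Y - {a} \<and> P A. C A * end_sum h u (X \<union> A) (Y - {a} - A) (\<lambda>b. u b a))) =
    (\<Sum>A | A \<subset> Y \<and> P A. C A * end_sum h u (X \<union> A) (Y - A) \<phi>)"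
proof -
  have fin: "finite {A. A \<subset> Y \<and> P A}" "finite {A. A \<subseteq> Y - {a} \<and> P A}" for a
    using assms by (auto intro: finite_subset[of _ "Pow Y"])
  have "(\<Sum>A | A \<subset> Y \<and> P A. C A * end_sum h u (X \<union> A) (Y - A) \<phi>) =
    (\<Sum>A | A \<subset> Y \<and> P A. \<Sum>a\<in>Y - A. h a (X \<union> (Y - {a})) * \<phi> a *
      (C A * end_sum h u (X \<union> A) (Y - {a} - A) (\<lambda>b. u b a)))"
  proof (rule sum.cong[OF refl])
    fix A assume A: "A \<in> {A. A \<subset> Y \<and> P A}"
    have "Y - A - {a} = Y - {a} - A" "X \<union> A \<union> (Y - {a} - A) = X \<union> (Y - {a})" if "a \<in> Y - A" for a
      using A that by auto
    then show "C A * end_sum h u (X \<union> A) (Y - A) \<phi> = (\<Sum>a\<in>Y - A. h a (X \<union> (Y - {a})) * \<phi> a *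
      (C A * end_sum h u (X \<union> A) (Y - {a} - A) (\<lambda>b. u b a)))"
      using A assms by (subst end_sum_rec) (auto simp: sum_distrib_left mult_ac intro!: sum.cong)
  qed
  also have "\<dots> = (\<Sum>a\<in>Y. \<Sum>A | A \<subseteq> Y - {a} \<and> P A. h a (X \<union> (Y - {a})) * \<phi> a *
      (C A * end_sum h u (X \<union> A) (Y - {a} - A) (\<lambda>b. u b a)))"
    unfolding sum.Sigma[OF fin(1) ballI, OF finite_Diff[OF assms]] sum.Sigma[OF assms ballI, OF fin(2)]
    by (rule sum.reindex_bij_witness[of _ "\<lambda>(a, A). (A, a)" "\<lambda>(A, a). (a, A)"]) auto
  finally show ?thesis
    by (simp add: sum_distrib_left)
qed

section \<open>Partial fractions along an ordering\<close>

definition inverse_differences :: "('a \<Rightarrow> 'k::comm_ring_1) \<Rightarrow> ('a \<Rightarrow> 'a \<Rightarrow> 'k) \<Rightarrow> 'a set \<Rightarrow> bool" where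
  "inverse_differences z u Y \<longleftrightarrow> (\<forall>a\<in>Y. \<forall>b\<in>Y. a \<noteq> b \<longrightarrow> (z a - z b) * u a b = 1)"

lemma inverse_differencesD:
  "inverse_differences z u Y \<Longrightarrow> a \<in> Y \<Longrightarrow> b \<in> Y \<Longrightarrow> a \<noteq> b \<Longrightarrow> (z a - z b) * u a b = 1"
  by (simp add: inverse_differences_def)

lemma inverse_differences_subset:
  "inverse_differences z u Y \<Longrightarrow> A \<subseteq> Y \<Longrightarrow> inverse_differences z u A"
  by (auto simp: inverse_differences_def)

lemma inverse_differences_swap:
  assumes "inverse_differences z u Y" "a \<in> Y" "b \<in> Y" "a \<noteq> b"
  shows "u b a = - u a b"
proof -
  have "u b a = u b a * ((z a - z b) * u a b)"
    using assms by (simp add: inverse_differencesD)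
  also have "\<dots> = - ((z b - z a) * u b a) * u a b"
    by (simp add: algebra_simps)
  finally show ?thesis
    using assms by (simp add: inverse_differencesD)
qed

text \<open>Satisfied by \<open>\<phi> b = 1 / (z b - c)\<close>.\<close>

definition simple_pole :: "('a \<Rightarrow> 'k::comm_ring_1) \<Rightarrow> ('a \<Rightarrow> 'k) \<Rightarrow> 'a set \<Rightarrow> bool" where
  "simple_pole z \<phi> Y \<longleftrightarrow> (\<forall>a\<in>Y. \<forall>b\<in>Y. \<phi> b - \<phi> a = (z a - z b) * \<phi> a * \<phi> b)"

lemma simple_poleD: "simple_pole z \<phi> Y \<Longrightarrow> a \<in> Y \<Longrightarrow> b \<in> Y \<Longrightarrow> \<phi> b - \<phi> a = (z a - z b) * \<phi> a * \<phi> b"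
  by (simp add: simple_pole_def)

text \<open>The recursion of \<open>end_sum\<close> replaces the end weight by
  \<open>\<lambda>b. u b c\<close>; hence a statement about simple poles can be its own induction
  hypothesis.\<close>

lemma simple_pole_inverse_differences:
  assumes "inverse_differences z u Y" "c \<in> Y" "A \<subseteq> Y - {c}"
  shows "simple_pole z (\<lambda>b. u b c) A"
  unfolding simple_pole_def
proof (intro ballI)
  fix a b assume ab: "a \<in> A" "b \<in> A"
  then have 1: "(z a - z c) * u a c = 1" "(z b - z c) * u b c = 1"
    using assms by (auto intro!: inverse_differencesD)
  have "(z a - z b) * u a c * u b c = ((z a - z c) * u a c) * u b c - ((z b - z c) * u b c) * u a c"
    by (simp add: algebra_simps)
  then show "u b c - u a c = (z a - z b) * u a c * u b c"
    unfolding 1 by simp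
qed

lemma simple_pole_quotient:
  assumes "inverse_differences z u Y" "simple_pole z \<phi> Y" "e \<in> Y" "b \<in> Y" "e \<noteq> b"
  shows "(\<phi> b - \<phi> e) * u e b = \<phi> e * \<phi> b"
proof -
  have "(\<phi> b - \<phi> e) * u e b = ((z e - z b) * u e b) * (\<phi> e * \<phi> b)"
    unfolding simple_poleD[OF assms(2-4)] by (simp only: mult_ac)
  then show ?thesis
    using assms by (simp add: inverse_differencesD)
qed

text \<open>Inserting \<open>e\<close> between consecutive \<open>a\<close> and \<open>b\<close>
  turns \<open>u a b\<close> into \<open>u a e * u e b = u a b * (u e b - u e a)\<close>. The
  weights do not depend on the position of \<open>e\<close>, so the sum over its positions
  telescopes. Only the end of the ordering remains: \<open>\<phi> b * u e b\<close> from the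
  positions before the last element \<open>b\<close>, and \<open>- \<phi> e * u e b\<close> from
  \<open>e\<close> in last place.\<close>

lemma end_sum_insert_separated:
  assumes "finite Y" "Y \<noteq> {}" "e \<notin> Y" "inverse_differences z u (insert e Y)"
    and "\<And>A. A \<subseteq> Y \<Longrightarrow> h e (X \<union> A) = \<kappa>"
    and "\<And>b A. b \<in> Y \<Longrightarrow> A \<subseteq> Y - {b} \<Longrightarrow> h b (X \<union> insert e A) = h b (X \<union> A)"
  shows "end_sum h u X (insert e Y) \<phi> = \<kappa> * end_sum h u X Y (\<lambda>b. (\<phi> b - \<phi> e) * u e b)"
  using assms
proof (induction "card Y" arbitrary: Y \<phi> rule: less_induct)
  case less
  have IH: "end_sum h u X (insert e (Y - {a})) (\<lambda>b. u b a) = \<kappa> * u e a * end_sum h u X (Y - {a}) (\<lambda>b. u b a)"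
    if a: "a \<in> Y" for a
  proof (cases "Y - {a} = {}")
    case True
    show ?thesis unfolding True using less.prems(5)[of "{}"] by simp
  next
    case False
    have "end_sum h u X (insert e (Y - {a})) (\<lambda>b. u b a) = \<kappa> * end_sum h u X (Y - {a}) (\<lambda>b. (u b a - u e a) * u e b)"
    proof (rule less.hyps)
      show "card (Y - {a}) < card Y"
        using less.prems(1) a by (intro card_Diff1_less)
      show "inverse_differences z u (insert e (Y - {a}))"
        by (rule inverse_differences_subset[OF less.prems(4)]) auto
      show "h b (X \<union> insert e A) = h b (X \<union> A)" if "b \<in> Y - {a}" "A \<subseteq> Y - {a} - {b}" for b A
        using that by (intro less.prems(6)) auto
    qed (use less.prems(1-5) False in auto)
    also have "end_sum h u X (Y - {a}) (\<lambda>b. (u b a - u e a) * u e b) = end_sum h u X (Y - {a}) (\<lambda>b. u e a * u b a)"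
    proof (rule end_sum_cong)
      fix b assume b: "b \<in> Y - {a}"
      have "simple_pole z (\<lambda>b. u b a) (insert e Y - {a})"
        by (rule simple_pole_inverse_differences[OF less.prems(4)]) (use a in auto)
      moreover have "inverse_differences z u (insert e Y - {a})"
        by (rule inverse_differences_subset[OF less.prems(4)]) auto
      ultimately show "(u b a - u e a) * u e b = u e a * u b a"
        using simple_pole_quotient[of z u "insert e Y - {a}" "\<lambda>b. u b a" e b] a b less.prems(3) by blast
    qed (use less.prems(1) in auto)
    also have "\<dots> = u e a * end_sum h u X (Y - {a}) (\<lambda>b. u b a)"
      using less.prems(1) False by (intro end_sum_mult) auto
    finally show ?thesis by (simp add: mult_ac)
  qed
  have "end_sum h u X (insert e Y) \<phi> = \<kappa> * \<phi> e * end_sum h u X Y (\<lambda>b. u b e) +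
      (\<Sum>a\<in>Y. h a (X \<union> (Y - {a})) * \<phi> a * (\<kappa> * u e a * end_sum h u X (Y - {a}) (\<lambda>b. u b a)))"
    unfolding end_sum_insert[OF less.prems(1,3)] using less.prems(5)[of Y] less.prems(6)[OF _ order.refl]
    by (simp add: IH)
  also have "(\<Sum>a\<in>Y. h a (X \<union> (Y - {a})) * \<phi> a * (\<kappa> * u e a * end_sum h u X (Y - {a}) (\<lambda>b. u b a))) =
      \<kappa> * end_sum h u X Y (\<lambda>b. \<phi> b * u e b)"
    using less.prems(1,2) by (simp add: end_sum_rec sum_distrib_left mult_ac)
  also have "end_sum h u X Y (\<lambda>b. \<phi> b * u e b) = end_sum h u X Y (\<lambda>b. (\<phi> b - \<phi> e) * u e b + \<phi> e * u e b)"
    by (intro arg_cong[of _ _ "end_sum h u X Y"]) (simp add: algebra_simps)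
  also have "\<dots> = end_sum h u X Y (\<lambda>b. (\<phi> b - \<phi> e) * u e b) + \<phi> e * end_sum h u X Y (\<lambda>b. u e b)"
    using less.prems(1,2) by (simp add: end_sum_add end_sum_mult)
  also have "end_sum h u X Y (\<lambda>b. u b e) = end_sum h u X Y (\<lambda>b. - 1 * u e b)"
    using less.prems(1,3) inverse_differences_swap[OF less.prems(4), of e] by (intro end_sum_cong) auto
  also have "\<dots> = - end_sum h u X Y (\<lambda>b. u e b)"
    unfolding end_sum_mult[OF less.prems(1,2)] by simp
  finally show ?case by (simp add: algebra_simps)
qed

text \<open>For a simple pole the difference quotient at \<open>e\<close> is
  \<open>\<phi> e * \<phi> b\<close>, so \<open>e\<close> splits off as a factor.\<close>

lemma end_sum_insert_separated_pole:
  assumes "finite Y" "e \<notin> Y" "inverse_differences z u (insert e Y)" "simple_pole z \<phi> (insert e Y)"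
    and "\<And>A. A \<subseteq> Y \<Longrightarrow> h e (X \<union> A) = \<kappa>"
    and "\<And>b A. b \<in> Y \<Longrightarrow> A \<subseteq> Y - {b} \<Longrightarrow> h b (X \<union> insert e A) = h b (X \<union> A)"
  shows "end_sum h u X (insert e Y) \<phi> = \<kappa> * \<phi> e * end_sum h u X Y \<phi>"
proof (cases "Y = {}")
  case True
  then show ?thesis using assms(5)[of "{}"] by simp
next
  case False
  have "end_sum h u X (insert e Y) \<phi> = \<kappa> * end_sum h u X Y (\<lambda>b. (\<phi> b - \<phi> e) * u e b)"
    by (rule end_sum_insert_separated) (use assms False in auto)
  also have "end_sum h u X Y (\<lambda>b. (\<phi> b - \<phi> e) * u e b) = end_sum h u X Y (\<lambda>b. \<phi> e * \<phi> b)"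
  proof (rule end_sum_cong)
    fix b assume "b \<in> Y"
    then show "(\<phi> b - \<phi> e) * u e b = \<phi> e * \<phi> b"
      using assms(2) by (intro simple_pole_quotient[OF assms(3,4)]) auto
  qed (use assms in auto)
  also have "\<dots> = \<phi> e * end_sum h u X Y \<phi>"
    using assms(1) False by (rule end_sum_mult)
  finally show ?thesis
    by (simp only: mult_ac)
qed

text \<open>For the last element \<open>b\<close>, the difference \<open>z x - z b\<close> is the
  sum of the consecutive differences from \<open>x\<close> onwards. Each cancels its factor of
  \<open>u\<close> and thus cuts the ordering after a prefix that contains \<open>x\<close>.\<close>

lemma end_sum_cut:
  assumes "finite Y" "x \<in> Y" "inverse_differences z u Y"
  shows "end_sum h u X Y (\<lambda>b. (z x - z b) * \<phi> b) =
    (\<Sum>A | A \<subset> Y \<and> x \<in> A. end_sum h u X A (\<lambda>_. 1) * end_sum h u (X \<union> A) (Y - A) \<phi>)"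
  using assms
proof (induction "card Y" arbitrary: Y \<phi> rule: less_induct)
  case less
  let ?C = "\<lambda>A. end_sum h u X A (\<lambda>_. 1)"
  have IH: "(z x - z a) * end_sum h u X (Y - {a}) (\<lambda>b. u b a) =
      (\<Sum>A | A \<subseteq> Y - {a} \<and> x \<in> A. ?C A * end_sum h u (X \<union> A) (Y - {a} - A) (\<lambda>b. u b a))" if a: "a \<in> Y" for a
  proof (cases "a = x")
    case True
    then have "{A. A \<subseteq> Y - {a} \<and> x \<in> A} = {}" by auto
    then show ?thesis using True by (simp only:) simp
  next
    case False
    have xa: "x \<in> Y - {a}" using False less.prems by auto
    have "{A. A \<subseteq> Y - {a} \<and> x \<in> A} = insert (Y - {a}) {A. A \<subset> Y - {a} \<and> x \<in> A}"
      using xa by auto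
    moreover have "finite {A. A \<subset> Y - {a} \<and> x \<in> A}"
      using less.prems(1) by (auto intro: finite_subset[of _ "Pow Y"])
    ultimately have "(\<Sum>A | A \<subseteq> Y - {a} \<and> x \<in> A. ?C A * end_sum h u (X \<union> A) (Y - {a} - A) (\<lambda>b. u b a)) =
      ?C (Y - {a}) + (\<Sum>A | A \<subset> Y - {a} \<and> x \<in> A. ?C A * end_sum h u (X \<union> A) (Y - {a} - A) (\<lambda>b. u b a))"
      by simp
    also have "(\<Sum>A | A \<subset> Y - {a} \<and> x \<in> A. ?C A * end_sum h u (X \<union> A) (Y - {a} - A) (\<lambda>b. u b a)) =
       end_sum h u X (Y - {a}) (\<lambda>b. (z x - z b) * u b a)"
    proof (rule less.hyps[symmetric])
      show "card (Y - {a}) < card Y"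
        using less.prems(1) a by (intro card_Diff1_less)
    qed (use less.prems xa in \<open>auto intro: inverse_differences_subset\<close>)
    \<comment> \<open>The cut directly before \<open>a\<close> has prefix \<open>Y - {a}\<close>;
      its term supplies the 1 that turns \<open>z x - z b\<close> into
      \<open>z x - z a\<close>.\<close>
    also have "?C (Y - {a}) + \<dots> = end_sum h u X (Y - {a}) (\<lambda>b. 1 + (z x - z b) * u b a)"
      using less.prems(1) xa by (subst end_sum_add) auto
    also have "\<dots> = end_sum h u X (Y - {a}) (\<lambda>b. (z x - z a) * u b a)"
    proof (rule end_sum_cong)
      fix b assume "b \<in> Y - {a}"
      then have "(z b - z a) * u b a = 1"
        using less.prems a by (auto intro!: inverse_differencesD)
      then show "1 + (z x - z b) * u b a = (z x - z a) * u b a"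
        by (simp add: algebra_simps)
    qed (use less.prems in auto)
    also have "\<dots> = (z x - z a) * end_sum h u X (Y - {a}) (\<lambda>b. u b a)"
      using less.prems(1) xa by (intro end_sum_mult) auto
    finally show ?thesis ..
  qed
  have "end_sum h u X Y (\<lambda>b. (z x - z b) * \<phi> b) =
    (\<Sum>a\<in>Y. h a (X \<union> (Y - {a})) * \<phi> a * ((z x - z a) * end_sum h u X (Y - {a}) (\<lambda>b. u b a)))"
    using less.prems(1,2) by (subst end_sum_rec) (auto simp: mult_ac intro!: sum.cong)
  also have "\<dots> = (\<Sum>a\<in>Y. h a (X \<union> (Y - {a})) * \<phi> a *
      (\<Sum>A | A \<subseteq> Y - {a} \<and> x \<in> A. ?C A * end_sum h u (X \<union> A) (Y - {a} - A) (\<lambda>b. u b a)))"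
    using IH by (intro sum.cong) auto
  also have "\<dots> = (\<Sum>A | A \<subset> Y \<and> x \<in> A. ?C A * end_sum h u (X \<union> A) (Y - A) \<phi>)"
    by (rule sum_cuts_by_last[OF less.prems(1)])
  finally show ?case .
qed

text \<open>Expanding both factors by their last elements \<open>a\<close>, \<open>b\<close>, this is
  \<open>1 / ((a - c) * (b - c)) = 1 / ((a - c) * (b - a)) + 1 / ((b - c) * (a - b))\<close>.\<close>

lemma end_sum_Un:
  assumes "finite Y" "Y = Y1 \<union> Y2" "Y1 \<inter> Y2 = {}" "inverse_differences z u Y" "simple_pole z \<phi> Y"
    and "\<And>a A B. a \<in> Y1 \<Longrightarrow> A \<subseteq> Y1 - {a} \<Longrightarrow> B \<subseteq> Y2 \<Longrightarrow> h a (X \<union> A \<union> B) = h a (X \<union> A)"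
    and "\<And>b A B. b \<in> Y2 \<Longrightarrow> A \<subseteq> Y1 \<Longrightarrow> B \<subseteq> Y2 - {b} \<Longrightarrow> h b (X \<union> A \<union> B) = h b (X \<union> B)"
  shows "end_sum h u X Y \<phi> = end_sum h u X Y1 \<phi> * end_sum h u X Y2 \<phi>"
  using assms
proof (induction "card Y" arbitrary: Y Y1 Y2 \<phi> rule: less_induct)
  case less
  show ?case
  proof (cases "Y1 = {} \<or> Y2 = {}")
    case True
    then show ?thesis using less.prems by auto
  next
    case False
    have fin: "finite Y1" "finite Y2" using less.prems by auto
    have pole: "simple_pole z (\<lambda>b. u b a) (Y - {a})" if "a \<in> Y" for a
      using that by (intro simple_pole_inverse_differences[OF less.prems(4)]) auto
    have IH1: "end_sum h u X (Y - {a}) (\<lambda>b. u b a) =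
        end_sum h u X (Y1 - {a}) (\<lambda>b. u b a) * end_sum h u X Y2 (\<lambda>b. u b a)" if a: "a \<in> Y1" for a
    proof (rule less.hyps)
      show "card (Y - {a}) < card Y"
        using less.prems(1,2) a by (intro card_Diff1_less) auto
      show "simple_pole z (\<lambda>b. u b a) (Y - {a})" using pole less.prems(2) a by auto
      show "h c (X \<union> A \<union> B) = h c (X \<union> A)" if "c \<in> Y1 - {a}" "A \<subseteq> Y1 - {a} - {c}" "B \<subseteq> Y2" for c A B
        using that by (intro less.prems(6)) auto
      show "h c (X \<union> A \<union> B) = h c (X \<union> B)" if "c \<in> Y2" "A \<subseteq> Y1 - {a}" "B \<subseteq> Y2 - {c}" for c A B
        using that by (intro less.prems(7)) auto
    qed (use less.prems(1-5) a in \<open>auto intro: inverse_differences_subset\<close>)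
    have IH2: "end_sum h u X (Y - {a}) (\<lambda>b. u b a) =
        end_sum h u X Y1 (\<lambda>b. u b a) * end_sum h u X (Y2 - {a}) (\<lambda>b. u b a)" if a: "a \<in> Y2" for a
    proof (rule less.hyps)
      show "card (Y - {a}) < card Y"
        using less.prems(1,2) a by (intro card_Diff1_less) auto
      show "simple_pole z (\<lambda>b. u b a) (Y - {a})" using pole less.prems(2) a by auto
      show "h c (X \<union> A \<union> B) = h c (X \<union> A)" if "c \<in> Y1" "A \<subseteq> Y1 - {c}" "B \<subseteq> Y2 - {a}" for c A B
        using that by (intro less.prems(6)) auto
      show "h c (X \<union> A \<union> B) = h c (X \<union> B)" if "c \<in> Y2 - {a}" "A \<subseteq> Y1" "B \<subseteq> Y2 - {a} - {c}" for c A B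
        using that by (intro less.prems(7)) auto
    qed (use less.prems(1-5) a in \<open>auto intro: inverse_differences_subset\<close>)
    define p where "p a = h a (X \<union> (Y1 - {a})) * end_sum h u X (Y1 - {a}) (\<lambda>b. u b a)" for a
    define q where "q b = h b (X \<union> (Y2 - {b})) * end_sum h u X (Y2 - {b}) (\<lambda>c. u c b)" for b
    have T1: "end_sum h u X Y1 \<psi> = (\<Sum>a\<in>Y1. p a * \<psi> a)" for \<psi>
      using fin False by (subst end_sum_rec) (auto simp: p_def mult_ac)
    have T2: "end_sum h u X Y2 \<psi> = (\<Sum>b\<in>Y2. q b * \<psi> b)" for \<psi>
      using fin False by (subst end_sum_rec) (auto simp: q_def mult_ac)
    have h1: "h a (X \<union> (Y - {a})) = h a (X \<union> (Y1 - {a}))" if "a \<in> Y1" for a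
    proof -
      have "X \<union> (Y - {a}) = X \<union> (Y1 - {a}) \<union> Y2" using that less.prems by auto
      then show ?thesis using less.prems(6)[of a "Y1 - {a}" Y2] that by simp
    qed
    have h2: "h a (X \<union> (Y - {a})) = h a (X \<union> (Y2 - {a}))" if "a \<in> Y2" for a
    proof -
      have "X \<union> (Y - {a}) = X \<union> Y1 \<union> (Y2 - {a})" using that less.prems by auto
      then show ?thesis using less.prems(7)[of a Y1 "Y2 - {a}"] that by simp
    qed
    have "end_sum h u X Y \<phi> = (\<Sum>a\<in>Y. h a (X \<union> (Y - {a})) * \<phi> a * end_sum h u X (Y - {a}) (\<lambda>b. u b a))"
      using less.prems False by (intro end_sum_rec) auto
    also have "\<dots> = (\<Sum>a\<in>Y1. h a (X \<union> (Y - {a})) * \<phi> a * end_sum h u X (Y - {a}) (\<lambda>b. u b a)) +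
       (\<Sum>a\<in>Y2. h a (X \<union> (Y - {a})) * \<phi> a * end_sum h u X (Y - {a}) (\<lambda>b. u b a))"
      unfolding less.prems(2) using fin less.prems(3) by (rule sum.union_disjoint)
    also have "(\<Sum>a\<in>Y1. h a (X \<union> (Y - {a})) * \<phi> a * end_sum h u X (Y - {a}) (\<lambda>b. u b a)) =
       (\<Sum>a\<in>Y1. \<Sum>b\<in>Y2. p a * q b * (\<phi> a * u b a))"
      by (intro sum.cong refl) (auto simp: h1 IH1 p_def T2 sum_distrib_left sum_distrib_right mult_ac)
    also have "(\<Sum>a\<in>Y2. h a (X \<union> (Y - {a})) * \<phi> a * end_sum h u X (Y - {a}) (\<lambda>b. u b a)) =
       (\<Sum>b\<in>Y2. \<Sum>a\<in>Y1. p a * q b * (\<phi> b * u a b))"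
      by (intro sum.cong refl) (auto simp: h2 IH2 q_def T1 sum_distrib_left sum_distrib_right mult_ac)
    also have "(\<Sum>b\<in>Y2. \<Sum>a\<in>Y1. p a * q b * (\<phi> b * u a b)) = (\<Sum>a\<in>Y1. \<Sum>b\<in>Y2. p a * q b * (\<phi> b * u a b))"
      by (rule sum.swap)
    also have "(\<Sum>a\<in>Y1. \<Sum>b\<in>Y2. p a * q b * (\<phi> a * u b a)) + \<dots> =
       (\<Sum>a\<in>Y1. \<Sum>b\<in>Y2. p a * q b * (\<phi> a * \<phi> b))"
      unfolding sum.distrib[symmetric]
    proof (intro sum.cong refl)
      fix a b assume ab: "a \<in> Y1" "b \<in> Y2"
      then have ne: "a \<noteq> b" "a \<in> Y" "b \<in> Y" using less.prems by auto
      have "\<phi> a * u b a + \<phi> b * u a b = (\<phi> b - \<phi> a) * u a b"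
        using inverse_differences_swap[OF less.prems(4) ne(2,3,1)] by (simp add: algebra_simps)
      also have "\<dots> = \<phi> a * \<phi> b"
        using ne by (intro simple_pole_quotient[OF less.prems(4,5)])
      finally show "p a * q b * (\<phi> a * u b a) + p a * q b * (\<phi> b * u a b) = p a * q b * (\<phi> a * \<phi> b)"
        by (simp add: distrib_left[symmetric])
    qed
    also have "\<dots> = end_sum h u X Y1 \<phi> * end_sum h u X Y2 \<phi>"
      by (simp add: T1 T2 sum_product mult_ac)
    finally show ?thesis .
  qed
qed
section \<open>Deletion of an element\<close>

text \<open>Separate from \<open>matroid\<close>, so that contractions and the free coextension are
  instances without any description of their independent sets.\<close>

locale rank_function =
  fixes \<rho> :: "'a set \<Rightarrow> nat"
  assumes rank_empty: "\<rho> {} = 0"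
    and rank_mono: "A \<subseteq> B \<Longrightarrow> \<rho> A \<le> \<rho> B"
    and rank_insert_le: "\<rho> (insert a A) \<le> Suc (\<rho> A)"
    and rank_submodular: "\<rho> (A \<union> B) + \<rho> (A \<inter> B) \<le> \<rho> A + \<rho> B"
begin

lemma rank_insert_cases: "\<rho> (insert a A) = \<rho> A \<or> \<rho> (insert a A) = Suc (\<rho> A)"
  using rank_insert_le[of a A] rank_mono[OF subset_insertI, of A a] by linarith

lemma spanned_mono:
  assumes "\<rho> (insert a A) = \<rho> A" "A \<subseteq> B"
  shows "\<rho> (insert a B) = \<rho> B"
proof -
  have "\<rho> (insert a A \<union> B) + \<rho> (insert a A \<inter> B) \<le> \<rho> (insert a A) + \<rho> B"
    by (rule rank_submodular)
  moreover have "insert a A \<union> B = insert a B" using assms(2) by auto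
  moreover have "\<rho> A \<le> \<rho> (insert a A \<inter> B)" using assms(2) by (intro rank_mono) auto
  moreover have "\<rho> B \<le> \<rho> (insert a B)" by (intro rank_mono) auto
  ultimately show ?thesis using assms(1) by simp
qed

lemma rank_le_card: "finite A \<Longrightarrow> \<rho> (X \<union> A) \<le> \<rho> X + card A"
proof (induction A rule: finite_induct)
  case (insert a A)
  then show ?case using rank_insert_le[of a "X \<union> A"] by simp
qed simp

end

text \<open>If \<open>A\<close> consists of the predecessors of \<open>a\<close> in an ordering, the
  first case says that the greedy basis skips \<open>a\<close>.\<close>

definition rank_weight :: "('a set \<Rightarrow> nat) \<Rightarrow> ('a \<Rightarrow> 'k) \<Rightarrow> 'a \<Rightarrow> 'a set \<Rightarrow> 'k::comm_ring_1" where
  "rank_weight \<rho> g a A = (if \<rho> (insert a A) = \<rho> A then g a else 1)"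

context rank_function
begin

text \<open>A loop of the contraction by \<open>X\<close> is skipped wherever it stands, and its
  presence in a prefix changes no rank.\<close>

lemma end_sum_insert_loop:
  assumes "finite Y" "Y \<noteq> {}" "e \<notin> Y" "inverse_differences z u (insert e Y)" "\<rho> (insert e X) = \<rho> X"
  shows "end_sum (rank_weight \<rho> g) u X (insert e Y) \<phi> =
    g e * end_sum (rank_weight \<rho> g) u X Y (\<lambda>b. (\<phi> b - \<phi> e) * u e b)"
proof (rule end_sum_insert_separated)
  have sp: "\<rho> (insert e B) = \<rho> B" if "X \<subseteq> B" for B
    using assms(5) that by (rule spanned_mono)
  show "rank_weight \<rho> g e (X \<union> A) = g e" for A
    using sp[of "X \<union> A"] by (simp add: rank_weight_def)
  show "rank_weight \<rho> g b (X \<union> insert e A) = rank_weight \<rho> g b (X \<union> A)" for b A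
    using sp[of "X \<union> A"] sp[of "insert b (X \<union> A)"] by (simp add: rank_weight_def insert_commute subset_insertI2)
qed (use assms in auto)

text \<open>An element outside the span of \<open>X \<union> Y\<close> is never skipped, and its
  presence in a prefix raises by 1 both of the ranks that decide whether \<open>b\<close> is
  skipped.\<close>

lemma rank_weight_insert_coloop:
  assumes "\<rho> (insert e (X \<union> Y)) \<noteq> \<rho> (X \<union> Y)"
  shows "A \<subseteq> Y \<Longrightarrow> rank_weight \<rho> g e (X \<union> A) = 1"
    and "b \<in> Y \<Longrightarrow> A \<subseteq> Y - {b} \<Longrightarrow> rank_weight \<rho> g b (X \<union> insert e A) = rank_weight \<rho> g b (X \<union> A)"
proof -
  have sp: "\<rho> (insert e B) = Suc (\<rho> B)" if "B \<subseteq> X \<union> Y" for B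
    using assms spanned_mono[OF _ that, of e] rank_insert_cases[of e B] by auto
  show "rank_weight \<rho> g e (X \<union> A) = 1" if "A \<subseteq> Y"
    using that sp[of "X \<union> A"] by (simp add: rank_weight_def le_supI2)
  show "rank_weight \<rho> g b (X \<union> insert e A) = rank_weight \<rho> g b (X \<union> A)" if "b \<in> Y" "A \<subseteq> Y - {b}"
  proof -
    have "\<rho> (insert e (X \<union> A)) = Suc (\<rho> (X \<union> A))" "\<rho> (insert e (insert b (X \<union> A))) = Suc (\<rho> (insert b (X \<union> A)))"
      by (rule sp; use that in auto)+
    then show ?thesis by (auto simp: rank_weight_def insert_commute)
  qed
qed

lemma end_sum_insert_coloop:
  assumes "finite Y" "Y \<noteq> {}" "e \<notin> Y" "inverse_differences z u (insert e Y)" "\<rho> (insert e (X \<union> Y)) \<noteq> \<rho> (X \<union> Y)"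
  shows "end_sum (rank_weight \<rho> g) u X (insert e Y) \<phi> =
    end_sum (rank_weight \<rho> g) u X Y (\<lambda>b. (\<phi> b - \<phi> e) * u e b)"
  using end_sum_insert_separated[of Y e z u "rank_weight \<rho> g" X 1 \<phi>,
    OF assms(1-4) rank_weight_insert_coloop[OF assms(5)]] by simp

lemma end_sum_insert_coloop_pole:
  assumes "finite Y" "e \<notin> Y" "inverse_differences z u (insert e Y)" "simple_pole z \<phi> (insert e Y)"
    "\<rho> (insert e (X \<union> Y)) \<noteq> \<rho> (X \<union> Y)"
  shows "end_sum (rank_weight \<rho> g) u X (insert e Y) \<phi> = \<phi> e * end_sum (rank_weight \<rho> g) u X Y \<phi>"
  using end_sum_insert_separated_pole[of Y e z u \<phi> "rank_weight \<rho> g" X 1,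
    OF assms(1-4) rank_weight_insert_coloop[OF assms(5)]] by simp

text \<open>In an ordering of \<open>Y\<close> let \<open>c\<close> be the element with whose
  arrival the prefix starts to span \<open>e\<close>. Placed before \<open>c\<close>, the element
  \<open>e\<close> enters the basis and \<open>c\<close> is skipped instead; placed after
  \<open>c\<close>, \<open>e\<close> itself is skipped. Over both ranges the positions of
  \<open>e\<close> telescope, and at \<open>c\<close> they leave
  \<open>(g c - g e) * u e c = p - z e - z c\<close>. With \<open>b\<close> the last element,
  \<open>z c\<close> is \<open>z b\<close> plus the consecutive differences from \<open>c\<close> to
  \<open>b\<close>, and these cut the ordering after each proper prefix that spans
  \<open>e\<close>.\<close>

lemma end_sum_delete:
  fixes z :: "'a \<Rightarrow> 'k::comm_ring_1" and u p
  defines "g \<equiv> \<lambda>a. z a * (z a - p)"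
  defines "G \<equiv> end_sum (rank_weight \<rho> g) u"
  assumes "finite Y" "Y \<noteq> {}" "e \<notin> Y" "inverse_differences z u (insert e Y)"
    and "\<rho> (insert e X) \<noteq> \<rho> X" "\<rho> (insert e (X \<union> Y)) = \<rho> (X \<union> Y)"
  shows "G X (insert e Y) \<phi> = - G X Y (\<lambda>b. (z e + z b - p) * \<phi> b - g e * ((\<phi> b - \<phi> e) * u e b)) -
    (\<Sum>A | A \<subset> Y \<and> A \<noteq> {} \<and> \<rho> (insert e (X \<union> A)) = \<rho> (X \<union> A). G X A (\<lambda>_. 1) * G (X \<union> A) (Y - A) \<phi>)"
  using assms(3-)
proof (induction "card Y" arbitrary: Y \<phi> rule: less_induct)
  case less
  let ?h = "rank_weight \<rho> g"
  let ?P = "\<lambda>A. A \<noteq> {} \<and> \<rho> (insert e (X \<union> A)) = \<rho> (X \<union> A)"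
  define S where "S a = (\<Sum>A | A \<subseteq> Y - {a} \<and> ?P A. G X A (\<lambda>_. 1) * G (X \<union> A) (Y - {a} - A) (\<lambda>b. u b a))" for a
  have fin: "finite {A. A \<subseteq> B \<and> ?P A}" "finite {A. A \<subset> B \<and> ?P A}" if "B \<subseteq> Y" for B
    using less.prems(1) that by (auto intro: finite_subset[of _ "Pow Y"])
  have step: "?h a (X \<union> insert e (Y - {a})) * G X (insert e (Y - {a})) (\<lambda>b. u b a) =
      ?h a (X \<union> (Y - {a})) * ((g e * u e a - (z e + z a - p)) * G X (Y - {a}) (\<lambda>b. u b a) - S a)" if a: "a \<in> Y" for a
  proof (cases "\<rho> (insert e (X \<union> (Y - {a}))) = \<rho> (X \<union> (Y - {a}))")
    case True
    have ne: "Y - {a} \<noteq> {}"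
    proof
      assume "Y - {a} = {}"
      then show False using True less.prems(5) unfolding \<open>Y - {a} = {}\<close> by simp
    qed
    have "\<rho> (insert e (X \<union> (Y - {a}))) = \<rho> (X \<union> (Y - {a}))" "\<rho> (insert e (insert a (X \<union> (Y - {a})))) = \<rho> (insert a (X \<union> (Y - {a})))"
      using True by (auto intro: spanned_mono)
    then have h: "?h a (X \<union> insert e (Y - {a})) = ?h a (X \<union> (Y - {a}))"
      by (auto simp: rank_weight_def insert_commute)
    have pole: "(u b a - u e a) * u e b = u e a * u b a" if "b \<in> Y - {a}" for b
    proof -
      have "simple_pole z (\<lambda>b. u b a) (insert e Y - {a})"
        by (rule simple_pole_inverse_differences[OF less.prems(4)]) (use a in auto)
      moreover have "inverse_differences z u (insert e Y - {a})"
        by (rule inverse_differences_subset[OF less.prems(4)]) auto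
      ultimately show ?thesis
        using simple_pole_quotient[of z u "insert e Y - {a}" "\<lambda>b. u b a" e b] a that less.prems(3) by blast
    qed
    have "G X (insert e (Y - {a})) (\<lambda>b. u b a) =
        - G X (Y - {a}) (\<lambda>b. (z e + z b - p) * u b a - g e * ((u b a - u e a) * u e b)) -
        (\<Sum>A | A \<subset> Y - {a} \<and> ?P A. G X A (\<lambda>_. 1) * G (X \<union> A) (Y - {a} - A) (\<lambda>b. u b a))"
    proof (rule less.hyps)
      show "card (Y - {a}) < card Y"
        using less.prems(1) a by (intro card_Diff1_less)
      show "inverse_differences z u (insert e (Y - {a}))"
        by (rule inverse_differences_subset[OF less.prems(4)]) auto
    qed (use less.prems ne True in auto)
    also have "G X (Y - {a}) (\<lambda>b. (z e + z b - p) * u b a - g e * ((u b a - u e a) * u e b)) =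
        G X (Y - {a}) (\<lambda>b. 1 + (z e + z a - p - g e * u e a) * u b a)"
      unfolding G_def
    proof (rule end_sum_cong)
      fix b assume b: "b \<in> Y - {a}"
      then have "(z b - z a) * u b a = 1"
        using less.prems a by (auto intro!: inverse_differencesD)
      then show "(z e + z b - p) * u b a - g e * ((u b a - u e a) * u e b) = 1 + (z e + z a - p - g e * u e a) * u b a"
        unfolding pole[OF b] by (simp add: algebra_simps)
    qed (use less.prems in auto)
    also have "\<dots> = G X (Y - {a}) (\<lambda>_. 1) + (z e + z a - p - g e * u e a) * G X (Y - {a}) (\<lambda>b. u b a)"
      unfolding G_def using less.prems(1) ne by (simp add: end_sum_add end_sum_mult)
    finally have eq: "G X (insert e (Y - {a})) (\<lambda>b. u b a) = (g e * u e a - (z e + z a - p)) * G X (Y - {a}) (\<lambda>b. u b a) -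
       (G X (Y - {a}) (\<lambda>_. 1) + (\<Sum>A | A \<subset> Y - {a} \<and> ?P A. G X A (\<lambda>_. 1) * G (X \<union> A) (Y - {a} - A) (\<lambda>b. u b a)))"
      by (simp add: algebra_simps)
    \<comment> \<open>The isolated term \<open>G X (Y - {a}) (\<lambda>_. 1)\<close> is the cut
      directly before \<open>a\<close>, which the induction hypothesis for \<open>Y - {a}\<close>
      lacks.\<close>
    have "{A. A \<subseteq> Y - {a} \<and> ?P A} = insert (Y - {a}) {A. A \<subset> Y - {a} \<and> ?P A}"
      using ne True by auto
    then have "S a = G X (Y - {a}) (\<lambda>_. 1) + (\<Sum>A | A \<subset> Y - {a} \<and> ?P A. G X A (\<lambda>_. 1) * G (X \<union> A) (Y - {a} - A) (\<lambda>b. u b a))"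
      unfolding S_def using fin(2)[of "Y - {a}"] by (simp add: G_def)
    then show ?thesis
      unfolding eq h by simp
  next
    case False
    \<comment> \<open>Now the last element \<open>a\<close> is the one that completes the span of
      \<open>e\<close>: without \<open>e\<close> it belongs to the basis, after \<open>e\<close> it
      is skipped.\<close>
    have rk: "\<rho> (insert e (X \<union> (Y - {a}))) = Suc (\<rho> (X \<union> (Y - {a})))"
      using False rank_insert_cases by blast
    have Ya: "insert a (X \<union> (Y - {a})) = X \<union> Y" using a by auto
    have "\<rho> (insert e (X \<union> (Y - {a}))) \<le> \<rho> (insert e (X \<union> Y))"
      by (intro rank_mono) auto
    then have rk2: "\<rho> (X \<union> Y) = Suc (\<rho> (X \<union> (Y - {a})))"
      using rk less.prems(6) rank_insert_cases[of a "X \<union> (Y - {a})"] unfolding Ya by auto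
    have Yea: "insert a (insert e (X \<union> (Y - {a}))) = insert e (X \<union> Y)" using a by auto
    have h: "?h a (X \<union> insert e (Y - {a})) = g a" "?h a (X \<union> (Y - {a})) = 1"
      using rk rk2 less.prems(6) by (simp_all add: rank_weight_def Ya Yea)
    have pole: "G X (insert e (Y - {a})) (\<lambda>b. u b a) = u e a * G X (Y - {a}) (\<lambda>b. u b a)"
      unfolding G_def
    proof (rule end_sum_insert_coloop_pole)
      show "inverse_differences z u (insert e (Y - {a}))"
        by (rule inverse_differences_subset[OF less.prems(4)]) auto
      show "simple_pole z (\<lambda>b. u b a) (insert e (Y - {a}))"
        by (rule simple_pole_inverse_differences[OF less.prems(4)]) (use a less.prems(3) in auto)
    qed (use less.prems False in auto)
    have "{A. A \<subseteq> Y - {a} \<and> ?P A} = {}"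
    proof -
      have "\<rho> (insert e (X \<union> A)) \<noteq> \<rho> (X \<union> A)" if "A \<subseteq> Y - {a}" for A
        using False spanned_mono[of e "X \<union> A" "X \<union> (Y - {a})"] that by auto
      then show ?thesis by auto
    qed
    then have "S a = 0" unfolding S_def by (simp only:) simp
    moreover have "(z e - z a) * u e a = 1"
      using less.prems a by (auto intro!: inverse_differencesD)
    \<comment> \<open>Here the quadratic form of \<open>g\<close> enters:
      \<open>g a - g e = (z a - z e) * (z a + z e - p)\<close>.\<close>
    then have "g a * u e a = g e * u e a - (z e + z a - p) * ((z e - z a) * u e a)"
      by (simp add: g_def algebra_simps)
    then have "g a * u e a = g e * u e a - (z e + z a - p)"
      using \<open>(z e - z a) * u e a = 1\<close> by simp
    ultimately show ?thesis
      unfolding h pole by (simp add: mult.assoc[symmetric])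
  qed
  have "G X (insert e Y) \<phi> = g e * \<phi> e * G X Y (\<lambda>b. u b e) +
     (\<Sum>a\<in>Y. \<phi> a * (?h a (X \<union> insert e (Y - {a})) * G X (insert e (Y - {a})) (\<lambda>b. u b a)))"
    using less.prems(6) unfolding G_def end_sum_insert[OF less.prems(1,3)]
    by (simp add: rank_weight_def mult_ac)
  also have "\<dots> = g e * \<phi> e * G X Y (\<lambda>b. u b e) +
     (\<Sum>a\<in>Y. ?h a (X \<union> (Y - {a})) * (g e * u e a * \<phi> a - (z e + z a - p) * \<phi> a) * G X (Y - {a}) (\<lambda>b. u b a) -
        ?h a (X \<union> (Y - {a})) * \<phi> a * S a)"
    by (intro arg_cong2[where f = "(+)"] sum.cong refl) (simp only: step, simp add: algebra_simps)
  also have "\<dots> = g e * \<phi> e * G X Y (\<lambda>b. u b e) + G X Y (\<lambda>b. g e * u e b * \<phi> b - (z e + z b - p) * \<phi> b) -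
     (\<Sum>a\<in>Y. ?h a (X \<union> (Y - {a})) * \<phi> a * S a)"
    unfolding G_def end_sum_rec[OF less.prems(1,2), of ?h u X "\<lambda>b. g e * u e b * \<phi> b - (z e + z b - p) * \<phi> b"]
    by (simp add: sum_subtractf)
  also have "g e * \<phi> e * G X Y (\<lambda>b. u b e) = G X Y (\<lambda>b. g e * \<phi> e * u b e)"
    unfolding G_def end_sum_mult[OF less.prems(1,2)] by simp
  also have "G X Y (\<lambda>b. g e * \<phi> e * u b e) + G X Y (\<lambda>b. g e * u e b * \<phi> b - (z e + z b - p) * \<phi> b) =
      G X Y (\<lambda>b. g e * \<phi> e * u b e + (g e * u e b * \<phi> b - (z e + z b - p) * \<phi> b))"
    unfolding G_def end_sum_add[OF less.prems(1,2)] by simp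
  also have "\<dots> = G X Y (\<lambda>b. - 1 * ((z e + z b - p) * \<phi> b - g e * ((\<phi> b - \<phi> e) * u e b)))"
    unfolding G_def
  proof (rule end_sum_cong)
    fix b assume "b \<in> Y"
    then have "u b e = - u e b"
      using less.prems(3) by (intro inverse_differences_swap[OF less.prems(4)]) auto
    then show "g e * \<phi> e * u b e + (g e * u e b * \<phi> b - (z e + z b - p) * \<phi> b) =
        - 1 * ((z e + z b - p) * \<phi> b - g e * ((\<phi> b - \<phi> e) * u e b))"
      by (simp add: algebra_simps)
  qed (use less.prems in auto)
  also have "\<dots> = - G X Y (\<lambda>b. (z e + z b - p) * \<phi> b - g e * ((\<phi> b - \<phi> e) * u e b))"
    unfolding G_def end_sum_mult[OF less.prems(1,2)] by simp
  also have "(\<Sum>a\<in>Y. ?h a (X \<union> (Y - {a})) * \<phi> a * S a) =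
      (\<Sum>A | A \<subset> Y \<and> ?P A. G X A (\<lambda>_. 1) * G (X \<union> A) (Y - A) \<phi>)"
    unfolding S_def G_def by (rule sum_cuts_by_last[OF less.prems(1)])
  finally show ?case .
qed

text \<open>For \<open>\<phi> b = 1 / (z b - p)\<close> the right hand side of the deletion formula does not involve \<open>z e\<close>.\<close>

lemma end_sum_delete_pole:
  fixes z :: "'a \<Rightarrow> 'k::comm_ring_1" and u p
  defines "g \<equiv> \<lambda>a. z a * (z a - p)"
  defines "G \<equiv> end_sum (rank_weight \<rho> g) u"
  assumes "finite Y" "Y \<noteq> {}" "e \<notin> Y" "inverse_differences z u (insert e Y)"
    and "\<rho> (insert e X) \<noteq> \<rho> X" "\<rho> (insert e (X \<union> Y)) = \<rho> (X \<union> Y)"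
    and \<phi>: "\<And>b. b \<in> insert e Y \<Longrightarrow> (z b - p) * \<phi> b = 1"
  shows "G X (insert e Y) \<phi> =
    - (\<Sum>A | A \<subseteq> Y \<and> A \<noteq> {} \<and> \<rho> (insert e (X \<union> A)) = \<rho> (X \<union> A). G X A (\<lambda>_. 1) * G (X \<union> A) (Y - A) \<phi>)"
proof -
  let ?P = "\<lambda>A. A \<noteq> {} \<and> \<rho> (insert e (X \<union> A)) = \<rho> (X \<union> A)"
  have "G X (insert e Y) \<phi> = - G X Y (\<lambda>b. (z e + z b - p) * \<phi> b - g e * ((\<phi> b - \<phi> e) * u e b)) -
    (\<Sum>A | A \<subset> Y \<and> ?P A. G X A (\<lambda>_. 1) * G (X \<union> A) (Y - A) \<phi>)"
    unfolding G_def g_def by (rule end_sum_delete) (use assms in auto)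
  also have "G X Y (\<lambda>b. (z e + z b - p) * \<phi> b - g e * ((\<phi> b - \<phi> e) * u e b)) = G X Y (\<lambda>_. 1)"
    unfolding G_def
  proof (rule end_sum_cong)
    fix b assume b: "b \<in> Y"
    have 1: "(z b - p) * \<phi> b = 1" "(z e - p) * \<phi> e = 1" "(z e - z b) * u e b = 1"
      using b assms(5) by (auto intro!: \<phi> inverse_differencesD[OF assms(6)])
    have "\<phi> b - \<phi> e = (((z e - p) * \<phi> e) * \<phi> b - ((z b - p) * \<phi> b) * \<phi> e)"
      unfolding 1 by simp
    also have "\<dots> = (z e - z b) * (\<phi> e * \<phi> b)" by (simp add: algebra_simps)
    finally have "(\<phi> b - \<phi> e) * u e b = ((z e - z b) * u e b) * (\<phi> e * \<phi> b)" by (simp only: mult_ac)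
    then have "g e * ((\<phi> b - \<phi> e) * u e b) = g e * (\<phi> e * \<phi> b)"
      unfolding 1 by simp
    also have "\<dots> = z e * ((z e - p) * \<phi> e) * \<phi> b"
      by (simp add: g_def mult_ac)
    finally have "g e * ((\<phi> b - \<phi> e) * u e b) = z e * \<phi> b"
      unfolding 1 by simp
    then show "(z e + z b - p) * \<phi> b - g e * ((\<phi> b - \<phi> e) * u e b) = 1"
      using 1(1) by (simp add: algebra_simps)
  qed (use assms in auto)
  \<comment> \<open>The first term is what the cut formula would give for \<open>A = Y\<close>, so
    it joins the sum.\<close>
  finally have eq: "G X (insert e Y) \<phi> = - (G X Y (\<lambda>_. 1) +
    (\<Sum>A | A \<subset> Y \<and> ?P A. G X A (\<lambda>_. 1) * G (X \<union> A) (Y - A) \<phi>))" by simp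
  have "{A. A \<subseteq> Y \<and> ?P A} = insert Y {A. A \<subset> Y \<and> ?P A}"
    using assms(4,8) by auto
  moreover have "finite {A. A \<subset> Y \<and> ?P A}"
    using assms(3) by (auto intro: finite_subset[of _ "Pow Y"])
  ultimately show ?thesis
    unfolding eq by (simp add: G_def)
qed

end
section \<open>Degrees and leading coefficients\<close>

text \<open>Only closure is required, so this covers homogeneous polynomials as well as
  \<open>grading_trivial\<close>, where lying in a negative degree means being 0. One induction thus
  gives both integrality and vanishing for reasons of degree.\<close>

definition grading :: "(int \<Rightarrow> 'k::comm_ring_1 set) \<Rightarrow> bool" where
  "grading R \<longleftrightarrow> 1 \<in> R 0 \<and> (\<forall>d. 0 \<in> R d \<and> (\<forall>x\<in>R d. - x \<in> R d \<and> (\<forall>y\<in>R d. x + y \<in> R d))) \<and>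
     (\<forall>c d. \<forall>x\<in>R c. \<forall>y\<in>R d. x * y \<in> R (c + d))"

lemma
  assumes "grading R"
  shows grading_one: "1 \<in> R 0"
    and grading_zero: "0 \<in> R d"
    and grading_uminus: "x \<in> R d \<Longrightarrow> - x \<in> R d"
    and grading_add: "x \<in> R d \<Longrightarrow> y \<in> R d \<Longrightarrow> x + y \<in> R d"
    and grading_mult: "x \<in> R c \<Longrightarrow> y \<in> R d \<Longrightarrow> x * y \<in> R (c + d)"
  using assms unfolding grading_def by blast+

lemma grading_diff: "grading R \<Longrightarrow> x \<in> R d \<Longrightarrow> y \<in> R d \<Longrightarrow> x - y \<in> R d"
  using grading_add[of R x d "- y"] grading_uminus[of R y d] by simp

lemma grading_sum: "grading R \<Longrightarrow> (\<And>a. a \<in> A \<Longrightarrow> f a \<in> R d) \<Longrightarrow> sum f A \<in> R d"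
  by (induction A rule: infinite_finite_induct) (auto intro: grading_zero grading_add)

lemma grading_trivial: "grading (\<lambda>d. if d < 0 then {0} else UNIV)"
  by (auto simp: grading_def)

definition graded_poly :: "(int \<Rightarrow> 'k::comm_ring_1 set) \<Rightarrow> int \<Rightarrow> 'k poly \<Rightarrow> bool" where
  "graded_poly R k q \<longleftrightarrow> (\<forall>i. coeff q i \<in> R (k - int i))"

lemma graded_poly_pCons: "graded_poly R k (pCons a q) \<longleftrightarrow> a \<in> R k \<and> graded_poly R (k - 1) q"
proof -
  have "(\<forall>i. coeff (pCons a q) i \<in> R (k - int i)) \<longleftrightarrow>
    coeff (pCons a q) 0 \<in> R (k - int 0) \<and> (\<forall>i. coeff (pCons a q) (Suc i) \<in> R (k - int (Suc i)))"
    by (metis not0_implies_Suc)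
  then show ?thesis by (simp add: graded_poly_def algebra_simps)
qed

lemma graded_poly_add:
  "grading R \<Longrightarrow> graded_poly R k q \<Longrightarrow> graded_poly R k q' \<Longrightarrow> graded_poly R k (q + q')"
  by (simp add: graded_poly_def grading_add)

lemma graded_poly_smult:
  "grading R \<Longrightarrow> c \<in> R j \<Longrightarrow> graded_poly R k q \<Longrightarrow> graded_poly R (j + k) (smult c q)"
  using grading_mult[of R c j] by (fastforce simp: graded_poly_def algebra_simps)

lemma graded_poly_linear_mult:
  assumes "grading R" "c \<in> R 1" "graded_poly R k q"
  shows "graded_poly R (k + 1) ([:c, 1:] * q)"
  using assms graded_poly_smult[OF assms]
  by (simp add: graded_poly_add graded_poly_pCons grading_zero add.commute)

lemma graded_poly_synthetic_div:
  assumes "grading R" "c \<in> R 1"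
  shows "graded_poly R k q \<Longrightarrow> poly q c \<in> R k \<and> graded_poly R (k - 1) (synthetic_div q c)"
proof (induction q arbitrary: k)
  case 0
  then show ?case by (simp add: grading_zero[OF assms(1)] graded_poly_def)
next
  case (pCons a q)
  then have *: "a \<in> R k" "poly q c \<in> R (k - 1)" "graded_poly R (k - 1 - 1) (synthetic_div q c)"
    using pCons.IH[of "k - 1"] by (auto simp: graded_poly_pCons)
  then show ?case
    using grading_add[OF assms(1) *(1)] grading_mult[OF assms(1,2) *(2)]
    by (simp add: graded_poly_pCons)
qed

lemma poly_difference_quotient:
  fixes q :: "'k::comm_ring_1 poly"
  assumes "(x - y) * v = 1"
  shows "(poly q y - poly q x) * v = - poly (synthetic_div q x) y"
proof -
  have "poly q y = poly ([:- x, 1:] * synthetic_div q x + [:poly q x:]) y"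
    by (simp only: synthetic_div_correct')
  then have eq: "poly q y - poly q x = - (x - y) * poly (synthetic_div q x) y"
    by (simp add: algebra_simps)
  have "(poly q y - poly q x) * v = - ((x - y) * v) * poly (synthetic_div q x) y"
    unfolding eq by (simp add: algebra_simps)
  then show ?thesis using assms by simp
qed

context rank_function
begin

text \<open>Polynomial end weights stay polynomial under deletion, because the difference quotient
  is a synthetic division; no \<open>u e b\<close> is left.\<close>

lemma end_sum_delete_poly:
  fixes z :: "'a \<Rightarrow> 'k::comm_ring_1" and u p
  defines "g \<equiv> \<lambda>a. z a * (z a - p)"
  defines "G \<equiv> end_sum (rank_weight \<rho> g) u"
  assumes "finite Y" "Y \<noteq> {}" "e \<notin> Y" "inverse_differences z u (insert e Y)"
    and "\<rho> (insert e X) \<noteq> \<rho> X" "\<rho> (insert e (X \<union> Y)) = \<rho> (X \<union> Y)"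
  shows "G X (insert e Y) (\<lambda>b. poly q (z b)) =
    - G X Y (\<lambda>b. poly ([:z e - p, 1:] * q + smult (g e) (synthetic_div q (z e))) (z b)) -
    (\<Sum>A | A \<subset> Y \<and> A \<noteq> {} \<and> \<rho> (insert e (X \<union> A)) = \<rho> (X \<union> A).
       G X A (\<lambda>_. 1) * G (X \<union> A) (Y - A) (\<lambda>b. poly q (z b)))"
proof -
  have "G X Y (\<lambda>b. (z e + z b - p) * poly q (z b) - g e * ((poly q (z b) - poly q (z e)) * u e b)) =
      G X Y (\<lambda>b. poly ([:z e - p, 1:] * q + smult (g e) (synthetic_div q (z e))) (z b))"
    unfolding G_def
  proof (rule end_sum_cong)
    fix b assume "b \<in> Y"
    then have "(z e - z b) * u e b = 1"
      using assms(5) by (intro inverse_differencesD[OF assms(6)]) auto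
    then show "(z e + z b - p) * poly q (z b) - g e * ((poly q (z b) - poly q (z e)) * u e b) =
        poly ([:z e - p, 1:] * q + smult (g e) (synthetic_div q (z e))) (z b)"
      unfolding poly_difference_quotient[OF \<open>(z e - z b) * u e b = 1\<close>] by (simp add: algebra_simps)
  qed (use assms in auto)
  then show ?thesis
    using end_sum_delete[OF assms(3-8), of p "\<lambda>b. poly q (z b)"] unfolding G_def g_def by simp
qed

text \<open>The degree is the one of a single ordering: 2 for each skipped element, -1 for each
  consecutive pair, and \<open>k\<close> for \<open>q\<close>. The content is that denominators
  cancel: nothing is assumed about \<open>u\<close> in terms of \<open>R\<close>, but the deletion
  formulas build the sum from \<open>z\<close>, \<open>p\<close> and the coefficients of
  \<open>q\<close> by ring operations.\<close>

lemma end_sum_graded: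
  fixes z :: "'a \<Rightarrow> 'k::comm_ring_1" and u p
  defines "g \<equiv> \<lambda>a. z a * (z a - p)"
  assumes R: "grading R" "p \<in> R 1"
    and "finite Y" "Y \<noteq> {}" "inverse_differences z u Y" "\<And>a. a \<in> Y \<Longrightarrow> z a \<in> R 1" "graded_poly R k q"
  shows "end_sum (rank_weight \<rho> g) u X Y (\<lambda>b. poly q (z b)) \<in>
    R (int (card Y) + 1 - 2 * (int (\<rho> (X \<union> Y)) - int (\<rho> X)) + k)"
  using assms(4-)
proof (induction "card Y" arbitrary: Y X q k rule: less_induct)
  case less
  let ?G = "end_sum (rank_weight \<rho> g) u"
  obtain e where "e \<in> Y" using less.prems by auto
  define Y' where "Y' = Y - {e}"
  have Y: "Y = insert e Y'" "e \<notin> Y'" "finite Y'" "card Y = Suc (card Y')"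
    using \<open>e \<in> Y\<close> less.prems(1) card_Suc_Diff1[of Y e] by (auto simp: Y'_def simp del: card_Diff_singleton card_Diff_insert)
  have ze: "z e \<in> R 1"
    using less.prems(4)[OF \<open>e \<in> Y\<close>] .
  have g: "g e \<in> R 2"
    using grading_mult[OF R(1) ze grading_diff[OF R(1) ze R(2)]] by (simp add: g_def)
  have qe: "poly q (z e) \<in> R k" "graded_poly R (k - 1) (synthetic_div q (z e))"
    using graded_poly_synthetic_div[OF R(1) ze less.prems(5)] by auto
  have IH: "?G X' A (\<lambda>b. poly q' (z b)) \<in> R (int (card A) + 1 - 2 * (int (\<rho> (X' \<union> A)) - int (\<rho> X')) + k')"
    if "A \<subseteq> Y'" "A \<noteq> {}" "graded_poly R k' q'" for X' A q' k'
  proof (rule less.hyps)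
    show "card A < card Y"
      using Y card_mono[OF Y(3) that(1)] by simp
    show "finite A" using that Y finite_subset by blast
    show "inverse_differences z u A"
      by (rule inverse_differences_subset[OF less.prems(3)]) (use that Y in auto)
  qed (use that less.prems Y in auto)
  have inv: "inverse_differences z u (insert e Y')" using less.prems(3) Y by simp
  consider (single) "Y' = {}" | (loop) "Y' \<noteq> {}" "\<rho> (insert e X) = \<rho> X"
    | (coloop) "Y' \<noteq> {}" "\<rho> (insert e (X \<union> Y')) \<noteq> \<rho> (X \<union> Y')"
    | (other) "Y' \<noteq> {}" "\<rho> (insert e X) \<noteq> \<rho> X" "\<rho> (insert e (X \<union> Y')) = \<rho> (X \<union> Y')"
    by blast
  then show ?case
  proof cases
    case single
    then have Ye: "Y = {e}" using Y by simp
    show ?thesis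
      using rank_insert_cases[of e X] qe(1) grading_mult[OF R(1) g qe(1)]
      by (auto simp: Ye rank_weight_def)
  next
    case loop
    have "?G X Y (\<lambda>b. poly q (z b)) = g e * ?G X Y' (\<lambda>b. (poly q (z b) - poly q (z e)) * u e b)"
      unfolding Y(1) by (rule end_sum_insert_loop) (use Y loop inv in auto)
    also have "?G X Y' (\<lambda>b. (poly q (z b) - poly q (z e)) * u e b) =
        ?G X Y' (\<lambda>b. - 1 * poly (synthetic_div q (z e)) (z b))"
      using Y(2,3) inverse_differencesD[OF inv, of e] by (intro end_sum_cong) (auto intro!: poly_difference_quotient)
    also have "\<dots> = - ?G X Y' (\<lambda>b. poly (synthetic_div q (z e)) (z b))"
      unfolding end_sum_mult[OF Y(3) loop(1)] by simp
    also have "g e * \<dots> \<in> R (2 + (int (card Y') + 1 - 2 * (int (\<rho> (X \<union> Y')) - int (\<rho> X)) + (k - 1)))"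
      by (intro grading_mult[OF R(1) g] grading_uminus[OF R(1)] IH order.refl loop qe)
    moreover have "\<rho> (X \<union> Y) = \<rho> (X \<union> Y')"
      using spanned_mono[OF loop(2), of "X \<union> Y'"] by (simp add: Y(1))
    ultimately show ?thesis by (simp add: Y(4) algebra_simps)
  next
    case coloop
    have "?G X Y (\<lambda>b. poly q (z b)) = ?G X Y' (\<lambda>b. (poly q (z b) - poly q (z e)) * u e b)"
      unfolding Y(1) by (rule end_sum_insert_coloop) (use Y coloop inv in auto)
    also have "\<dots> = ?G X Y' (\<lambda>b. - 1 * poly (synthetic_div q (z e)) (z b))"
      using Y(2,3) inverse_differencesD[OF inv, of e] by (intro end_sum_cong) (auto intro!: poly_difference_quotient)
    also have "\<dots> = - ?G X Y' (\<lambda>b. poly (synthetic_div q (z e)) (z b))"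
      unfolding end_sum_mult[OF Y(3) coloop(1)] by simp
    also have "\<dots> \<in> R (int (card Y') + 1 - 2 * (int (\<rho> (X \<union> Y')) - int (\<rho> X)) + (k - 1))"
      by (intro grading_uminus[OF R(1)] IH order.refl coloop qe)
    moreover have "\<rho> (X \<union> Y) = Suc (\<rho> (X \<union> Y'))"
      using coloop(2) rank_insert_cases[of e "X \<union> Y'"] by (simp add: Y(1))
    ultimately show ?thesis by (simp add: Y(4) algebra_simps)
  next
    case other
    have rk: "\<rho> (X \<union> Y) = \<rho> (X \<union> Y')" using other by (simp add: Y(1))
    have d: "int (card Y') + 1 - 2 * (int (\<rho> (X \<union> Y')) - int (\<rho> X)) + (k + 1) =
        int (card Y) + 1 - 2 * (int (\<rho> (X \<union> Y)) - int (\<rho> X)) + k"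
      using Y(4) by (simp add: rk)
    have "graded_poly R (k + 1) ([:z e - p, 1:] * q + smult (g e) (synthetic_div q (z e)))"
      using graded_poly_smult[OF R(1) g qe(2)]
      by (intro graded_poly_add graded_poly_linear_mult grading_diff R ze less.prems) (simp add: add.commute)
    then have "?G X Y' (\<lambda>b. poly ([:z e - p, 1:] * q + smult (g e) (synthetic_div q (z e))) (z b)) \<in>
        R (int (card Y) + 1 - 2 * (int (\<rho> (X \<union> Y)) - int (\<rho> X)) + k)"
      unfolding d[symmetric] by (intro IH order.refl other)
    moreover have "?G X A (\<lambda>_. 1) * ?G (X \<union> A) (Y' - A) (\<lambda>b. poly q (z b)) \<in>
        R (int (card Y) + 1 - 2 * (int (\<rho> (X \<union> Y)) - int (\<rho> X)) + k)"
      if A: "A \<subset> Y'" "A \<noteq> {}" for A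
    proof -
      have "graded_poly R 0 1"
        by (auto simp: graded_poly_def coeff_1 grading_one[OF R(1)] grading_zero[OF R(1)])
      then have 1: "?G X A (\<lambda>b. poly 1 (z b)) \<in> R (int (card A) + 1 - 2 * (int (\<rho> (X \<union> A)) - int (\<rho> X)) + 0)"
        using A by (intro IH) auto
      have 2: "?G (X \<union> A) (Y' - A) (\<lambda>b. poly q (z b)) \<in>
          R (int (card (Y' - A)) + 1 - 2 * (int (\<rho> (X \<union> A \<union> (Y' - A))) - int (\<rho> (X \<union> A))) + k)"
        using A less.prems by (intro IH) auto
      have "X \<union> A \<union> (Y' - A) = X \<union> Y'" "int (card (Y' - A)) = int (card Y') - int (card A)"
        using A Y(3) card_mono[OF Y(3), of A] by (auto simp: card_Diff_subset finite_subset)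
      \<comment> \<open>The parts together have one element less than \<open>Y\<close>, and two
        summands 1 where the whole has one; the ranks add up.\<close>
      then have d': "int (card A) + 1 - 2 * (int (\<rho> (X \<union> A)) - int (\<rho> X)) + 0 +
          (int (card (Y' - A)) + 1 - 2 * (int (\<rho> (X \<union> A \<union> (Y' - A))) - int (\<rho> (X \<union> A))) + k) =
          int (card Y) + 1 - 2 * (int (\<rho> (X \<union> Y)) - int (\<rho> X)) + k"
        unfolding rk Y(4) by simp
      show ?thesis
        using grading_mult[OF R(1) 1 2] unfolding d' by simp
    qed
    ultimately have "- ?G X Y' (\<lambda>b. poly ([:z e - p, 1:] * q + smult (g e) (synthetic_div q (z e))) (z b)) -
        (\<Sum>A | A \<subset> Y' \<and> A \<noteq> {} \<and> \<rho> (insert e (X \<union> A)) = \<rho> (X \<union> A).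
           ?G X A (\<lambda>_. 1) * ?G (X \<union> A) (Y' - A) (\<lambda>b. poly q (z b))) \<in>
        R (int (card Y) + 1 - 2 * (int (\<rho> (X \<union> Y)) - int (\<rho> X)) + k)"
      by (intro grading_diff grading_uminus grading_sum R) auto
    then show ?thesis
      using end_sum_delete_poly[OF Y(3) other(1) Y(2) inv other(2,3), of p q] Y(1) by (simp add: g_def)
  qed
qed

end

section \<open>Real coordinates: independence of the coordinates, vanishing, and exact
  values\<close>

abbreviation real_sum :: "('a set \<Rightarrow> nat) \<Rightarrow> ('a \<Rightarrow> real) \<Rightarrow> 'a set \<Rightarrow> 'a set \<Rightarrow> ('a \<Rightarrow> real) \<Rightarrow> real" where
  "real_sum \<rho> z \<equiv> end_sum (rank_weight \<rho> (\<lambda>a. z a * (z a - 1))) (\<lambda>a b. 1 / (z a - z b))"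

lemma inverse_differences_real:
  "inj_on z Y \<Longrightarrow> inverse_differences z (\<lambda>a b. 1 / (z a - z b :: real)) Y"
  by (auto simp: inverse_differences_def inj_on_def)

lemma simple_pole_real:
  "(\<And>a. a \<in> Y \<Longrightarrow> z a \<noteq> 1) \<Longrightarrow> simple_pole z (\<lambda>b. 1 / (z b - 1 :: real)) Y"
  by (auto simp: simple_pole_def field_simps)

lemma real_sum_cong:
  assumes "finite Y" "\<And>a. a \<in> Y \<Longrightarrow> z' a = z a" "\<And>a. a \<in> Y \<Longrightarrow> \<phi>' a = \<phi> a"
    and "\<And>a A. a \<in> Y \<Longrightarrow> A \<subseteq> Y \<Longrightarrow> a \<notin> A \<Longrightarrow>
      \<rho>' (insert a (X' \<union> A)) = \<rho>' (X' \<union> A) \<longleftrightarrow> \<rho> (insert a (X \<union> A)) = \<rho> (X \<union> A)"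
  shows "real_sum \<rho>' z' X' Y \<phi>' = real_sum \<rho> z X Y \<phi>"
  using assms by (intro end_sum_cong) (auto simp: rank_weight_def)

text \<open>Moving the coordinates one at a time from \<open>z\<close> to \<open>z'\<close> keeps them distinct.\<close>

lemma coordinatewise_constant:
  fixes z z' :: "'a \<Rightarrow> real"
  assumes "finite Y" "Y \<noteq> {}" "inj_on z Y" "inj_on z' Y"
    and ne: "\<And>a b. a \<in> Y \<Longrightarrow> b \<in> Y \<Longrightarrow> z a = z' b \<Longrightarrow> a = b"
    and z1: "\<And>a. a \<in> Y \<Longrightarrow> z a \<noteq> 1 \<and> z' a \<noteq> 1"
    and step: "\<And>e y y'. e \<in> Y \<Longrightarrow> inj_on y Y \<Longrightarrow> inj_on y' Y \<Longrightarrow> (\<And>a. a \<in> Y \<Longrightarrow> y a \<noteq> 1 \<and> y' a \<noteq> 1) \<Longrightarrow>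
      (\<And>a. a \<in> Y - {e} \<Longrightarrow> y a = y' a) \<Longrightarrow> f y = f y'"
  shows "f z = f z'"
proof -
  have inj: "inj_on (override_on z z' D) Y" for D
    unfolding inj_on_def
  proof (intro ballI impI)
    fix x y assume xy: "x \<in> Y" "y \<in> Y" "override_on z z' D x = override_on z z' D y"
    show "x = y"
      using xy(3) ne[OF xy(1,2)] ne[OF xy(2,1)] inj_onD[OF assms(3) _ xy(1,2)] inj_onD[OF assms(4) _ xy(1,2)]
      by (auto simp: override_on_def split: if_splits)
  qed
  have 1: "override_on z z' D a \<noteq> 1" if "a \<in> Y" for D a
    using z1[OF that] by (simp add: override_on_def)
  have "finite D \<Longrightarrow> D \<subseteq> Y \<Longrightarrow> f z = f (override_on z z' D)" for D
  proof (induction D rule: finite_induct)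
    case (insert e D)
    have "f (override_on z z' D) = f (override_on z z' (insert e D))"
    proof (rule step[of e])
      show "override_on z z' D a = override_on z z' (insert e D) a" if "a \<in> Y - {e}" for a
        using that by (simp add: override_on_def)
    qed (use insert.prems inj 1 in auto)
    then show ?case using insert by simp
  qed (simp add: override_on_def)
  from this[OF assms(1)] have "f z = f (override_on z z' Y)" by simp
  \<comment> \<open>\<open>override_on z z' Y\<close> agrees with \<open>z'\<close> only on
    \<open>Y\<close>, while \<open>f\<close> sees whole functions; one more step, with any
    \<open>e\<close>, bridges this.\<close>
  also obtain e where "e \<in> Y" using assms(2) by auto
  then have "f (override_on z z' Y) = f z'"
    by (intro step[of e] inj assms(4)) (use z1 in auto)
  finally show ?thesis .
qed

lemma end_sum_uminus:
  assumes "finite Y" "Y \<noteq> {}"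
  shows "end_sum h (\<lambda>a b. - u a b) X Y \<phi> = - ((- 1) ^ card Y * end_sum h u X Y \<phi>)"
  using assms
proof (induction "card Y" arbitrary: Y \<phi> rule: less_induct)
  case less
  have IH: "end_sum h (\<lambda>a b. - u a b) X (Y - {a}) (\<lambda>b. - u b a) = (- 1) ^ card (Y - {a}) * end_sum h u X (Y - {a}) (\<lambda>b. u b a)"
    if a: "a \<in> Y" for a
  proof (cases "Y - {a} = {}")
    case False
    have "end_sum h (\<lambda>a b. - u a b) X (Y - {a}) (\<lambda>b. - u b a) = end_sum h (\<lambda>a b. - u a b) X (Y - {a}) (\<lambda>b. - 1 * u b a)"
      by simp
    also have "\<dots> = - end_sum h (\<lambda>a b. - u a b) X (Y - {a}) (\<lambda>b. u b a)"
      using less.prems(1) False by (subst end_sum_mult) auto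
    also have "end_sum h (\<lambda>a b. - u a b) X (Y - {a}) (\<lambda>b. u b a) = - ((- 1) ^ card (Y - {a}) * end_sum h u X (Y - {a}) (\<lambda>b. u b a))"
      using less.prems a False by (intro less.hyps card_Diff1_less) auto
    finally show ?thesis by simp
  next
    case True
    show ?thesis unfolding True by simp
  qed
  have card_Y: "card Y = Suc (card (Y - {a}))" if "a \<in> Y" for a
    using that less.prems(1) by (rule card_Suc_Diff1[symmetric, rotated])
  then have "h a (X \<union> (Y - {a})) * \<phi> a * end_sum h (\<lambda>a b. - u a b) X (Y - {a}) (\<lambda>b. - u b a) =
      - ((- 1) ^ card Y * (h a (X \<union> (Y - {a})) * \<phi> a * end_sum h u X (Y - {a}) (\<lambda>b. u b a)))" if "a \<in> Y" for a
    unfolding IH[OF that] card_Y[OF that] by (simp add: mult_ac)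
  then show ?case
    using less.prems by (simp add: end_sum_rec sum_distrib_left flip: sum_negf)
qed

context rank_function
begin

lemma real_sum_eq_0:
  assumes "finite Y" "Y \<noteq> {}" "inj_on z Y" "card Y + 1 + degree q + 2 * \<rho> X < 2 * \<rho> (X \<union> Y)"
  shows "real_sum \<rho> z X Y (\<lambda>b. poly q (z b)) = 0"
proof -
  let ?R = "\<lambda>d::int. if d < 0 then {0} else UNIV :: real set"
  have "graded_poly ?R (int (degree q)) q"
    by (auto simp: graded_poly_def coeff_eq_0)
  then have "real_sum \<rho> z X Y (\<lambda>b. poly q (z b)) \<in>
      ?R (int (card Y) + 1 - 2 * (int (\<rho> (X \<union> Y)) - int (\<rho> X)) + int (degree q))"
    using assms by (intro end_sum_graded grading_trivial inverse_differences_real) auto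
  moreover have "int (card Y) + 1 - 2 * (int (\<rho> (X \<union> Y)) - int (\<rho> X)) + int (degree q) < 0"
    using assms(4) by simp
  ultimately show ?thesis by simp
qed

text \<open>This disposes of the cut terms: \<open>A\<close> has the rank of
  \<open>insert e A\<close> but one element less, which makes the degree negative.\<close>

lemma real_sum_prefix_eq_0:
  assumes "finite A" "A \<noteq> {}" "e \<notin> A" "inj_on z A" "\<rho> (insert e A) = \<rho> A"
    and "card (insert e A) + 1 \<le> 2 * \<rho> (insert e A)"
  shows "real_sum \<rho> z {} A (\<lambda>_. 1) = 0"
  using real_sum_eq_0[of A z 1 "{}"] assms by (simp add: rank_empty)

text \<open>The degree is 0, so the sum is a constant that sees only the coefficient of
  \<open>q\<close> at \<open>k\<close>. Every deletion changes the sign. Deleting a coloop lowers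
  \<open>k\<close> by one; deleting any other element raises \<open>k\<close> by one, and its cut
  terms vanish by \<open>real_sum_prefix_eq_0\<close>.\<close>

lemma real_sum_leading:
  assumes "finite Y" "Y \<noteq> {}" "inj_on z Y" "degree q \<le> k" "card Y + k + 1 = 2 * \<rho> Y"
    and nice: "\<And>J. J \<subseteq> Y \<Longrightarrow> J \<noteq> {} \<Longrightarrow> card J + 1 \<le> 2 * \<rho> J"
  shows "real_sum \<rho> z {} Y (\<lambda>b. poly q (z b)) = - ((- 1) ^ card Y * coeff q k)"
  using assms
proof (induction "card Y" arbitrary: Y q k rule: less_induct)
  case less
  obtain e where "e \<in> Y" using less.prems by auto
  define Y' where "Y' = Y - {e}"
  have Y: "Y = insert e Y'" "e \<notin> Y'" "finite Y'" "card Y = Suc (card Y')"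
    using \<open>e \<in> Y\<close> less.prems(1) card_Suc_Diff1[of Y e] by (auto simp: Y'_def simp del: card_Diff_singleton card_Diff_insert)
  have e1: "\<rho> (insert e {}) \<noteq> \<rho> {}"
    using less.prems(6)[of "{e}"] Y(1) by (auto simp: rank_empty)
  have inv: "inverse_differences z (\<lambda>a b. 1 / (z a - z b)) (insert e Y')"
    using less.prems(3) Y by (simp add: inverse_differences_real)
  have inj: "inj_on z A" if "A \<subseteq> Y" for A using that less.prems(3) inj_on_subset by blast
  let ?s = "synthetic_div q (z e)"
  have coeff_s: "coeff q (Suc i) = coeff ?s i - z e * coeff ?s (Suc i)" for i
  proof -
    have "coeff (q + smult (z e) ?s) (Suc i) = coeff (pCons (poly q (z e)) ?s) (Suc i)"
      by (simp only: synthetic_div_correct)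
    then show ?thesis by simp
  qed
  have deg_s: "coeff ?s k = 0" "k > 0 \<Longrightarrow> degree ?s \<le> k - 1"
  proof -
    show "k > 0 \<Longrightarrow> degree ?s \<le> k - 1" using less.prems(4) by (simp add: degree_synthetic_div)
    show "coeff ?s k = 0"
    proof (cases "k = 0")
      case True
      then have "?s = 0" using less.prems(4) by (simp add: synthetic_div_eq_0_iff)
      then show ?thesis by simp
    next
      case False
      then show ?thesis using less.prems(4) by (intro coeff_eq_0) (simp add: degree_synthetic_div)
    qed
  qed
  consider (single) "Y' = {}" | (coloop) "Y' \<noteq> {}" "\<rho> (insert e Y') \<noteq> \<rho> Y'"
    | (other) "Y' \<noteq> {}" "\<rho> (insert e Y') = \<rho> Y'" by blast
  then show ?case
  proof cases
    case single
    then have Ye: "Y = {e}" using Y by simp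
    have "\<rho> {e} = 1" using e1 rank_insert_cases[of e "{}"] by (simp add: rank_empty)
    then have "k = 0" using less.prems(5) by (simp add: Ye)
    then obtain c where "q = [:c:]" using less.prems(4) degree_eq_zeroE by auto
    then show ?thesis
      using e1 \<open>k = 0\<close> by (simp add: Ye rank_weight_def)
  next
    case coloop
    have rk: "\<rho> Y = Suc (\<rho> Y')" using coloop rank_insert_cases[of e Y'] by (simp add: Y(1))
    \<comment> \<open>For \<open>k = 0\<close> the set \<open>Y'\<close> would satisfy
      \<open>card Y' = 2 * \<rho> Y'\<close>, against the assumed bound.\<close>
    then have k: "k > 0" "card Y' + (k - 1) + 1 = 2 * \<rho> Y'"
      using less.prems(5) less.prems(6)[of Y'] Y(4) coloop(1) Y(1) subset_insertI[of Y' e] by auto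
    have "real_sum \<rho> z {} Y (\<lambda>b. poly q (z b)) = real_sum \<rho> z {} Y' (\<lambda>b. (poly q (z b) - poly q (z e)) * (1 / (z e - z b)))"
      unfolding Y(1) by (rule end_sum_insert_coloop[OF Y(3) coloop(1) Y(2) inv]) (use coloop in simp)
    also have "\<dots> = real_sum \<rho> z {} Y' (\<lambda>b. - 1 * poly ?s (z b))"
    proof (rule end_sum_cong)
      fix b assume "b \<in> Y'"
      then have "(z e - z b) * (1 / (z e - z b)) = 1"
        using Y(2) by (intro inverse_differencesD[OF inv]) auto
      from poly_difference_quotient[OF this]
      show "(poly q (z b) - poly q (z e)) * (1 / (z e - z b)) = - 1 * poly ?s (z b)" by simp
    qed (use Y(3) in auto)
    also have "\<dots> = - real_sum \<rho> z {} Y' (\<lambda>b. poly ?s (z b))"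
      unfolding end_sum_mult[OF Y(3) coloop(1)] by simp
    also have "real_sum \<rho> z {} Y' (\<lambda>b. poly ?s (z b)) = - ((- 1) ^ card Y' * coeff ?s (k - 1))"
    proof (rule less.hyps)
      show "card J + 1 \<le> 2 * \<rho> J" if "J \<subseteq> Y'" "J \<noteq> {}" for J
        using that Y(1) by (intro less.prems(6)) auto
    qed (use Y less.prems(1-5) k coloop inj deg_s in auto)
    also have "coeff ?s (k - 1) = coeff q k"
      using coeff_s[of "k - 1"] k(1) deg_s(1) by simp
    finally show ?thesis by (simp add: Y(4))
  next
    case other
    have 0: "real_sum \<rho> z {} A (\<lambda>_. 1) = 0" if "A \<subset> Y'" "A \<noteq> {}" "\<rho> (insert e A) = \<rho> A" for A
    proof (rule real_sum_prefix_eq_0[of A e])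
      show "finite A" "inj_on z A" "e \<notin> A" using that Y inj[of A] by (auto intro: finite_subset)
      show "card (insert e A) + 1 \<le> 2 * \<rho> (insert e A)"
        using that Y(1) by (intro less.prems(6)) auto
    qed (use that in auto)
    let ?q = "[:z e - 1, 1:] * q + smult (z e * (z e - 1)) ?s"
    have "real_sum \<rho> z {} Y (\<lambda>b. poly q (z b)) = - real_sum \<rho> z {} Y' (\<lambda>b. poly ?q (z b)) -
       (\<Sum>A | A \<subset> Y' \<and> A \<noteq> {} \<and> \<rho> (insert e ({} \<union> A)) = \<rho> ({} \<union> A).
          real_sum \<rho> z {} A (\<lambda>_. 1) * real_sum \<rho> z ({} \<union> A) (Y' - A) (\<lambda>b. poly q (z b)))"
      unfolding Y(1) by (rule end_sum_delete_poly[OF Y(3) other(1) Y(2) inv e1]) (use other in simp)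
    also have "(\<Sum>A | A \<subset> Y' \<and> A \<noteq> {} \<and> \<rho> (insert e ({} \<union> A)) = \<rho> ({} \<union> A).
          real_sum \<rho> z {} A (\<lambda>_. 1) * real_sum \<rho> z ({} \<union> A) (Y' - A) (\<lambda>b. poly q (z b))) = 0"
      using 0 by (intro sum.neutral) auto
    also have "real_sum \<rho> z {} Y' (\<lambda>b. poly ?q (z b)) = - ((- 1) ^ card Y' * coeff ?q (Suc k))"
    proof (rule less.hyps)
      show "degree ?q \<le> Suc k"
      proof (rule degree_add_le)
        show "degree ([:z e - 1, 1:] * q) \<le> Suc k"
          using degree_mult_le[of "[:z e - 1, 1:]" q] less.prems(4) by simp
        show "degree (smult (z e * (z e - 1)) ?s) \<le> Suc k"
          using degree_smult_le[of "z e * (z e - 1)" ?s] less.prems(4) by (simp add: degree_synthetic_div)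
      qed
      show "card Y' + Suc k + 1 = 2 * \<rho> Y'" using less.prems(5) other by (simp add: Y(1) Y(4)[unfolded Y(1)])
      show "card J + 1 \<le> 2 * \<rho> J" if "J \<subseteq> Y'" "J \<noteq> {}" for J
        using that Y(1) by (intro less.prems(6)) auto
    qed (use Y less.prems(1-5) other inj in auto)
    also have "coeff ?q (Suc k) = coeff q k"
    proof -
      have "coeff q (Suc k) = 0" "coeff ?s (Suc k) = 0"
        using less.prems(4) by (auto intro!: coeff_eq_0 simp: degree_synthetic_div)
      then show ?thesis by simp
    qed
    finally show ?thesis by (simp add: Y(4))
  qed
qed

text \<open>The bound for \<open>Y'\<close> forces \<open>\<rho> Y' = \<rho> Y\<close>, and cuts at
  proper subsets of \<open>Y'\<close> vanish by \<open>real_sum_prefix_eq_0\<close>. Hence the pole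
  formula keeps only \<open>A = Y'\<close>, with value 1 by \<open>real_sum_leading\<close> since
  \<open>card Y'\<close> is odd, and the formula for the weight 1 keeps only its first term.\<close>

lemma
  fixes z :: "'a \<Rightarrow> real"
  assumes "finite Y" "inj_on z Y" "Y = insert e Y'" "e \<notin> Y'" "card Y = 2 * \<rho> Y"
    and nice: "\<And>J. J \<subset> Y \<Longrightarrow> J \<noteq> {} \<Longrightarrow> card J + 1 \<le> 2 * \<rho> J"
  shows real_sum_nice_pole: "(\<And>a. a \<in> Y \<Longrightarrow> z a \<noteq> 1) \<Longrightarrow> real_sum \<rho> z {} Y (\<lambda>b. 1 / (z b - 1)) = - 1"
    and real_sum_nice_1: "real_sum \<rho> z {} Y (\<lambda>_. 1) = 1 - z e - real_sum \<rho> z {} Y' z"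
proof -
  have Y: "finite Y'" "card Y = Suc (card Y')" "inj_on z Y'"
    using assms by (auto simp: inj_on_def)
  have ne: "Y' \<noteq> {}"
  proof
    assume "Y' = {}"
    then have "2 * \<rho> Y = 1" using assms(5) Y by simp
    then show False by presburger
  qed
  have "Suc (card Y') \<le> 2 * \<rho> Y'" using nice[of Y'] assms(3,4) ne by auto
  moreover have "\<rho> Y' \<le> \<rho> Y" using assms(3) by (intro rank_mono) auto
  ultimately have rk: "\<rho> (insert e ({} \<union> Y')) = \<rho> ({} \<union> Y')" "card Y' + 0 + 1 = 2 * \<rho> Y'"
    using Y(2) assms(5) by (auto simp: assms(3))
  have e1: "\<rho> (insert e {}) \<noteq> \<rho> {}"
  proof -
    have "{e} \<subset> Y" using ne assms(3,4) by blast
    then show ?thesis using nice[of "{e}"] by (simp add: rank_empty)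
  qed
  have inv: "inverse_differences z (\<lambda>a b. 1 / (z a - z b)) (insert e Y')"
    using assms(2,3) by (simp add: inverse_differences_real)
  have 0: "real_sum \<rho> z {} A (\<lambda>_. 1) = 0" if "A \<subset> Y'" "A \<noteq> {}" "\<rho> (insert e A) = \<rho> A" for A
  proof (rule real_sum_prefix_eq_0[of A e])
    show "finite A" "inj_on z A" "e \<notin> A"
      using that Y assms(4) by (auto intro: finite_subset inj_on_subset)
    show "card (insert e A) + 1 \<le> 2 * \<rho> (insert e A)"
      using that assms(3,4) by (intro nice) auto
  qed (use that in auto)
  have "real_sum \<rho> z {} Y' (\<lambda>b. poly 1 (z b)) = - ((- 1) ^ card Y' * coeff 1 0)"
    by (rule real_sum_leading) (use Y ne rk assms nice in auto)
  moreover have "odd (card Y')" using rk(2) by presburger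
  ultimately have 1: "real_sum \<rho> z {} Y' (\<lambda>_. 1) = 1" by simp
  show "real_sum \<rho> z {} Y (\<lambda>b. 1 / (z b - 1)) = - 1" if z1: "\<And>a. a \<in> Y \<Longrightarrow> z a \<noteq> 1"
  proof -
    have "real_sum \<rho> z {} Y (\<lambda>b. 1 / (z b - 1)) =
      - (\<Sum>A | A \<subseteq> Y' \<and> A \<noteq> {} \<and> \<rho> (insert e ({} \<union> A)) = \<rho> ({} \<union> A).
           real_sum \<rho> z {} A (\<lambda>_. 1) * real_sum \<rho> z ({} \<union> A) (Y' - A) (\<lambda>b. 1 / (z b - 1)))"
      unfolding assms(3)
      by (rule end_sum_delete_pole[OF Y(1) ne assms(4) inv e1 rk(1)]) (use z1 assms(3) in auto)
    also have "(\<Sum>A | A \<subseteq> Y' \<and> A \<noteq> {} \<and> \<rho> (insert e ({} \<union> A)) = \<rho> ({} \<union> A).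
           real_sum \<rho> z {} A (\<lambda>_. 1) * real_sum \<rho> z ({} \<union> A) (Y' - A) (\<lambda>b. 1 / (z b - 1))) =
       (\<Sum>A\<in>{Y'}. real_sum \<rho> z {} A (\<lambda>_. 1) * real_sum \<rho> z ({} \<union> A) (Y' - A) (\<lambda>b. 1 / (z b - 1)))"
      using ne rk(1) Y(1) 0 by (intro sum.mono_neutral_right) auto
    finally show ?thesis by (simp add: 1)
  qed
  have "real_sum \<rho> z {} Y (\<lambda>_. 1) = - real_sum \<rho> z {} Y' (\<lambda>b. (z e + z b - 1) * 1 - z e * (z e - 1) * ((1 - 1) * (1 / (z e - z b)))) -
      (\<Sum>A | A \<subset> Y' \<and> A \<noteq> {} \<and> \<rho> (insert e ({} \<union> A)) = \<rho> ({} \<union> A). real_sum \<rho> z {} A (\<lambda>_. 1) * real_sum \<rho> z ({} \<union> A) (Y' - A) (\<lambda>_. 1))"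
    unfolding assms(3) by (rule end_sum_delete[OF Y(1) ne assms(4) inv e1 rk(1)])
  also have "(\<Sum>A | A \<subset> Y' \<and> A \<noteq> {} \<and> \<rho> (insert e ({} \<union> A)) = \<rho> ({} \<union> A). real_sum \<rho> z {} A (\<lambda>_. 1) * real_sum \<rho> z ({} \<union> A) (Y' - A) (\<lambda>_. 1)) = 0"
    using 0 by (intro sum.neutral) auto
  also have "real_sum \<rho> z {} Y' (\<lambda>b. (z e + z b - 1) * 1 - z e * (z e - 1) * ((1 - 1) * (1 / (z e - z b)))) =
      real_sum \<rho> z {} Y' (\<lambda>b. (z e - 1) * 1 + z b)"
    by (intro arg_cong[where f = "real_sum \<rho> z {} Y'"]) auto
  also have "\<dots> = z e - 1 + real_sum \<rho> z {} Y' z"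
    unfolding end_sum_add[OF Y(1) ne] end_sum_mult[OF Y(1) ne] 1 by simp
  finally show "real_sum \<rho> z {} Y (\<lambda>_. 1) = 1 - z e - real_sum \<rho> z {} Y' z" by simp
qed

text \<open>The sum is minus the sum of the coordinates plus a constant, which \<open>z \<mapsto> 1 - z\<close> determines.\<close>

lemma real_sum_nice_total:
  fixes z :: "'a \<Rightarrow> real"
  assumes "finite Y" "Y \<noteq> {}" "inj_on z Y" "card Y = 2 * \<rho> Y" "\<And>a. a \<in> Y \<Longrightarrow> 2 \<le> z a"
    and nice: "\<And>J. J \<subset> Y \<Longrightarrow> J \<noteq> {} \<Longrightarrow> card J + 1 \<le> 2 * \<rho> J"
  shows "real_sum \<rho> z {} Y (\<lambda>_. 1) = real (\<rho> Y) - sum z Y"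
proof -
  \<comment> \<open>By \<open>real_sum_nice_1\<close>, moving the coordinate of \<open>e\<close>
    alone changes the sum by the opposite amount, so \<open>f\<close> is constant. The reflection
    preserves \<open>z * (z - 1)\<close> and negates the differences; as \<open>card Y\<close> is
    even, their odd number negates the sum.\<close>
  define f where "f y = real_sum \<rho> y {} Y (\<lambda>_. 1) + sum y Y" for y
  have "f z = f (\<lambda>a. 1 - z a)"
  proof (rule coordinatewise_constant[OF assms(1-3)])
    show "inj_on (\<lambda>a. 1 - z a) Y" using assms(3) by (auto simp: inj_on_def)
    show "a = b" if "a \<in> Y" "b \<in> Y" "z a = 1 - z b" for a b
      using assms(5)[OF that(1)] assms(5)[OF that(2)] that(3) by simp
    show "z a \<noteq> 1 \<and> 1 - z a \<noteq> 1" if "a \<in> Y" for a using assms(5)[OF that] by simp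
    fix e and y y' :: "'a \<Rightarrow> real"
    assume e: "e \<in> Y" and inj: "inj_on y Y" "inj_on y' Y" and yy: "\<And>a. a \<in> Y - {e} \<Longrightarrow> y a = y' a"
    have Y: "Y = insert e (Y - {e})" "e \<notin> Y - {e}" using e by auto
    have eq: "real_sum \<rho> y {} (Y - {e}) y = real_sum \<rho> y' {} (Y - {e}) y'" "sum y (Y - {e}) = sum y' (Y - {e})"
      using assms(1) yy by (auto intro!: real_sum_cong sum.cong)
    show "f y = f y'"
      unfolding f_def
        real_sum_nice_1[OF assms(1) inj(1) Y assms(4) nice, simplified] real_sum_nice_1[OF assms(1) inj(2) Y assms(4) nice, simplified]
      using eq by (simp add: sum.remove[OF assms(1) e])
  qed
  moreover have "real_sum \<rho> (\<lambda>a. 1 - z a) {} Y (\<lambda>_. 1) = - real_sum \<rho> z {} Y (\<lambda>_. 1)"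
  proof -
    have "real_sum \<rho> (\<lambda>a. 1 - z a) {} Y (\<lambda>_. 1) =
      end_sum (rank_weight \<rho> (\<lambda>a. z a * (z a - 1))) (\<lambda>a b. - (1 / (z a - z b))) {} Y (\<lambda>_. 1)"
    proof (rule end_sum_cong)
      fix a b
      have "1 - z a - (1 - z b) = - (z a - z b)" by simp
      then show "1 / (1 - z a - (1 - z b)) = - (1 / (z a - z b))" by (simp only: divide_minus_right)
    qed (use assms(1) in \<open>auto simp: rank_weight_def algebra_simps\<close>)
    also have "\<dots> = - ((- 1) ^ card Y * real_sum \<rho> z {} Y (\<lambda>_. 1))"
      by (rule end_sum_uminus[OF assms(1,2)])
    finally show ?thesis using assms(4) by simp
  qed
  ultimately show ?thesis
    using assms(4) by (simp add: f_def sum_subtractf)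
qed

text \<open>The hypotheses on \<open>e\<close> are those of \<open>end_sum_delete_pole\<close>,
  whose right hand side involves only coordinates in \<open>Y - {e}\<close>.\<close>

lemma real_sum_pole_step:
  assumes "finite Y" "e \<in> Y" "inj_on y Y" "inj_on y' Y" "\<And>a. a \<in> Y \<Longrightarrow> y a \<noteq> 1 \<and> y' a \<noteq> (1 :: real)"
    and "\<And>a. a \<in> Y - {e} \<Longrightarrow> y a = y' a"
    and "\<rho> (insert e X) \<noteq> \<rho> X" "\<rho> (X \<union> (Y - {e})) = \<rho> (X \<union> Y)"
  shows "real_sum \<rho> y X Y (\<lambda>b. 1 / (y b - 1)) = real_sum \<rho> y' X Y (\<lambda>b. 1 / (y' b - 1))"
proof -
  let ?Y = "Y - {e}"
  have Y: "Y = insert e ?Y" "e \<notin> ?Y" "finite ?Y" using assms(1,2) by auto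
  have U: "insert e (X \<union> ?Y) = X \<union> Y" using assms(2) by auto
  have rk: "\<rho> (insert e (X \<union> ?Y)) = \<rho> (X \<union> ?Y)"
    unfolding U using assms(8) by simp
  have "?Y \<noteq> {}"
  proof
    assume "?Y = {}"
    show False using rk assms(7) unfolding \<open>?Y = {}\<close> by simp
  qed
  have del: "real_sum \<rho> y X Y (\<lambda>b. 1 / (y b - 1)) =
      - (\<Sum>A | A \<subseteq> ?Y \<and> A \<noteq> {} \<and> \<rho> (insert e (X \<union> A)) = \<rho> (X \<union> A).
           real_sum \<rho> y X A (\<lambda>_. 1) * real_sum \<rho> y (X \<union> A) (?Y - A) (\<lambda>b. 1 / (y b - 1)))"
    if "inj_on y Y" "\<And>a. a \<in> Y \<Longrightarrow> y a \<noteq> 1" for y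
    using end_sum_delete_pole[OF Y(3) \<open>?Y \<noteq> {}\<close> Y(2) _ assms(7) rk, of y "\<lambda>a b. 1 / (y a - y b)" 1 "\<lambda>b. 1 / (y b - 1)"]
      inverse_differences_real[OF that(1)] that(2) unfolding Y(1)[symmetric] by simp
  have 1: "y a \<noteq> 1" "y' a \<noteq> 1" if "a \<in> Y" for a using assms(5)[OF that] by auto
  have "- (\<Sum>A | A \<subseteq> ?Y \<and> A \<noteq> {} \<and> \<rho> (insert e (X \<union> A)) = \<rho> (X \<union> A).
           real_sum \<rho> y X A (\<lambda>_. 1) * real_sum \<rho> y (X \<union> A) (?Y - A) (\<lambda>b. 1 / (y b - 1))) =
     - (\<Sum>A | A \<subseteq> ?Y \<and> A \<noteq> {} \<and> \<rho> (insert e (X \<union> A)) = \<rho> (X \<union> A).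
           real_sum \<rho> y' X A (\<lambda>_. 1) * real_sum \<rho> y' (X \<union> A) (?Y - A) (\<lambda>b. 1 / (y' b - 1)))"
  proof (intro arg_cong[where f = uminus] sum.cong refl)
    fix A assume "A \<in> {A. A \<subseteq> ?Y \<and> A \<noteq> {} \<and> \<rho> (insert e (X \<union> A)) = \<rho> (X \<union> A)}"
    then have "A \<subseteq> ?Y" by auto
    then have "real_sum \<rho> y X A (\<lambda>_. 1) = real_sum \<rho> y' X A (\<lambda>_. 1)"
      "real_sum \<rho> y (X \<union> A) (?Y - A) (\<lambda>b. 1 / (y b - 1)) = real_sum \<rho> y' (X \<union> A) (?Y - A) (\<lambda>b. 1 / (y' b - 1))"
      by (intro real_sum_cong; use Y(3) assms(6) in \<open>auto intro: finite_subset\<close>)+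
    then show "real_sum \<rho> y X A (\<lambda>_. 1) * real_sum \<rho> y (X \<union> A) (?Y - A) (\<lambda>b. 1 / (y b - 1)) =
        real_sum \<rho> y' X A (\<lambda>_. 1) * real_sum \<rho> y' (X \<union> A) (?Y - A) (\<lambda>b. 1 / (y' b - 1))" by simp
  qed
  with del[OF assms(3) 1(1)] del[OF assms(4) 1(2)] show ?thesis by simp
qed

end
section \<open>Sending coordinates to infinity\<close>

lemma bigo_powi_mono:
  "(f :: real \<Rightarrow> real) \<in> O(\<lambda>x. x powi m) \<Longrightarrow> m \<le> m' \<Longrightarrow> f \<in> O(\<lambda>x. x powi m')"
proof (erule landau_o.big_trans)
  assume "m \<le> m'"
  have "eventually (\<lambda>x::real. x \<ge> 1) at_top" by (rule eventually_ge_at_top)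
  then have "eventually (\<lambda>x::real. norm (x powi m) \<le> 1 * norm (x powi m')) at_top"
    by eventually_elim (use \<open>m \<le> m'\<close> in \<open>auto intro: power_int_increasing\<close>)
  then show "(\<lambda>x::real. x powi m) \<in> O(\<lambda>x. x powi m')" by (rule bigoI)
qed

lemma bigo_powi_mult:
  assumes "(f :: real \<Rightarrow> real) \<in> O(\<lambda>x. x powi m)" "g \<in> O(\<lambda>x. x powi m')"
  shows "(\<lambda>x. f x * g x) \<in> O(\<lambda>x. x powi (m + m'))"
proof -
  have "(\<lambda>x. f x * g x) \<in> O(\<lambda>x. x powi m * x powi m')"
    using assms by (rule landau_o.big.mult)
  also have "(\<lambda>x::real. x powi m * x powi m') \<in> \<Theta>(\<lambda>x. x powi (m + m'))"
  proof (rule bigthetaI_cong)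
    show "eventually (\<lambda>x::real. x powi m * x powi m' = x powi (m + m')) at_top"
      using eventually_gt_at_top[of 0] by eventually_elim (simp add: power_int_add)
  qed
  finally show ?thesis .
qed

lemma bigo_inverse_difference:
  assumes "w \<noteq> (0 :: real)"
  shows "(\<lambda>x. 1 / (x * w - c)) \<in> O(\<lambda>x. x powi - 1)"
proof (rule bigoI)
  have "eventually (\<lambda>x. x > max 0 (2 * \<bar>c\<bar> / \<bar>w\<bar>)) at_top" by (rule eventually_gt_at_top)
  then show "eventually (\<lambda>x. norm (1 / (x * w - c)) \<le> 2 / \<bar>w\<bar> * norm (x powi - 1)) at_top"
  proof eventually_elim
    case (elim x)
    then have "x > 0" "2 * \<bar>c\<bar> / \<bar>w\<bar> < x" by (simp_all only: max_less_iff_conj)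
    then have x: "x > 0" "x * \<bar>w\<bar> > 2 * \<bar>c\<bar>" using assms by (auto simp: pos_divide_less_eq)
    have "\<bar>x * w\<bar> - \<bar>c\<bar> \<le> \<bar>x * w - c\<bar>" by (rule abs_triangle_ineq2)
    then have "x * \<bar>w\<bar> / 2 \<le> \<bar>x * w - c\<bar>" using x by (simp add: abs_mult)
    then have "1 / \<bar>x * w - c\<bar> \<le> 1 / (x * \<bar>w\<bar> / 2)"
      using x assms by (intro divide_left_mono) (auto intro!: mult_pos_pos)
    then show ?case using x by (simp add: power_int_minus field_simps)
  qed
qed

context rank_function
begin

lemma rank_remove_le:
  assumes "S \<subseteq> Y"
  shows "\<rho> Y \<le> \<rho> (Y - {a}) + 1" and "\<rho> (Y - {a}) \<le> \<rho> Y"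
    and "a \<in> S \<Longrightarrow> \<rho> Y + \<rho> (S - {a}) \<le> \<rho> (Y - {a}) + \<rho> S"
proof -
  show "\<rho> (Y - {a}) \<le> \<rho> Y" by (rule rank_mono) auto
  have "\<rho> Y \<le> \<rho> (insert a (Y - {a}))" by (rule rank_mono) auto
  then show "\<rho> Y \<le> \<rho> (Y - {a}) + 1" using rank_insert_le[of a "Y - {a}"] by simp
  assume "a \<in> S"
  then have "(Y - {a}) \<union> S = Y" "(Y - {a}) \<inter> S = S - {a}" using assms by auto
  then show "\<rho> Y + \<rho> (S - {a}) \<le> \<rho> (Y - {a}) + \<rho> S"
    using rank_submodular[of "Y - {a}" S] by simp
qed

text \<open>Every element outside \<open>S\<close> brings \<open>1 / x\<close> from the difference
  that follows it, or from \<phi>, and \<open>x ^ 2\<close> if it is skipped; at least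
  \<open>\<rho> Y - \<rho> (Y \<inter> S)\<close> of them are not skipped. A further
  \<open>1 / x\<close> appears when an element of \<open>S\<close> is followed by one outside.
  Otherwise \<open>S\<close> comes at the end, and then \<open>\<rho> (Y - S)\<close> elements
  outside \<open>S\<close> are not skipped, which is more unless the two parts separate. The flag
  \<open>far\<close> records that the ordering continues outside \<open>S\<close>, as the induction
  on the last element requires.\<close>

lemma real_sum_bigo:
  fixes z w :: "'a \<Rightarrow> real" and S :: "'a set" and \<phi> :: "real \<Rightarrow> 'a \<Rightarrow> real" and far :: bool
  defines "zl \<equiv> \<lambda>x a. if a \<in> S then z a else x * w a"
  assumes "finite Y" "inj_on z Y" "inj_on w Y" "\<And>a. a \<in> Y \<Longrightarrow> w a \<noteq> 0"
    and "\<And>b. b \<in> Y \<Longrightarrow> (\<lambda>x. \<phi> x b) \<in> O(\<lambda>x. x powi (if far \<or> b \<notin> S then - 1 else 0))"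
  shows "(\<lambda>x. real_sum \<rho> (zl x) {} Y (\<phi> x)) \<in>
    O(\<lambda>x. x powi (int (card (Y - S)) + 2 * int (\<rho> (Y \<inter> S)) - 2 * int (\<rho> Y) -
      (if Y \<inter> S \<noteq> {} \<and> (far \<or> \<rho> Y < \<rho> (Y \<inter> S) + \<rho> (Y - S)) then 1 else 0)))"
  using assms(2-)
proof (induction "card Y" arbitrary: Y \<phi> far rule: less_induct)
  case less
  let ?b = "\<lambda>Y far. if Y \<inter> S \<noteq> {} \<and> (far \<or> \<rho> Y < \<rho> (Y \<inter> S) + \<rho> (Y - S)) then 1 else (0::int)"
  let ?m = "\<lambda>Y. int (card (Y - S)) + 2 * int (\<rho> (Y \<inter> S)) - 2 * int (\<rho> Y)"
  show ?case
  proof (cases "Y = {}")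
    case True
    then show ?thesis by (simp add: rank_empty)
  next
    case False
    have "(\<lambda>x. rank_weight \<rho> (\<lambda>a. zl x a * (zl x a - 1)) a ({} \<union> (Y - {a})) * \<phi> x a *
        real_sum \<rho> (zl x) {} (Y - {a}) (\<lambda>b. 1 / (zl x b - zl x a))) \<in> O(\<lambda>x. x powi (?m Y - ?b Y far))"
      if a: "a \<in> Y" for a
    proof -
      have wt: "(\<lambda>x. rank_weight \<rho> (\<lambda>a. zl x a * (zl x a - 1)) a ({} \<union> (Y - {a}))) \<in>
          O(\<lambda>x. x powi (if \<rho> Y = \<rho> (Y - {a}) \<and> a \<notin> S then 2 else 0))"
      proof -
        have Ya: "insert a (Y - {a}) = Y" using a by auto
        have "(\<lambda>x. x * w a) \<in> O(\<lambda>x. x powi 1)" by simp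
        moreover have "(\<lambda>x. x * w a - 1) \<in> O(\<lambda>x. x powi 1)"
          using bigo_powi_mono[of "\<lambda>x. 1" 0 1] by (intro sum_in_bigo) auto
        ultimately have "(\<lambda>x. x * w a * (x * w a - 1)) \<in> O(\<lambda>x. x powi (1 + 1))"
          by (rule bigo_powi_mult)
        then show ?thesis
          using Ya by (cases "a \<in> S"; cases "\<rho> Y = \<rho> (Y - {a})") (auto simp: rank_weight_def zl_def insert_absorb[OF a])
      qed
      have diff: "(\<lambda>x. 1 / (zl x b - zl x a)) \<in> O(\<lambda>x. x powi (if a \<notin> S \<or> b \<notin> S then - 1 else 0))" if b: "b \<in> Y - {a}" for b
      proof -
        consider "a \<in> S" "b \<in> S" | "a \<in> S" "b \<notin> S" | "a \<notin> S" "b \<in> S" | "a \<notin> S" "b \<notin> S" by blast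
        then show ?thesis
        proof cases
          case 3
          have "(\<lambda>x. 1 / (z b - x * w a)) = (\<lambda>x. - (1 / (x * w a - z b)))"
            by (rule ext, simp flip: divide_minus_right)
          then show ?thesis
            using 3 bigo_inverse_difference[OF less.prems(4)[OF a], of "z b"] by (simp add: zl_def)
        next
          case 4
          have "w b - w a \<noteq> 0" using b a less.prems(3) by (auto simp: inj_on_def)
          then show ?thesis
            using 4 bigo_inverse_difference[of "w b - w a" 0] by (simp add: zl_def algebra_simps)
        qed (use b bigo_inverse_difference[OF less.prems(4), of b "z a"] in \<open>auto simp: zl_def\<close>)
      qed
      have IH: "(\<lambda>x. real_sum \<rho> (zl x) {} (Y - {a}) (\<lambda>b. 1 / (zl x b - zl x a))) \<in>
          O(\<lambda>x. x powi (?m (Y - {a}) - ?b (Y - {a}) (a \<notin> S)))"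
      proof (rule less.hyps)
        show "card (Y - {a}) < card Y"
          using less.prems(1) a by (rule card_Diff1_less)
      qed (use less.prems(1-4) diff in \<open>auto intro: inj_on_diff\<close>)
      let ?e = "(if \<rho> Y = \<rho> (Y - {a}) \<and> a \<notin> S then 2 else 0) + (if far \<or> a \<notin> S then - 1 else 0) +
          (?m (Y - {a}) - ?b (Y - {a}) (a \<notin> S))"
      have "?e \<le> ?m Y - ?b Y far"
      proof (cases "a \<in> S")
        case True
        have sets: "(Y - {a}) \<inter> S = Y \<inter> S - {a}" "Y - {a} - S = Y - S" using True by auto
        have rk: "\<rho> Y \<le> \<rho> (Y - {a}) + 1" "\<rho> (Y - {a}) \<le> \<rho> Y" "\<rho> Y + \<rho> (Y \<inter> S - {a}) \<le> \<rho> (Y - {a}) + \<rho> (Y \<inter> S)"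
          using True a rank_remove_le[of "Y \<inter> S" Y a] by auto
        \<comment> \<open>If removing \<open>a\<close> lowers the ranks of \<open>Y\<close> and of
          \<open>Y \<inter> S\<close> equally, nothing is gained from the ranks, but the parts of
          \<open>Y - {a}\<close> still do not separate, so the extra factor comes from
          there.\<close>
        have "?b (Y - {a}) False = 1"
          if "\<rho> Y < \<rho> (Y \<inter> S) + \<rho> (Y - S)" "\<rho> Y + \<rho> (Y \<inter> S - {a}) = \<rho> (Y - {a}) + \<rho> (Y \<inter> S)"
        proof -
          have less: "\<rho> (Y - {a}) < \<rho> (Y \<inter> S - {a}) + \<rho> (Y - S)" using that by simp
          have "Y \<inter> S - {a} \<noteq> {}"
          proof
            assume "Y \<inter> S - {a} = {}"
            moreover have "\<rho> (Y - S) \<le> \<rho> (Y - {a})" using True by (intro rank_mono) auto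
            ultimately show False using less by (simp only: rank_empty)
          qed
          then show ?thesis unfolding sets using less by simp
        qed
        then show ?thesis
          using rk True by (auto simp: sets split: if_splits)
      next
        case False
        have sets: "(Y - {a}) \<inter> S = Y \<inter> S" "Y - {a} - S = Y - S - {a}" using False by auto
        have "card (Y - S) = Suc (card (Y - S - {a}))"
          using False a less.prems(1) by (intro card_Suc_Diff1[symmetric]) auto
        moreover have "\<rho> Y \<le> \<rho> (Y - {a}) + 1" "\<rho> (Y - {a}) \<le> \<rho> Y"
          by (rule rank_remove_le[of "{}"]; simp)+
        ultimately show ?thesis
          using False by (auto simp: sets)
      qed
      then show ?thesis
        by (rule bigo_powi_mono[OF bigo_powi_mult[OF bigo_powi_mult[OF wt less.prems(5)[OF a]] IH]])
    qed
    then have "(\<lambda>x. \<Sum>a\<in>Y. rank_weight \<rho> (\<lambda>a. zl x a * (zl x a - 1)) a ({} \<union> (Y - {a})) * \<phi> x a *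
        real_sum \<rho> (zl x) {} (Y - {a}) (\<lambda>b. 1 / (zl x b - zl x a))) \<in> O(\<lambda>x. x powi (?m Y - ?b Y far))"
      by (rule big_sum_in_bigo)
    then show ?thesis
      using less.prems(1) False by (simp add: end_sum_rec)
  qed
qed

lemma real_sum_scale:
  fixes z w :: "'a \<Rightarrow> real" and S :: "'a set"
  assumes Y: "finite Y" "Y \<noteq> {}" "inj_on z Y" "\<And>a. a \<in> Y \<Longrightarrow> z a \<noteq> 1"
    and w: "inj_on w Y" "\<And>a. a \<in> Y \<Longrightarrow> w a \<ge> 1"
    and nl: "\<And>e. e \<in> Y \<Longrightarrow> \<rho> {e} \<noteq> 0" "\<And>e. e \<in> Y \<Longrightarrow> \<rho> (Y - {e}) = \<rho> Y"
    and x: "x > 1" "\<And>a. a \<in> Y \<Longrightarrow> x > z a"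
  defines "zx \<equiv> \<lambda>a. if a \<in> S then z a else x * w a"
  shows "real_sum \<rho> zx {} Y (\<lambda>b. 1 / (zx b - 1)) = real_sum \<rho> z {} Y (\<lambda>b. 1 / (z b - 1))"
proof -
  have xw: "x * w a \<ge> x" if "a \<in> Y" for a
    using w(2)[OF that] x(1) by simp
  have ne: "z a \<noteq> x * w b" if "a \<in> Y" "b \<in> Y" for a b
    using xw[OF that(2)] x(2)[OF that(1)] by simp
  have "real_sum \<rho> z {} Y (\<lambda>b. 1 / (z b - 1)) = real_sum \<rho> zx {} Y (\<lambda>b. 1 / (zx b - 1))"
  proof (rule coordinatewise_constant[OF Y(1-3), where f = "\<lambda>y. real_sum \<rho> y {} Y (\<lambda>b. 1 / (y b - 1))"])
    show "inj_on zx Y"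
      unfolding inj_on_def
    proof (intro ballI impI)
      fix a b assume "a \<in> Y" "b \<in> Y" "zx a = zx b"
      then show "a = b"
        using ne[of a b] ne[of b a] inj_onD[OF Y(3), of a b] inj_onD[OF w(1), of a b] x(1)
        by (auto simp: zx_def split: if_splits)
    qed
    show "a = b" if "a \<in> Y" "b \<in> Y" "z a = zx b" for a b
      using that ne[of a b] inj_onD[OF Y(3), of a b] by (auto simp: zx_def split: if_splits)
    show "z a \<noteq> 1 \<and> zx a \<noteq> 1" if "a \<in> Y" for a
    proof -
      have "x * w a \<noteq> 1" using xw[OF that] x(1) by linarith
      then show ?thesis using Y(4)[OF that] by (simp add: zx_def)
    qed
  next
    fix e and y y' :: "'a \<Rightarrow> real"
    assume "e \<in> Y" "inj_on y Y" "inj_on y' Y" "\<And>a. a \<in> Y \<Longrightarrow> y a \<noteq> 1 \<and> y' a \<noteq> 1" "\<And>a. a \<in> Y - {e} \<Longrightarrow> y a = y' a"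
    then show "real_sum \<rho> y {} Y (\<lambda>b. 1 / (y b - 1)) = real_sum \<rho> y' {} Y (\<lambda>b. 1 / (y' b - 1))"
      using nl by (intro real_sum_pole_step[OF Y(1)]) (auto simp: rank_empty)
  qed
  then show ?thesis by simp
qed

lemma eventually_real_sum_scale:
  fixes z w :: "'a \<Rightarrow> real"
  assumes Y: "finite Y" "Y \<noteq> {}" "inj_on z Y" "\<And>a. a \<in> Y \<Longrightarrow> z a \<noteq> 1"
    and w: "inj_on w Y" "\<And>a. a \<in> Y \<Longrightarrow> w a \<ge> 1"
    and nl: "\<And>e. e \<in> Y \<Longrightarrow> \<rho> {e} \<noteq> 0" "\<And>e. e \<in> Y \<Longrightarrow> \<rho> (Y - {e}) = \<rho> Y"
  shows "eventually (\<lambda>x. real_sum \<rho> (\<lambda>a. if a \<in> S then z a else x * w a) {} Y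
      (\<lambda>b. 1 / ((if b \<in> S then z b else x * w b) - 1)) = real_sum \<rho> z {} Y (\<lambda>b. 1 / (z b - 1))) at_top"
proof -
  have "eventually (\<lambda>x. x > Max (insert 1 (z ` Y))) at_top" by (rule eventually_gt_at_top)
  then show ?thesis
  proof eventually_elim
    case (elim x)
    then show ?case using Y(1) by (intro real_sum_scale assms) auto
  qed
qed

text \<open>The sum is constant along the motion and is \<open>O(1 / x)\<close>. In the case of
  equality the missing factor \<open>1 / x\<close> comes from the last term in the exponent of
  \<open>real_sum_bigo\<close>, because \<open>S\<close> and \<open>Y - S\<close> do not
  separate.\<close>

lemma real_sum_eq_0_if_dense_subset:
  fixes z :: "'a \<Rightarrow> real"
  assumes Y: "finite Y" "Y \<noteq> {}" "inj_on z Y" "\<And>a. a \<in> Y \<Longrightarrow> z a \<noteq> 1"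
    and nl: "\<And>e. e \<in> Y \<Longrightarrow> \<rho> {e} \<noteq> 0" "\<And>e. e \<in> Y \<Longrightarrow> \<rho> (Y - {e}) = \<rho> Y"
    and S: "S \<subseteq> Y" "card (Y - S) + 2 * \<rho> S < 2 * \<rho> Y \<or>
      card (Y - S) + 2 * \<rho> S = 2 * \<rho> Y \<and> \<rho> Y < \<rho> S + \<rho> (Y - S)"
  shows "real_sum \<rho> z {} Y (\<lambda>b. 1 / (z b - 1)) = 0"
proof -
  obtain f :: "'a \<Rightarrow> nat" where f: "inj_on f Y"
    using finite_imp_inj_to_nat_seg[OF Y(1)] by auto
  \<comment> \<open>Distinct positive speeds keep the moving coordinates distinct and make their
    differences grow linearly.\<close>
  define w where "w a = real (f a) + 1" for a
  have w: "inj_on w Y" "w a \<ge> 1" for a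
    using f by (auto simp: w_def inj_on_def)
  define zl where "zl x a = (if a \<in> S then z a else x * w a)" for x a
  define c where "c = real_sum \<rho> z {} Y (\<lambda>b. 1 / (z b - 1))"
  have const: "eventually (\<lambda>x. real_sum \<rho> (zl x) {} Y (\<lambda>b. 1 / (zl x b - 1)) = c) at_top"
    unfolding zl_def c_def by (intro eventually_real_sum_scale assms w)
  have YS: "Y \<inter> S = S" using S(1) by auto
  have "(\<lambda>x. real_sum \<rho> (zl x) {} Y (\<lambda>b. 1 / (zl x b - 1))) \<in>
    O(\<lambda>x. x powi (int (card (Y - S)) + 2 * int (\<rho> (Y \<inter> S)) - 2 * int (\<rho> Y) -
      (if Y \<inter> S \<noteq> {} \<and> (False \<or> \<rho> Y < \<rho> (Y \<inter> S) + \<rho> (Y - S)) then 1 else 0)))"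
    unfolding zl_def
  proof (rule real_sum_bigo)
    fix b assume "b \<in> Y"
    have "w b \<noteq> 0" using w(2)[of b] by simp
    from bigo_inverse_difference[OF this, of 1]
    show "(\<lambda>x. 1 / ((if b \<in> S then z b else x * w b) - 1)) \<in> O(\<lambda>x. x powi (if False \<or> b \<notin> S then - 1 else 0))"
      by auto
    show "w b \<noteq> 0" by fact
  qed (use Y w in auto)
  moreover have "S \<noteq> {}" if "\<rho> Y < \<rho> S + \<rho> (Y - S)"
    using that by (auto simp: rank_empty)
  ultimately have "(\<lambda>x. real_sum \<rho> (zl x) {} Y (\<lambda>b. 1 / (zl x b - 1))) \<in> O(\<lambda>x. x powi - 1)"
    using S(2) unfolding YS by (elim bigo_powi_mono) auto
  then obtain K where "eventually (\<lambda>x. norm (real_sum \<rho> (zl x) {} Y (\<lambda>b. 1 / (zl x b - 1))) \<le> K * norm (x powi - 1)) at_top"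
    by (rule landau_o.bigE)
  then have bound: "eventually (\<lambda>x::real. norm c \<le> K * norm (inverse x)) at_top"
    using const by eventually_elim (simp add: power_int_minus)
  have "((\<lambda>x::real. K * norm (inverse x)) \<longlongrightarrow> K * norm (0 :: real)) at_top"
    by (intro tendsto_intros tendsto_inverse_0_at_top filterlim_ident)
  then have "norm c \<le> K * norm (0 :: real)"
    using bound by (rule tendsto_lowerbound) simp
  then show ?thesis by (simp add: c_def)
qed

end
section \<open>The case of \<open>2 * r + 1\<close> elements\<close>

text \<open>The total for \<open>P\<close> is compared with those for its proper members. If the
  maximal ones are disjoint, their totals add up to at most that of \<open>P\<close>, since each
  loses 1/2. If \<open>P\<close> is the union of two intersecting proper members, inclusion and
  exclusion gives exactly the total of \<open>P\<close>, provided that members inside neither of the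
  two have value 0. For this reason the induction also carries the vanishing of \<open>a P\<close>
  in the second case.\<close>

lemma odd_family_bounds:
  fixes a :: "'a set \<Rightarrow> real"
  assumes "finite E" "F \<subseteq> Pow E" and odd_card: "\<And>P. P \<in> F \<Longrightarrow> odd (card P)"
    and closed: "\<And>P Q. P \<in> F \<Longrightarrow> Q \<in> F \<Longrightarrow> P \<inter> Q \<noteq> {} \<Longrightarrow> P \<inter> Q \<in> F \<and> P \<union> Q \<in> F"
    and total: "\<And>P. P \<in> F \<Longrightarrow> (\<Sum>Q | Q \<in> F \<and> Q \<subseteq> P. a Q) = (real (card P) - 1) / 2"
    and "P \<in> F"
  shows "0 \<le> a P \<and> a P \<le> (real (card P) - 1) / 2"
proof -
  define m where "m P = (real (card P) - 1) / 2" for P :: "'a set"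
  define D where "D P = {Q. Q \<in> F \<and> Q \<subseteq> P}" for P
  have fin: "finite P" "finite (D P)" "P \<noteq> {}" if "P \<in> F" for P
    using that assms(1,2) odd_card[OF that] by (auto simp: D_def intro: finite_subset[of _ "Pow E"] finite_subset[of _ E])
  have "0 \<le> a P \<and> a P \<le> m P \<and>
      ((\<exists>Q1\<in>F. \<exists>Q2\<in>F. Q1 \<subset> P \<and> Q2 \<subset> P \<and> Q1 \<inter> Q2 \<noteq> {} \<and> Q1 \<union> Q2 = P) \<longrightarrow> a P = 0)"
    using \<open>P \<in> F\<close>
  proof (induction "card P" arbitrary: P rule: less_induct)
    case less
    have IH: "0 \<le> a Q" "Q1 \<in> F \<Longrightarrow> Q2 \<in> F \<Longrightarrow> Q1 \<subset> Q \<Longrightarrow> Q2 \<subset> Q \<Longrightarrow> Q1 \<inter> Q2 \<noteq> {} \<Longrightarrow> Q1 \<union> Q2 = Q \<Longrightarrow> a Q = 0"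
      if "Q \<in> F" "Q \<subset> P" for Q Q1 Q2
      using less.hyps[OF psubset_card_mono[OF fin(1)[OF less.prems] that(2)] that(1)] by blast+
    have mP: "0 \<le> m P" using fin(1,3)[OF less.prems] by (simp add: m_def Suc_leI card_gt_0_iff)
    have "D P = insert P (D P - {P})" using less.prems by (auto simp: D_def)
    then have "(\<Sum>Q\<in>D P. a Q) = a P + (\<Sum>Q\<in>D P - {P}. a Q)"
      using fin(2)[OF less.prems] by (metis Diff_iff finite_Diff insertI1 sum.insert)
    then have aP: "a P = m P - (\<Sum>Q\<in>D P - {P}. a Q)"
      using total[OF less.prems] unfolding D_def m_def by linarith
    have DP: "Q \<in> D P - {P} \<longleftrightarrow> Q \<in> F \<and> Q \<subset> P" for Q by (auto simp: D_def)
    show ?case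
    proof (cases "\<exists>Q1\<in>F. \<exists>Q2\<in>F. Q1 \<subset> P \<and> Q2 \<subset> P \<and> Q1 \<inter> Q2 \<noteq> {} \<and> Q1 \<union> Q2 = P")
      case True
      then obtain Q1 Q2 where Q: "Q1 \<in> F" "Q2 \<in> F" "Q1 \<subset> P" "Q2 \<subset> P" "Q1 \<inter> Q2 \<noteq> {}" "Q1 \<union> Q2 = P" by blast
      have zero: "a R = 0" if R: "R \<in> F" "R \<subset> P" "\<not> R \<subseteq> Q1" "\<not> R \<subseteq> Q2" for R
      proof (rule IH(2)[OF R(1,2)])
        have ne: "R \<inter> Q1 \<noteq> {}" "R \<inter> Q2 \<noteq> {}" using R Q by blast+
        show 1: "R \<inter> Q1 \<in> F" "R \<inter> Q2 \<in> F" using closed R Q ne by blast+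
        show un: "R \<inter> Q1 \<union> R \<inter> Q2 = R" using R Q by blast
        \<comment> \<open>Here oddness is decisive: otherwise \<open>R\<close> would be a disjoint
          union of two odd sets.\<close>
        show "R \<inter> Q1 \<inter> (R \<inter> Q2) \<noteq> {}"
        proof
          assume "R \<inter> Q1 \<inter> (R \<inter> Q2) = {}"
          then have "card R = card (R \<inter> Q1) + card (R \<inter> Q2)"
            using fin(1)[OF R(1)] card_Un_disjoint[of "R \<inter> Q1" "R \<inter> Q2"] un by simp
          then show False using odd_card[OF R(1)] odd_card[OF 1(1)] odd_card[OF 1(2)] by simp
        qed
      qed (use R in blast)+
      have "(\<Sum>Q\<in>D P - {P}. a Q) = (\<Sum>Q\<in>D Q1 \<union> D Q2. a Q)"
        using fin(2)[OF less.prems] Q zero unfolding D_def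
        by (intro sum.mono_neutral_right) (simp, blast, blast)
      also have "\<dots> = (\<Sum>Q\<in>D Q1. a Q) + (\<Sum>Q\<in>D Q2. a Q) - (\<Sum>Q\<in>D Q1 \<inter> D Q2. a Q)"
        using Q fin(2) by (simp add: sum_Un)
      also have "D Q1 \<inter> D Q2 = D (Q1 \<inter> Q2)" by (auto simp: D_def)
      finally have "(\<Sum>Q\<in>D P - {P}. a Q) = m Q1 + m Q2 - m (Q1 \<inter> Q2)"
        unfolding D_def m_def using total[OF Q(1)] total[OF Q(2)] total[of "Q1 \<inter> Q2"] closed[OF Q(1,2,5)] by simp
      also have "\<dots> = m P"
        using card_Un_Int[OF fin(1)[OF Q(1)] fin(1)[OF Q(2)]] unfolding Q(6) m_def by (simp add: field_simps flip: of_nat_add)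
      finally have "a P = 0" using aP by simp
      then show ?thesis using mP by simp
    next
      case False
      define M where "M = {Q \<in> D P - {P}. \<forall>R\<in>D P - {P}. Q \<subseteq> R \<longrightarrow> R = Q}"
      have M: "Q \<in> F" "Q \<subset> P" if "Q \<in> M" for Q
        using that DP[of Q] unfolding M_def by blast+
      have finM: "finite M" using fin(2)[OF less.prems] by (auto simp: M_def)
      \<comment> \<open>The union of two intersecting maximal members is a member; it is not
        \<open>P\<close> in the present case, and anything smaller contradicts maximality.\<close>
      have disj: "Q \<inter> R = {}" if "Q \<in> M" "R \<in> M" "Q \<noteq> R" for Q R
      proof (rule ccontr)
        assume ne: "Q \<inter> R \<noteq> {}"
        have U: "Q \<union> R \<in> F" using closed M that ne by blast
        have "Q \<union> R \<noteq> P" using False M[OF that(1)] M[OF that(2)] ne by blast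
        then have "Q \<union> R \<in> D P - {P}" unfolding DP using U M(2)[OF that(1)] M(2)[OF that(2)] by blast
        then have "Q \<union> R = Q" "Q \<union> R = R" using that Un_upper1[of Q R] Un_upper2[of R Q] unfolding M_def by auto
        then show False using that(3) by blast
      qed
      have cover: "D P - {P} = (\<Union>Q\<in>M. D Q)"
      proof
        show "D P - {P} \<subseteq> (\<Union>Q\<in>M. D Q)"
        proof
          fix Q assume Q: "Q \<in> D P - {P}"
          obtain R where "R \<in> D P - {P}" "Q \<subseteq> R" "\<forall>S\<in>D P - {P}. R \<subseteq> S \<longrightarrow> R = S"
            using finite_has_maximal2[of "D P - {P}" Q] fin(2)[OF less.prems] Q by auto
          then have "R \<in> M" unfolding M_def by auto
          moreover have "Q \<in> D R" using Q \<open>Q \<subseteq> R\<close> by (simp add: D_def)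
          ultimately show "Q \<in> (\<Union>Q\<in>M. D Q)" by blast
        qed
        show "(\<Union>Q\<in>M. D Q) \<subseteq> D P - {P}" using M unfolding D_def by blast
      qed
      have "(\<Sum>Q\<in>D P - {P}. a Q) = (\<Sum>Q\<in>M. \<Sum>R\<in>D Q. a R)"
        unfolding cover
      proof (rule sum.UNION_disjoint[OF finM])
        show "\<forall>Q\<in>M. \<forall>R\<in>M. Q \<noteq> R \<longrightarrow> D Q \<inter> D R = {}"
        proof (intro ballI impI)
          fix Q R assume QR: "Q \<in> M" "R \<in> M" "Q \<noteq> R"
          show "D Q \<inter> D R = {}"
          proof (rule ccontr)
            assume "D Q \<inter> D R \<noteq> {}"
            then obtain S where "S \<in> F" "S \<subseteq> Q \<inter> R" unfolding D_def by blast
            then show False using disj[OF QR] fin(3)[of S] by simp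
          qed
        qed
      qed (use fin M in auto)
      also have "\<dots> = (\<Sum>Q\<in>M. m Q)"
        using total M by (intro sum.cong) (auto simp: D_def m_def)
      also have "\<dots> \<le> m P"
      proof (cases "M = {}")
        case False
        have "(\<Sum>Q\<in>M. card Q) = card (\<Union>M)"
          using finM disj fin(1) M by (intro card_Union_disjoint[symmetric]) (auto simp: pairwise_def disjnt_def)
        also have "\<dots> \<le> card P"
          using M fin(1)[OF less.prems] by (intro card_mono) auto
        finally have "(\<Sum>Q\<in>M. real (card Q)) \<le> real (card P)" by (metis of_nat_le_iff of_nat_sum)
        moreover have "real (card M) \<ge> 1" using False finM by (simp add: Suc_leI card_gt_0_iff)
        ultimately show ?thesis
          by (simp add: m_def sum_subtractf flip: sum_divide_distrib)
      qed (use mP in simp)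
      finally have 1: "0 \<le> a P" using aP by simp
      have "0 \<le> (\<Sum>Q\<in>D P - {P}. a Q)" using IH(1) DP by (intro sum_nonneg) auto
      then have "a P \<le> m P" using aP by simp
      then show ?thesis using 1 False by blast
    qed
  qed
  then show ?thesis by (simp add: m_def)
qed

section \<open>Contraction, free coextension and sums over tight sets\<close>

context rank_function
begin

lemma rank_function_contract: "rank_function (\<lambda>A. \<rho> (T \<union> A) - \<rho> T)"
proof
  have le: "\<rho> T \<le> \<rho> (T \<union> A)" for A by (rule rank_mono) auto
  show "\<rho> (T \<union> {}) - \<rho> T = 0" by simp
  show "\<rho> (T \<union> A) - \<rho> T \<le> \<rho> (T \<union> B) - \<rho> T" if "A \<subseteq> B" for A B
    using that by (intro diff_le_mono rank_mono) auto
  show "\<rho> (T \<union> insert a A) - \<rho> T \<le> Suc (\<rho> (T \<union> A) - \<rho> T)" for a A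
    using rank_insert_le[of a "T \<union> A"] by simp
  show "\<rho> (T \<union> (A \<union> B)) - \<rho> T + (\<rho> (T \<union> A \<inter> B) - \<rho> T) \<le> \<rho> (T \<union> A) - \<rho> T + (\<rho> (T \<union> B) - \<rho> T)" for A B
  proof -
    have "T \<union> A \<union> (T \<union> B) = T \<union> (A \<union> B)" "(T \<union> A) \<inter> (T \<union> B) = T \<union> A \<inter> B" by auto
    then show ?thesis
      using rank_submodular[of "T \<union> A" "T \<union> B"] le[of A] le[of B] le[of "A \<union> B"] le[of "A \<inter> B"] by simp
  qed
qed

lemma real_sum_contract:
  assumes "finite Y"
  shows "real_sum (\<lambda>A. \<rho> (T \<union> A) - \<rho> T) z X Y \<phi> = real_sum \<rho> z (T \<union> X) Y \<phi>"
proof (rule real_sum_cong[OF assms])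
  fix a A
  have "\<rho> T \<le> \<rho> (T \<union> (X \<union> A))" "\<rho> T \<le> \<rho> (insert a (T \<union> (X \<union> A)))" by (rule rank_mono; auto)+
  then show "\<rho> (T \<union> insert a (X \<union> A)) - \<rho> T = \<rho> (T \<union> (X \<union> A)) - \<rho> T \<longleftrightarrow>
      \<rho> (insert a (T \<union> X \<union> A)) = \<rho> (T \<union> X \<union> A)"
    by (auto simp: Un_assoc)
qed auto

text \<open>The free coextension by \<open>None\<close>: contracting \<open>None\<close> gives back \<open>\<rho>\<close>.\<close>

definition coextension :: "'a set \<Rightarrow> 'a option set \<Rightarrow> nat" where
  "coextension E A = (let J = {a \<in> E. Some a \<in> A} in if None \<in> A then \<rho> J + 1 else min (\<rho> J + 1) (card J))"

lemma rank_function_coextension: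
  assumes "finite E"
  shows "rank_function (coextension E)"
proof
  define J where "J A = {a \<in> E. Some a \<in> A}" for A
  define M where "M B = min (\<rho> B + 1) (card B)" for B
  have co: "coextension E A = (if None \<in> A then \<rho> (J A) + 1 else M (J A))" for A
    by (simp add: coextension_def J_def M_def Let_def)
  have finJ: "finite (J A)" for A using assms by (auto simp: J_def)
  have J: "J (A \<union> B) = J A \<union> J B" "J (A \<inter> B) = J A \<inter> J B" for A B by (auto simp: J_def)
  \<comment> \<open>For the cases of submodularity in which one of the ranks on the right is given
    by a cardinality.\<close>
  have Un: "\<rho> (A \<union> B) + card (A \<inter> B) \<le> \<rho> A + card B" if "finite A" "finite B" for A B
  proof -
    have "\<rho> (A \<union> (B - A)) \<le> \<rho> A + card (B - A)" using that by (intro rank_le_card) auto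
    moreover have "card B = card (B - A) + card (A \<inter> B)"
      using that card_Int_Diff[of B A] by (simp add: Int_commute)
    ultimately show ?thesis by simp
  qed
  have M_mono: "M A \<le> M B" if "A \<subseteq> B" "finite B" for A B
    using rank_mono[OF that(1)] card_mono[OF that(2,1)] by (simp add: M_def min_le_iff_disj)
  have M_insert: "M (insert a A) \<le> Suc (M A)" if "finite A" for a A
    using rank_insert_le[of a A] card_insert_le_m1[of "Suc (card A)" A a] that by (auto simp: M_def card_insert_if)
  have M_le: "M A \<le> \<rho> A + 1" "\<rho> A \<le> card A" if "finite A" for A
    using rank_le_card[OF that, of "{}"] by (simp_all add: M_def rank_empty)
  have sub: "\<rho> (A \<union> B) + 1 + M (A \<inter> B) \<le> \<rho> A + 1 + M B" if "finite A" "finite B" for A B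
    using Un[OF that] rank_submodular[of A B] M_le[of "A \<inter> B"] that by (auto simp: M_def min_def)
  have sub2: "M (A \<union> B) + M (A \<inter> B) \<le> M A + M B" if "finite A" "finite B" for A B
    using Un[OF that] Un[OF that(2,1)] rank_submodular[of A B] card_Un_Int[OF that]
    by (auto simp: M_def min_def Un_commute Int_commute)
  show "coextension E {} = 0" by (simp add: co J_def M_def)
  show "coextension E A \<le> coextension E B" if "A \<subseteq> B" for A B
  proof -
    have "J A \<subseteq> J B" using that by (auto simp: J_def)
    then show ?thesis
      using that rank_mono[of "J A" "J B"] M_mono[of "J A" "J B"] M_le(1)[OF finJ, of A] finJ by (auto simp: co)
  qed
  show "coextension E (insert a A) \<le> Suc (coextension E A)" for a A
  proof (cases a)
    case None
    then have "J (insert a A) = J A" by (auto simp: J_def)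
    then show ?thesis using None M_le(2)[OF finJ, of A] by (auto simp: co M_def)
  next
    case (Some b)
    then have "J (insert a A) = (if b \<in> E then insert b (J A) else J A)" by (auto simp: J_def)
    then show ?thesis using Some rank_insert_le[of b "J A"] M_insert[OF finJ, of b A] by (auto simp: co)
  qed
  show "coextension E (A \<union> B) + coextension E (A \<inter> B) \<le> coextension E A + coextension E B" for A B
    using sub[OF finJ finJ, of A B] sub[OF finJ finJ, of B A] sub2[OF finJ finJ, of A B] rank_submodular[of "J A" "J B"]
    by (auto simp: co J Un_commute Int_commute)
qed

text \<open>The sum over the tight sets \<open>T\<close> arises by cutting the orderings of the coextension after \<open>T\<close> and \<open>None\<close>;
  the complements of single elements are tight and account for the sum of the coordinates.\<close>

lemma real_sum_tight_total:
  fixes z :: "'a \<Rightarrow> real"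
  assumes "finite E" "inj_on z E" "\<And>a. a \<in> E \<Longrightarrow> 2 \<le> z a" "card E = 2 * \<rho> E + 1"
    and half: "\<And>J. J \<subset> E \<Longrightarrow> card J \<le> 2 * \<rho> J"
  shows "(\<Sum>T | T \<subseteq> E \<and> card T = 2 * \<rho> T \<and> card T + 1 < card E. real_sum \<rho> z T (E - T) (\<lambda>b. 1 / (z b - 1))) = - real (\<rho> E)"
proof -
  let ?N = "coextension E"
  interpret N: rank_function ?N by (rule rank_function_coextension[OF assms(1)])
  \<comment> \<open>The coordinate of \<open>None\<close>. It only has to be new and at least 2; it
    cancels from the result.\<close>
  define x where "x = Max (insert 2 (z ` E)) + 1"
  define zx where "zx = case_option x z"
  have "b \<le> Max (insert 2 (z ` E))" if "b \<in> insert 2 (z ` E)" for b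
    using assms(1) that by (intro Max_ge) auto
  then have "2 \<le> Max (insert 2 (z ` E))" "\<And>a. a \<in> E \<Longrightarrow> z a \<le> Max (insert 2 (z ` E))" by blast+
  then have x: "2 \<le> x" "\<And>a. a \<in> E \<Longrightarrow> z a < x"
    unfolding x_def by (linarith, fastforce)
  define Y where "Y = insert None (Some ` E)"
  have finY: "finite Y" using assms(1) by (simp add: Y_def)
  have inj: "inj_on zx Y"
    using assms(2) x(2) by (auto simp: Y_def zx_def inj_on_def)
  have ge: "2 \<le> zx b" if "b \<in> Y" for b
    using that assms(3) x(1) by (auto simp: Y_def zx_def)
  have J: "{a \<in> E. Some a \<in> Some ` T} = T" "{a \<in> E. Some a \<in> insert None (Some ` T)} = T" if "T \<subseteq> E" for T
    using that by auto
  have rk: "?N (insert None (Some ` T)) = \<rho> T + 1" "?N (Some ` T) = min (\<rho> T + 1) (card T)" if "T \<subseteq> E" for T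
    using J[OF that] by (simp_all add: coextension_def Let_def)
  have cd: "card (insert None (Some ` T)) = card T + 1" "card (Some ` T) = card T" if "T \<subseteq> E" for T
    using finite_subset[OF that assms(1)] by (auto simp: card_image)
  have cardY: "card Y = 2 * ?N Y" using rk(1)[of E] cd(1)[of E] assms(4) by (simp add: Y_def)
  \<comment> \<open>The coextension has one element and one rank more, hence is of the even type,
    and \<open>half\<close> makes it satisfy the strict bounds under which its sums are known
    exactly.\<close>
  have nice: "card B + 1 \<le> 2 * ?N B" if "B \<subset> Y" "B \<noteq> {}" for B
  proof (cases "None \<in> B")
    case True
    define T where "T = {a. Some a \<in> B}"
    have B: "B = insert None (Some ` T)"
    proof (rule set_eqI)
      fix b show "b \<in> B \<longleftrightarrow> b \<in> insert None (Some ` T)" using True by (cases b) (auto simp: T_def)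
    qed
    then have T: "T \<subset> E" using that(1) by (auto simp: Y_def)
    then show ?thesis using half[OF T] rk(1)[of T] cd(1)[of T] unfolding B by auto
  next
    case False
    define T where "T = {a. Some a \<in> B}"
    have B: "B = Some ` T"
    proof (rule set_eqI)
      fix b show "b \<in> B \<longleftrightarrow> b \<in> Some ` T" using False by (cases b) (auto simp: T_def)
    qed
    then have T: "T \<subseteq> E" "T \<noteq> {}" using that by (auto simp: Y_def)
    then have "card T \<ge> 1" using assms(1) by (simp add: Suc_leI card_gt_0_iff finite_subset)
    moreover have "card T \<le> 2 * \<rho> T + 1" using half[of T] T(1) assms(4) psubsetI[OF T(1)] by (cases "T = E") auto
    ultimately show ?thesis using rk(2)[OF T(1)] cd(2)[OF T(1)] unfolding B by (simp add: min_def)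
  qed
  let ?\<phi> = "\<lambda>b. 1 / (zx b - 1)"
  \<comment> \<open>This sum is computed twice: here from the exact values of the even case, below
    by cutting at \<open>None\<close>.\<close>
  have "real_sum ?N zx {} Y (\<lambda>b. (zx None - zx b) * ?\<phi> b) = real_sum ?N zx {} Y (\<lambda>b. - 1 * 1 + (x - 1) * ?\<phi> b)"
  proof (rule real_sum_cong[OF finY])
    fix b assume "b \<in> Y"
    then have "zx b - 1 \<noteq> 0" using ge[of b] by simp
    moreover have "x - zx b = - (zx b - 1) + (x - 1)" by simp
    ultimately show "(zx None - zx b) * ?\<phi> b = - 1 * 1 + (x - 1) * ?\<phi> b"
      by (simp add: zx_def divide_simps)
  qed auto
  also have "\<dots> = - 1 * real_sum ?N zx {} Y (\<lambda>_. 1) + (x - 1) * real_sum ?N zx {} Y ?\<phi>"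
    using finY by (simp only: end_sum_add end_sum_mult Y_def insert_not_empty not_False_eq_True)
  also have "real_sum ?N zx {} Y (\<lambda>_. 1) = real (?N Y) - sum zx Y"
    using finY inj cardY ge nice by (intro N.real_sum_nice_total) (auto simp: Y_def)
  also have "real_sum ?N zx {} Y ?\<phi> = - 1"
  proof (rule N.real_sum_nice_pole[OF finY inj Y_def _ cardY nice])
    show "zx b \<noteq> 1" if "b \<in> Y" for b using ge[OF that] by simp
  qed auto
  also have "sum zx Y = x + sum z E"
    using assms(1) by (simp add: Y_def zx_def sum.reindex)
  also have "?N Y = \<rho> E + 1" using rk(1)[of E] by (simp add: Y_def)
  finally have lhs: "real_sum ?N zx {} Y (\<lambda>b. (zx None - zx b) * ?\<phi> b) = sum z E - real (\<rho> E)" by simp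
  define F where "F T = real_sum \<rho> z T (E - T) (\<lambda>b. 1 / (z b - 1))" for T
  let ?C = "\<lambda>A. real_sum ?N zx {} A (\<lambda>_. 1) * real_sum ?N zx ({} \<union> A) (Y - A) ?\<phi>"
  have "real_sum ?N zx {} Y (\<lambda>b. (zx None - zx b) * ?\<phi> b) = (\<Sum>A | A \<subset> Y \<and> None \<in> A. ?C A)"
    by (rule end_sum_cut) (use finY inj in \<open>auto simp: Y_def inverse_differences_real\<close>)
  also have "\<dots> = (\<Sum>T | T \<subset> E. ?C (insert None (Some ` T)))"
  proof (rule sum.reindex_bij_witness[of _ "\<lambda>T. insert None (Some ` T)" "\<lambda>A. {a. Some a \<in> A}"])
    fix A assume A: "A \<in> {A. A \<subset> Y \<and> None \<in> A}"
    show eq: "insert None (Some ` {a. Some a \<in> A}) = A"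
    proof (rule set_eqI)
      fix b show "b \<in> insert None (Some ` {a. Some a \<in> A}) \<longleftrightarrow> b \<in> A" using A by (cases b) auto
    qed
    show "{a. Some a \<in> A} \<in> {T. T \<subset> E}" using A eq by (auto simp: Y_def)
    show "?C (insert None (Some ` {a. Some a \<in> A})) = ?C A" by (simp only: eq)
  qed (auto simp: Y_def)
  also have "\<dots> = (\<Sum>T | T \<subset> E. if card T = 2 * \<rho> T then F T else 0)"
  proof (rule sum.cong[OF refl])
    fix T assume "T \<in> {T. T \<subset> E}"
    then have T: "T \<subset> E" "T \<subseteq> E" by auto
    let ?A = "insert None (Some ` T)"
    have A: "?A \<subset> Y" "finite ?A" using T assms(1) by (auto simp: Y_def intro: finite_subset)
    have injA: "inj_on zx ?A" using inj A(1) inj_on_subset psubset_imp_subset by metis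
    have "Y - ?A = Some ` (E - T)" by (auto simp: Y_def)
    then have "real_sum ?N zx ({} \<union> ?A) (Y - ?A) ?\<phi> = real_sum ?N zx ?A (Some ` (E - T)) ?\<phi>" by simp
    also have "\<dots> = F T"
      unfolding F_def
    proof (rule end_sum_embed)
      fix a B assume aB: "a \<in> E - T" "B \<subseteq> E - T"
      have "?N (?A \<union> Some ` B) = \<rho> (T \<union> B) + 1" "?N (insert (Some a) (?A \<union> Some ` B)) = \<rho> (insert a (T \<union> B)) + 1"
        using rk(1)[of "T \<union> B"] rk(1)[of "insert a (T \<union> B)"] aB T(2) by (auto simp: image_Un insert_commute)
      then show "rank_weight ?N (\<lambda>a. zx a * (zx a - 1)) (Some a) (?A \<union> Some ` B) =
          rank_weight \<rho> (\<lambda>a. z a * (z a - 1)) a (T \<union> B)"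
        by (simp add: rank_weight_def zx_def)
    qed (use assms(1) in \<open>auto simp: zx_def\<close>)
    finally have 1: "real_sum ?N zx ({} \<union> ?A) (Y - ?A) ?\<phi> = F T" .
    \<comment> \<open>The prefix sum has degree \<open>card T - 2 * \<rho> T\<close>, which is never
      positive: it is a constant for tight \<open>T\<close> and vanishes otherwise. The constant is
      1 because \<open>card ?A\<close> is odd.\<close>
    have 2: "real_sum ?N zx {} ?A (\<lambda>_. 1) = (if card T = 2 * \<rho> T then 1 else 0)"
    proof (cases "card T = 2 * \<rho> T")
      case True
      have "real_sum ?N zx {} ?A (\<lambda>b. poly 1 (zx b)) = - ((- 1) ^ card ?A * coeff 1 0)"
      proof (rule N.real_sum_leading)
        show "card B + 1 \<le> 2 * ?N B" if "B \<subseteq> ?A" "B \<noteq> {}" for B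
          using that A(1) by (intro nice) auto
      qed (use A injA rk(1)[OF T(2)] cd(1)[OF T(2)] True in auto)
      then show ?thesis using True cd(1)[OF T(2)] by simp
    next
      case False
      then have "card T < 2 * \<rho> T" using half[OF T(1)] by simp
      then have "real_sum ?N zx {} ?A (\<lambda>b. poly 1 (zx b)) = 0"
        using A injA rk(1)[OF T(2)] cd(1)[OF T(2)] by (intro N.real_sum_eq_0) (auto simp: N.rank_empty)
      then show ?thesis using False by simp
    qed
    show "?C ?A = (if card T = 2 * \<rho> T then F T else 0)" unfolding 1 2 by simp
  qed
  also have "\<dots> = (\<Sum>T | T \<subset> E \<and> card T = 2 * \<rho> T. F T)"
  proof -
    have "finite {T. T \<subset> E}" using assms(1) by (auto intro: finite_subset[of _ "Pow E"])
    from sum.inter_filter[OF this, of F "\<lambda>T. card T = 2 * \<rho> T"] show ?thesis by simp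
  qed
  also have "{T. T \<subset> E \<and> card T = 2 * \<rho> T} = {T. T \<subseteq> E \<and> card T = 2 * \<rho> T \<and> card T + 1 < card E} \<union> (\<lambda>e. E - {e}) ` E"
    (is "?L = ?R1 \<union> ?R2")
  proof
    show "?L \<subseteq> ?R1 \<union> ?R2"
    proof
      fix T assume T: "T \<in> ?L"
      then have "card T < card E" by (intro psubset_card_mono[OF assms(1)]) simp
      then consider "card T + 1 < card E" | "card T + 1 = card E" by linarith
      then show "T \<in> ?R1 \<union> ?R2"
      proof cases
        case 2
        then have "card (E - T) = 1" using T assms(1) by (auto simp: card_Diff_subset finite_subset psubset_eq)
        then obtain e where "E - T = {e}" by (auto simp: card_1_singleton_iff)
        then have "T = E - {e}" "e \<in> E" using T by auto
        then show ?thesis by blast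
      qed (use T in auto)
    qed
    show "?R1 \<union> ?R2 \<subseteq> ?L"
    proof -
      have "card (E - {e}) = 2 * \<rho> (E - {e})" if "e \<in> E" for e
        using half[of "E - {e}"] that assms(1,4) rank_mono[of "E - {e}" E] by (auto simp: card_Diff_singleton)
      then show ?thesis by auto
    qed
  qed
  also have "(\<Sum>T\<in>?R1 \<union> ?R2. F T) = (\<Sum>T\<in>?R1. F T) + (\<Sum>T\<in>?R2. F T)"
  proof (rule sum.union_disjoint)
    show "finite ?R1" using assms(1) by (auto intro: finite_subset[of _ "Pow E"])
    have "card (E - {e}) + 1 = card E" if "e \<in> E" for e
      using card_Suc_Diff1[OF assms(1) that] by simp
    then show "?R1 \<inter> ?R2 = {}" by force
  qed (use assms(1) in auto)
  also have "(\<Sum>T\<in>?R2. F T) = (\<Sum>e\<in>E. F (E - {e}))"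
    by (subst sum.reindex) (auto simp: inj_on_def)
  also have "\<dots> = sum z E"
  proof (rule sum.cong[OF refl])
    fix e assume e: "e \<in> E"
    have "card (E - {e}) = 2 * \<rho> E" using e assms(1,4) by (simp add: card_Diff_singleton)
    moreover have "E - {e} \<subset> E" using e by auto
    ultimately have "\<rho> E = \<rho> (E - {e})"
      using half[of "E - {e}"] rank_mono[of "E - {e}" E] by auto
    then have "\<rho> (insert e (E - {e})) = \<rho> (E - {e})"
      using e by (simp add: insert_absorb)
    moreover have "E - (E - {e}) = {e}" using e by auto
    \<comment> \<open>The single remaining element is skipped, and its weight
      \<open>z e * (z e - 1)\<close> meets the pole \<open>1 / (z e - 1)\<close>.\<close>
    ultimately show "F (E - {e}) = z e"
      using assms(3)[OF e] by (simp add: F_def rank_weight_def)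
  qed
  finally show ?thesis using lhs by (simp add: F_def)
qed

lemma real_sum_odd_bounds:
  fixes z :: "'a \<Rightarrow> real"
  assumes "finite E" "inj_on z E" "\<And>a. a \<in> E \<Longrightarrow> 2 \<le> z a" "card E = 2 * \<rho> E + 1" "\<rho> E > 0"
    and half: "\<And>J. J \<subset> E \<Longrightarrow> card J \<le> 2 * \<rho> J"
  shows "- real (\<rho> E) \<le> real_sum \<rho> z {} E (\<lambda>b. 1 / (z b - 1))" "real_sum \<rho> z {} E (\<lambda>b. 1 / (z b - 1)) \<le> 0"
proof -
  define F where "F = {P. P \<subseteq> E \<and> P \<noteq> {} \<and> card (E - P) = 2 * \<rho> (E - P)}"
  \<comment> \<open>Singletons get 0: \<open>real_sum_tight_total\<close> leaves out their
    complements, and the total prescribed for a singleton is 0.\<close>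
  define a where "a P = (if card P = 1 then 0 else - real_sum \<rho> z (E - P) P (\<lambda>b. 1 / (z b - 1)))" for P
  have card_P: "card P + card (E - P) = card E" if "P \<subseteq> E" for P
    using that assms(1) by (simp add: card_Diff_subset finite_subset card_mono)
  have "0 \<le> a E \<and> a E \<le> (real (card E) - 1) / 2"
  proof (rule odd_family_bounds[OF assms(1), of F])
    show "F \<subseteq> Pow E" by (auto simp: F_def)
    show "odd (card P)" if "P \<in> F" for P
    proof -
      have "card P + 2 * \<rho> (E - P) = 2 * \<rho> E + 1" using that card_P[of P] assms(4) by (auto simp: F_def)
      then show ?thesis by presburger
    qed
    show "E \<in> F" using assms(4) by (auto simp: F_def rank_empty)
    show "P \<inter> Q \<in> F \<and> P \<union> Q \<in> F" if "P \<in> F" "Q \<in> F" "P \<inter> Q \<noteq> {}" for P Q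
    proof -
      have sub: "P \<subseteq> E" "Q \<subseteq> E" "P \<noteq> {}" using that by (auto simp: F_def)
      have eqs: "E - P \<inter> Q = (E - P) \<union> (E - Q)" "E - (P \<union> Q) = (E - P) \<inter> (E - Q)" by auto
      \<comment> \<open>As \<open>P\<close> and \<open>Q\<close> meet, both complements are proper
        subsets and \<open>half\<close> bounds them; by submodularity both bounds are then
        attained.\<close>
      have "card (E - P \<inter> Q) \<le> 2 * \<rho> (E - P \<inter> Q)" "card (E - (P \<union> Q)) \<le> 2 * \<rho> (E - (P \<union> Q))"
        using sub that(3) by (intro half; blast)+
      moreover have "card (E - P \<inter> Q) + card (E - (P \<union> Q)) = card (E - P) + card (E - Q)"
        unfolding eqs using assms(1) card_Un_Int[of "E - P" "E - Q"] by simp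
      moreover have "\<rho> (E - P \<inter> Q) + \<rho> (E - (P \<union> Q)) \<le> \<rho> (E - P) + \<rho> (E - Q)"
        unfolding eqs by (rule rank_submodular)
      moreover have "card (E - P) = 2 * \<rho> (E - P)" "card (E - Q) = 2 * \<rho> (E - Q)"
        using that by (auto simp: F_def)
      ultimately have "card (E - P \<inter> Q) = 2 * \<rho> (E - P \<inter> Q)" "card (E - (P \<union> Q)) = 2 * \<rho> (E - (P \<union> Q))" by linarith+
      then show ?thesis using that sub by (auto simp: F_def)
    qed
    show "(\<Sum>Q | Q \<in> F \<and> Q \<subseteq> P. a Q) = (real (card P) - 1) / 2" if P: "P \<in> F" for P
    proof -
      define T where "T = E - P"
      define \<sigma> where "\<sigma> A = \<rho> (T \<union> A) - \<rho> T" for A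
      interpret S: rank_function \<sigma> unfolding \<sigma>_def by (rule rank_function_contract)
      have PE: "P \<subseteq> E" "P \<noteq> {}" "finite P" "T \<union> P = E" "card T = 2 * \<rho> T" "T \<inter> P = {}" "finite T"
        using P assms(1) by (auto simp: F_def T_def intro: finite_subset)
      have le: "\<rho> T \<le> \<rho> (T \<union> A)" for A by (rule rank_mono) auto
      have card_TJ: "card (T \<union> J) = card T + card J" if "J \<subseteq> P" for J
        using that PE by (intro card_Un_disjoint) (auto intro: finite_subset)
      have cardP: "card P = 2 * \<sigma> P + 1"
        using card_P[OF PE(1)] assms(4) PE le[of P] by (simp add: \<sigma>_def T_def[symmetric])
      have tight: "card J = 2 * \<sigma> J \<longleftrightarrow> card (T \<union> J) = 2 * \<rho> (T \<union> J)" if "J \<subseteq> P" for J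
        using card_TJ[OF that] PE(5) le[of J] by (auto simp: \<sigma>_def)
      have "(\<Sum>J | J \<subseteq> P \<and> card J = 2 * \<sigma> J \<and> card J + 1 < card P. real_sum \<sigma> z J (P - J) (\<lambda>b. 1 / (z b - 1))) = - real (\<sigma> P)"
      proof (rule S.real_sum_tight_total[OF PE(3) _ _ cardP])
        show "card J \<le> 2 * \<sigma> J" if "J \<subset> P" for J
        proof -
          have "card (T \<union> J) \<le> 2 * \<rho> (T \<union> J)" using that PE by (intro half) auto
          then show ?thesis using card_TJ[of J] that PE(5) le[of J] by (auto simp: \<sigma>_def)
        qed
      qed (use assms(2,3) PE(1) in \<open>auto intro: inj_on_subset\<close>)
      also have "(\<Sum>J | J \<subseteq> P \<and> card J = 2 * \<sigma> J \<and> card J + 1 < card P. real_sum \<sigma> z J (P - J) (\<lambda>b. 1 / (z b - 1))) =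
          (\<Sum>Q | Q \<in> F \<and> Q \<subseteq> P \<and> card Q \<noteq> 1. - a Q)"
      proof (rule sum.reindex_bij_witness[of _ "\<lambda>Q. P - Q" "\<lambda>J. P - J"])
        fix J assume J: "J \<in> {J. J \<subseteq> P \<and> card J = 2 * \<sigma> J \<and> card J + 1 < card P}"
        then have *: "E - (P - J) = T \<union> J" "card (P - J) = card P - card J"
          using PE by (auto simp: card_Diff_subset finite_subset T_def)
        show "P - J \<in> {Q. Q \<in> F \<and> Q \<subseteq> P \<and> card Q \<noteq> 1}"
          using J tight[of J] PE * by (auto simp: F_def)
        have "real_sum \<sigma> z J (P - J) (\<lambda>b. 1 / (z b - 1)) = real_sum \<rho> z (T \<union> J) (P - J) (\<lambda>b. 1 / (z b - 1))"
          unfolding \<sigma>_def using PE by (intro real_sum_contract) auto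
        moreover have "card (P - J) \<noteq> 1"
          using J unfolding *(2) by auto
        ultimately show "- a (P - J) = real_sum \<sigma> z J (P - J) (\<lambda>b. 1 / (z b - 1))"
          using *(1) by (simp add: a_def)
      next
        fix Q assume Q: "Q \<in> {Q. Q \<in> F \<and> Q \<subseteq> P \<and> card Q \<noteq> 1}"
        then have "T \<union> (P - Q) = E - Q" using PE by (auto simp: T_def)
        moreover have "card Q \<le> card P" "card (P - Q) = card P - card Q" "card Q > 0"
          using Q PE by (auto simp: card_Diff_subset finite_subset card_mono card_gt_0_iff F_def)
        ultimately show "P - Q \<in> {J. J \<subseteq> P \<and> card J = 2 * \<sigma> J \<and> card J + 1 < card P}"
          using Q tight[of "P - Q"] by (auto simp: F_def)
      qed auto
      also have "\<dots> = - (\<Sum>Q | Q \<in> F \<and> Q \<subseteq> P \<and> card Q \<noteq> 1. a Q)" by (simp add: sum_negf)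
      also have "(\<Sum>Q | Q \<in> F \<and> Q \<subseteq> P \<and> card Q \<noteq> 1. a Q) = (\<Sum>Q | Q \<in> F \<and> Q \<subseteq> P. a Q)"
      proof (rule sum.mono_neutral_left)
        show "finite {Q. Q \<in> F \<and> Q \<subseteq> P}" using PE(3) by (auto intro: finite_subset[of _ "Pow P"])
      qed (auto simp: a_def)
      finally show ?thesis using cardP by simp
    qed
  qed
  moreover have "card E \<noteq> 1" using assms(4,5) by simp
  ultimately show "- real (\<rho> E) \<le> real_sum \<rho> z {} E (\<lambda>b. 1 / (z b - 1))" "real_sum \<rho> z {} E (\<lambda>b. 1 / (z b - 1)) \<le> 0"
    using assms(4) by (auto simp: a_def)
qed

end
section \<open>Connected components\<close>

context rank_function
begin

definition connected_set :: "'a set \<Rightarrow> bool" where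
  "connected_set Y \<longleftrightarrow> Y \<noteq> {} \<and> (\<forall>S. S \<subset> Y \<and> S \<noteq> {} \<longrightarrow> \<rho> Y < \<rho> S + \<rho> (Y - S))"

lemma connected_setD: "connected_set Y \<Longrightarrow> S \<subset> Y \<Longrightarrow> S \<noteq> {} \<Longrightarrow> \<rho> Y < \<rho> S + \<rho> (Y - S)"
  by (auto simp: connected_set_def)

definition component_partition :: "'a set set \<Rightarrow> bool" where
  "component_partition \<C> \<longleftrightarrow> finite \<C> \<and> disjoint \<C> \<and> (\<forall>C\<in>\<C>. finite C \<and> connected_set C) \<and>
     (\<forall>A. A \<subseteq> \<Union>\<C> \<longrightarrow> \<rho> A = (\<Sum>C\<in>\<C>. \<rho> (A \<inter> C)))"

lemma rank_separated:
  assumes "S \<subseteq> Y" "\<rho> S + \<rho> (Y - S) \<le> \<rho> Y" "A \<subseteq> Y"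
  shows "\<rho> A = \<rho> (A \<inter> S) + \<rho> (A - S)"
proof -
  have "(S \<union> A) \<union> (Y - S) = Y" "(S \<union> A) \<inter> (Y - S) = A - S" "S \<inter> A = A \<inter> S"
    "A \<inter> S \<union> (A - S) = A" "A \<inter> S \<inter> (A - S) = {}" using assms by auto
  then show ?thesis
    using rank_submodular[of S A] rank_submodular[of "S \<union> A" "Y - S"] rank_submodular[of "A \<inter> S" "A - S"] assms(2) by simp
qed

lemma ex_component_partition:
  assumes "finite Y"
  shows "\<exists>\<C>. component_partition \<C> \<and> \<Union>\<C> = Y"
  using assms
proof (induction "card Y" arbitrary: Y rule: less_induct)
  case less
  consider "Y = {}" | "connected_set Y" | S where "S \<subset> Y" "S \<noteq> {}" "\<rho> S + \<rho> (Y - S) \<le> \<rho> Y"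
    unfolding connected_set_def not_less[symmetric] by blast
  then show ?case
  proof cases
    case 1
    then show ?thesis by (intro exI[of _ "{}"]) (auto simp: component_partition_def rank_empty)
  next
    case 2
    then have "component_partition {Y}"
      using less.prems by (auto simp: component_partition_def Int_absorb2)
    then show ?thesis by (intro exI[of _ "{Y}"]) simp
  next
    case 3
    have "card S < card Y" "card (Y - S) < card Y" "finite S" "finite (Y - S)"
      using 3(1,2) less.prems by (auto intro: psubset_card_mono finite_subset)
    then obtain \<C>1 \<C>2 where C1: "component_partition \<C>1" "\<Union>\<C>1 = S" and C2: "component_partition \<C>2" "\<Union>\<C>2 = Y - S"
      using less.hyps by meson
    have ne: "C \<noteq> {}" if "C \<in> \<C>1 \<union> \<C>2" for C
      using that C1(1) C2(1) by (auto simp: component_partition_def connected_set_def)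
    have disj: "\<C>1 \<inter> \<C>2 = {}"
    proof (rule ccontr)
      assume "\<C>1 \<inter> \<C>2 \<noteq> {}"
      then obtain C where "C \<in> \<C>1" "C \<in> \<C>2" by blast
      moreover then have "C \<subseteq> S \<inter> (Y - S)" using C1(2) C2(2) by blast
      ultimately show False using ne by blast
    qed
    have "disjoint (\<C>1 \<union> \<C>2)"
    proof (rule pairwiseI)
      fix C D assume CD: "C \<in> \<C>1 \<union> \<C>2" "D \<in> \<C>1 \<union> \<C>2" "C \<noteq> D"
      have "C \<in> \<C>1 \<Longrightarrow> C \<subseteq> S" "D \<in> \<C>1 \<Longrightarrow> D \<subseteq> S" "C \<in> \<C>2 \<Longrightarrow> C \<subseteq> Y - S" "D \<in> \<C>2 \<Longrightarrow> D \<subseteq> Y - S"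
        using C1(2) C2(2) by blast+
      moreover have "C \<in> \<C>1 \<Longrightarrow> D \<in> \<C>1 \<Longrightarrow> disjnt C D" "C \<in> \<C>2 \<Longrightarrow> D \<in> \<C>2 \<Longrightarrow> disjnt C D"
        using CD(3) C1(1) C2(1) by (simp_all add: component_partition_def pairwise_def)
      ultimately show "disjnt C D"
        using CD(1,2) unfolding disjnt_def by blast
    qed
    moreover have "\<rho> A = (\<Sum>C\<in>\<C>1 \<union> \<C>2. \<rho> (A \<inter> C))" if A: "A \<subseteq> Y" for A
    proof -
      have "\<rho> A = \<rho> (A \<inter> S) + \<rho> (A - S)"
        using 3 A by (intro rank_separated) auto
      also have "\<rho> (A \<inter> S) = (\<Sum>C\<in>\<C>1. \<rho> (A \<inter> S \<inter> C))"
        using C1(1)[unfolded component_partition_def] C1(2) by blast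
      also have "\<dots> = (\<Sum>C\<in>\<C>1. \<rho> (A \<inter> C))"
        using C1(2) by (intro sum.cong refl arg_cong[where f = \<rho>]) auto
      also have "\<rho> (A - S) = (\<Sum>C\<in>\<C>2. \<rho> ((A - S) \<inter> C))"
      proof -
        have "A - S \<subseteq> \<Union>\<C>2" using C2(2) A by auto
        then show ?thesis using C2(1)[unfolded component_partition_def] by blast
      qed
      also have "\<dots> = (\<Sum>C\<in>\<C>2. \<rho> (A \<inter> C))"
        using C2(2) by (intro sum.cong refl arg_cong[where f = \<rho>]) auto
      finally have "\<rho> A = (\<Sum>C\<in>\<C>1. \<rho> (A \<inter> C)) + (\<Sum>C\<in>\<C>2. \<rho> (A \<inter> C))" .
      moreover have "finite \<C>1" "finite \<C>2" using C1(1) C2(1) by (simp_all add: component_partition_def)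
      ultimately show ?thesis using disj by (simp add: sum.union_disjoint)
    qed
    moreover have "\<Union>(\<C>1 \<union> \<C>2) = Y" using C1(2) C2(2) 3(1) by auto
    moreover have "finite (\<C>1 \<union> \<C>2)" "\<forall>C\<in>\<C>1 \<union> \<C>2. finite C \<and> connected_set C"
      using C1(1) C2(1) by (simp_all add: component_partition_def ball_Un)
    ultimately have "component_partition (\<C>1 \<union> \<C>2)"
      by (simp add: component_partition_def)
    then show ?thesis using \<open>\<Union>(\<C>1 \<union> \<C>2) = Y\<close> by blast
  qed
qed

text \<open>Additivity of the rank makes the weights in one part independent of the elements of the
  others, so \<open>end_sum_Un\<close> splits off the parts one at a time.\<close>

lemma real_sum_Union:
  fixes z :: "'a \<Rightarrow> real"
  assumes "finite \<C>" "disjoint \<C>" "\<And>C. C \<in> \<C> \<Longrightarrow> finite C"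
    and "\<And>A. A \<subseteq> \<Union>\<C> \<Longrightarrow> \<rho> A = (\<Sum>C\<in>\<C>. \<rho> (A \<inter> C))"
    and "inj_on z (\<Union>\<C>)" "\<And>a. a \<in> \<Union>\<C> \<Longrightarrow> z a \<noteq> 1"
  shows "real_sum \<rho> z {} (\<Union>\<C>) (\<lambda>b. 1 / (z b - 1)) = (\<Prod>C\<in>\<C>. real_sum \<rho> z {} C (\<lambda>b. 1 / (z b - 1)))"
  using assms
proof (induction \<C> rule: finite_induct)
  case (insert D \<C>)
  have disj: "D \<inter> C = {}" if "C \<in> \<C>" for C
    using insert.prems(1) insert.hyps(2) that by (auto simp: pairwise_def disjnt_def)
  then have disjU: "D \<inter> \<Union>\<C> = {}" by auto
  have sumC: "(\<Sum>C\<in>\<C>. \<rho> ((A \<union> B) \<inter> C)) = (\<Sum>C\<in>\<C>. \<rho> (B \<inter> C))" if "A \<subseteq> D" for A B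
    using disj that by (intro sum.cong refl arg_cong[where f = \<rho>]) blast
  have add: "\<rho> (A \<union> B) = \<rho> A + \<rho> B" "\<rho> B = (\<Sum>C\<in>\<C>. \<rho> (B \<inter> C))" if "A \<subseteq> D" "B \<subseteq> \<Union>\<C>" for A B
  proof -
    have "(A \<union> B) \<inter> D = A" "B \<inter> D = {}" using that disjU by auto
    moreover have "\<rho> (A \<union> B) = \<rho> ((A \<union> B) \<inter> D) + (\<Sum>C\<in>\<C>. \<rho> ((A \<union> B) \<inter> C))"
      using insert.prems(3)[of "A \<union> B"] insert.hyps that by auto
    moreover have "\<rho> B = \<rho> (B \<inter> D) + (\<Sum>C\<in>\<C>. \<rho> (B \<inter> C))"
      using insert.prems(3)[of B] insert.hyps that by auto
    ultimately show "\<rho> (A \<union> B) = \<rho> A + \<rho> B" "\<rho> B = (\<Sum>C\<in>\<C>. \<rho> (B \<inter> C))"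
      using sumC[OF that(1), of B] by (simp_all add: rank_empty)
  qed
  have "real_sum \<rho> z {} (\<Union>(insert D \<C>)) (\<lambda>b. 1 / (z b - 1)) =
      real_sum \<rho> z {} D (\<lambda>b. 1 / (z b - 1)) * real_sum \<rho> z {} (\<Union>\<C>) (\<lambda>b. 1 / (z b - 1))"
  proof (rule end_sum_Un[of _ D "\<Union>\<C>" z])
    show "inverse_differences z (\<lambda>a b. 1 / (z a - z b)) (\<Union>(insert D \<C>))"
      by (rule inverse_differences_real) fact
    show "simple_pole z (\<lambda>b. 1 / (z b - 1)) (\<Union>(insert D \<C>))"
      by (rule simple_pole_real) fact
  next
    fix a A B assume "a \<in> D" "A \<subseteq> D - {a}" "B \<subseteq> \<Union>\<C>"
    then have "\<rho> (insert a A \<union> B) = \<rho> (insert a A) + \<rho> B" "\<rho> (A \<union> B) = \<rho> A + \<rho> B"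
      by (intro add; auto)+
    then show "rank_weight \<rho> (\<lambda>a. z a * (z a - 1)) a ({} \<union> A \<union> B) = rank_weight \<rho> (\<lambda>a. z a * (z a - 1)) a ({} \<union> A)"
      by (simp add: rank_weight_def)
  next
    fix b A B assume "b \<in> \<Union>\<C>" "A \<subseteq> D" "B \<subseteq> \<Union>\<C> - {b}"
    then have "\<rho> (A \<union> insert b B) = \<rho> A + \<rho> (insert b B)" "\<rho> (A \<union> B) = \<rho> A + \<rho> B"
      by (intro add; auto)+
    then show "rank_weight \<rho> (\<lambda>a. z a * (z a - 1)) b ({} \<union> A \<union> B) = rank_weight \<rho> (\<lambda>a. z a * (z a - 1)) b ({} \<union> B)"
      by (simp add: rank_weight_def)
  qed (use insert.prems insert.hyps disjU in auto)
  also have "real_sum \<rho> z {} (\<Union>\<C>) (\<lambda>b. 1 / (z b - 1)) = (\<Prod>C\<in>\<C>. real_sum \<rho> z {} C (\<lambda>b. 1 / (z b - 1)))"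
  proof (rule insert.IH)
    show "disjoint \<C>" using insert.prems(1) by (auto simp: pairwise_def)
    show "\<rho> A = (\<Sum>C\<in>\<C>. \<rho> (A \<inter> C))" if "A \<subseteq> \<Union>\<C>" for A
      using add(2)[of "{}" A] that by simp
    show "inj_on z (\<Union>\<C>)" using insert.prems(4) by (rule inj_on_subset) auto
  qed (use insert.prems in auto)
  finally show ?case using insert.hyps by simp
qed simp

text \<open>Either some subset is dense enough for the limit argument, where connectedness provides
  the strict inequality in the critical case, or every proper nonempty subset obeys the bounds
  required by \<open>real_sum_nice_pole\<close> or \<open>real_sum_odd_bounds\<close>.\<close>

lemma real_sum_connected:
  fixes z :: "'a \<Rightarrow> real"
  defines "F \<equiv> \<lambda>C. real_sum \<rho> z {} C (\<lambda>b. 1 / (z b - 1))"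
  assumes C: "finite C" "connected_set C" "inj_on z C" "\<And>a. a \<in> C \<Longrightarrow> 2 \<le> z a"
    and nl: "\<And>e. e \<in> C \<Longrightarrow> \<rho> {e} \<noteq> 0" "\<And>e. e \<in> C \<Longrightarrow> \<rho> (C - {e}) = \<rho> C"
  shows "card C < 2 * \<rho> C \<Longrightarrow> F C = 0"
    and "card C = 2 * \<rho> C \<Longrightarrow> F C = 0 \<or> F C = - 1"
    and "card C = 2 * \<rho> C + 1 \<Longrightarrow> - real (\<rho> C) \<le> F C \<and> F C \<le> 0"
proof -
  have ne: "C \<noteq> {}" using C(2) by (simp add: connected_set_def)
  have z1: "z a \<noteq> 1" if "a \<in> C" for a using C(4)[OF that] by simp
  \<comment> \<open>For empty \<open>S\<close> there is no strict separation inequality, so the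
    first alternative has to hold by itself.\<close>
  have zero: "F C = 0" if S: "S \<subset> C" "card (C - S) + 2 * \<rho> S \<le> 2 * \<rho> C" "S = {} \<Longrightarrow> card C < 2 * \<rho> C" for S
    unfolding F_def
  proof (rule real_sum_eq_0_if_dense_subset[OF C(1) ne C(3) z1 nl])
    show "card (C - S) + 2 * \<rho> S < 2 * \<rho> C \<or> card (C - S) + 2 * \<rho> S = 2 * \<rho> C \<and> \<rho> C < \<rho> S + \<rho> (C - S)"
      using S connected_setD[OF C(2), of S] by (cases "S = {}") (auto simp: rank_empty)
  qed (use S in auto)
  have card_S: "card (C - S) + card S = card C" if "S \<subset> C" for S
  proof -
    have "C \<inter> S = S" using that by auto
    then show ?thesis using card_Int_Diff[OF C(1), of S] by simp
  qed
  show "F C = 0" if "card C < 2 * \<rho> C"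
    using that ne by (intro zero[of "{}"]) (auto simp: rank_empty)
  show "F C = 0 \<or> F C = - 1" if n: "card C = 2 * \<rho> C"
  proof (cases "\<exists>S. S \<subset> C \<and> S \<noteq> {} \<and> 2 * \<rho> S \<le> card S")
    case True
    then obtain S where "S \<subset> C" "S \<noteq> {}" "2 * \<rho> S \<le> card S" by blast
    then show ?thesis using zero[of S] card_S[of S] n by auto
  next
    case False
    obtain e where "e \<in> C" using ne by auto
    then have "C = insert e (C - {e})" by auto
    have "F C = - 1"
      unfolding F_def
      by (rule real_sum_nice_pole[OF C(1,3) \<open>C = insert e (C - {e})\<close> _ n]) (use False z1 in \<open>auto simp: not_le Suc_le_eq\<close>)
    then show ?thesis by simp
  qed
  show "- real (\<rho> C) \<le> F C \<and> F C \<le> 0" if n: "card C = 2 * \<rho> C + 1"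
  proof (cases "\<exists>S. S \<subset> C \<and> 2 * \<rho> S < card S")
    case True
    then obtain S where S: "S \<subset> C" "2 * \<rho> S < card S" by blast
    then have "S \<noteq> {}" by auto
    then have "F C = 0" using S card_S[OF S(1)] n by (intro zero[OF S(1)]) auto
    then show ?thesis by simp
  next
    case False
    obtain e where "e \<in> C" using ne by auto
    then have "\<rho> C > 0" using nl(1)[of e] rank_mono[of "{e}" C] by auto
    then show ?thesis
      unfolding F_def using False C n by (intro conjI real_sum_odd_bounds) (auto simp: not_less)
  qed
qed

text \<open>The sign gives each component the factor \<open>- F C\<close>, and a component with
  \<open>card C < 2 * \<rho> C\<close> makes the product 0. Otherwise the numbers
  \<open>card C - 2 * \<rho> C\<close> are nonnegative with sum 0 or 1, so at most one component is
  of the odd type and all others contribute 0 or 1.\<close>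

lemma real_sum_bounds:
  fixes z :: "'a \<Rightarrow> real"
  assumes \<C>: "component_partition \<C>" "\<Union>\<C> = Y" and z: "inj_on z Y" "\<And>a. a \<in> Y \<Longrightarrow> 2 \<le> z a"
    and nl: "\<And>e. e \<in> Y \<Longrightarrow> \<rho> {e} \<noteq> 0" "\<And>e. e \<in> Y \<Longrightarrow> \<rho> (Y - {e}) = \<rho> Y"
  defines "f \<equiv> (- 1) ^ card \<C> * real_sum \<rho> z {} Y (\<lambda>b. 1 / (z b - 1))"
  shows "card Y = 2 * \<rho> Y \<Longrightarrow> f = 0 \<or> f = 1"
    and "card Y = 2 * \<rho> Y + 1 \<Longrightarrow> 0 \<le> f \<and> f \<le> real (\<rho> Y)"
proof -
  define F where "F C = real_sum \<rho> z {} C (\<lambda>b. 1 / (z b - 1))" for C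
  have fin: "finite \<C>" "disjoint \<C>" "\<And>C. C \<in> \<C> \<Longrightarrow> finite C" "\<And>C. C \<in> \<C> \<Longrightarrow> connected_set C"
    and additive: "\<And>A. A \<subseteq> Y \<Longrightarrow> \<rho> A = (\<Sum>C\<in>\<C>. \<rho> (A \<inter> C))"
    using \<C> by (auto simp: component_partition_def)
  have z1: "z a \<noteq> 1" if "a \<in> Y" for a using z(2)[OF that] by simp
  have sub: "C \<subseteq> Y" if "C \<in> \<C>" for C using that \<C>(2) by auto
  have "f = (\<Prod>C\<in>\<C>. - F C)"
    unfolding f_def F_def prod_uminus \<C>(2)[symmetric]
    by (intro arg_cong2[where f = "(*)"] refl real_sum_Union fin additive) (use z z1 \<C>(2) in auto)
  have rankY: "\<rho> Y = (\<Sum>C\<in>\<C>. \<rho> C)"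
    using additive[of Y] sub by (simp add: Int_absorb1)
  have cardY: "card Y = (\<Sum>C\<in>\<C>. card C)"
    unfolding \<C>(2)[symmetric] using fin by (intro card_Union_disjoint) auto
  have coloopless: "\<rho> (C - {e}) = \<rho> C" if C: "C \<in> \<C>" and e: "e \<in> C" for C e
  proof -
    have rest: "(\<Sum>D\<in>\<C> - {C}. \<rho> ((Y - {e}) \<inter> D)) = (\<Sum>D\<in>\<C> - {C}. \<rho> D)"
    proof (intro sum.cong refl arg_cong[where f = \<rho>])
      fix D assume "D \<in> \<C> - {C}"
      then show "(Y - {e}) \<inter> D = D"
        using fin(2) C e sub[of D] by (auto simp: pairwise_def disjnt_def)
    qed
    have "\<rho> (Y - {e}) = \<rho> ((Y - {e}) \<inter> C) + (\<Sum>D\<in>\<C> - {C}. \<rho> ((Y - {e}) \<inter> D))"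
      using additive[of "Y - {e}"] sum.remove[OF fin(1) C, of "\<lambda>D. \<rho> ((Y - {e}) \<inter> D)"] by auto
    moreover have "\<rho> Y = \<rho> C + (\<Sum>D\<in>\<C> - {C}. \<rho> D)"
      unfolding rankY by (rule sum.remove[OF fin(1) C])
    moreover have "(Y - {e}) \<inter> C = C - {e}" using sub[OF C] by auto
    ultimately show ?thesis using nl(2)[of e] e sub[OF C] rest by auto
  qed
  note conn = real_sum_connected[of _ z, OF fin(3,4), folded F_def]
  have C: "card C < 2 * \<rho> C \<Longrightarrow> F C = 0" "card C = 2 * \<rho> C \<Longrightarrow> F C = 0 \<or> F C = - 1"
      "card C = 2 * \<rho> C + 1 \<Longrightarrow> - real (\<rho> C) \<le> F C \<and> F C \<le> 0" if "C \<in> \<C>" for C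
  proof -
    have "inj_on z C" "\<And>a. a \<in> C \<Longrightarrow> 2 \<le> z a" "\<And>e. e \<in> C \<Longrightarrow> \<rho> {e} \<noteq> 0"
      using z nl(1) sub[OF that] by (auto intro: inj_on_subset)
    note prems = this coloopless[OF that]
    show "card C < 2 * \<rho> C \<Longrightarrow> F C = 0" by (rule conn(1)[OF that that prems])
    show "card C = 2 * \<rho> C \<Longrightarrow> F C = 0 \<or> F C = - 1" by (rule conn(2)[OF that that prems])
    show "card C = 2 * \<rho> C + 1 \<Longrightarrow> - real (\<rho> C) \<le> F C \<and> F C \<le> 0" by (rule conn(3)[OF that that prems])
  qed
  have f0: "f = 0" if "C \<in> \<C>" "card C < 2 * \<rho> C" for C
    unfolding \<open>f = _\<close> using that C(1)[OF that] fin(1) by (intro prod_zero) auto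
  have ge: "(\<Sum>C\<in>\<D>. 2 * \<rho> C) \<le> (\<Sum>C\<in>\<D>. card C)" if "\<D> \<subseteq> \<C>" "\<And>C. C \<in> \<C> \<Longrightarrow> 2 * \<rho> C \<le> card C" for \<D>
    using that by (intro sum_mono) auto
  show "f = 0 \<or> f = 1" if n: "card Y = 2 * \<rho> Y"
  proof (cases "\<exists>C\<in>\<C>. card C < 2 * \<rho> C")
    case True
    then show ?thesis using f0 by blast
  next
    case False
    have "(\<Sum>C\<in>\<C>. 2 * \<rho> C) = (\<Sum>C\<in>\<C>. card C)"
      using n by (simp add: rankY cardY sum_distrib_left)
    then have "\<forall>C\<in>\<C>. 2 * \<rho> C = card C"
      using False fin(1) by (intro ballI sum_mono_inv[of "\<lambda>C. 2 * \<rho> C" \<C> card]) (auto simp: not_less)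
    then have 01: "\<forall>C\<in>\<C>. - F C = 0 \<or> - F C = 1" using C(2) by (metis add.inverse_inverse add.inverse_neutral)
    have "(\<Prod>C\<in>\<D>. - F C) = 0 \<or> (\<Prod>C\<in>\<D>. - F C) = 1" if "finite \<D>" "\<D> \<subseteq> \<C>" for \<D>
      using that by (induction \<D> rule: finite_induct) (use 01 in auto)
    then show ?thesis unfolding \<open>f = _\<close> using fin(1) by blast
  qed
  show "0 \<le> f \<and> f \<le> real (\<rho> Y)" if n: "card Y = 2 * \<rho> Y + 1"
  proof (cases "\<exists>C\<in>\<C>. card C < 2 * \<rho> C")
    case True
    then show ?thesis using f0 by auto
  next
    case False
    then have ge2: "2 * \<rho> C \<le> card C" if "C \<in> \<C>" for C using that by (auto simp: not_less)
    have "\<exists>C\<in>\<C>. 2 * \<rho> C \<noteq> card C"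
    proof (rule ccontr)
      assume "\<not> ?thesis"
      then have "(\<Sum>C\<in>\<C>. 2 * \<rho> C) = (\<Sum>C\<in>\<C>. card C)" by (intro sum.cong) auto
      then show False using n by (simp add: rankY cardY sum_distrib_left)
    qed
    then obtain D where D: "D \<in> \<C>" "2 * \<rho> D \<noteq> card D" by blast
    have "(\<Sum>C\<in>\<C>. card C) = card D + (\<Sum>C\<in>\<C> - {D}. card C)" "(\<Sum>C\<in>\<C>. 2 * \<rho> C) = 2 * \<rho> D + (\<Sum>C\<in>\<C> - {D}. 2 * \<rho> C)"
      by (rule sum.remove[OF fin(1) D(1)])+
    moreover have "(\<Sum>C\<in>\<C>. card C) = (\<Sum>C\<in>\<C>. 2 * \<rho> C) + 1"
      using n by (simp add: rankY cardY sum_distrib_left)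
    moreover have "(\<Sum>C\<in>\<C> - {D}. 2 * \<rho> C) \<le> (\<Sum>C\<in>\<C> - {D}. card C)"
      by (rule ge) (use ge2 in auto)
    ultimately have D1: "card D = 2 * \<rho> D + 1" "(\<Sum>C\<in>\<C> - {D}. 2 * \<rho> C) = (\<Sum>C\<in>\<C> - {D}. card C)"
      using ge2[OF D(1)] D(2) by linarith+
    have "\<forall>C\<in>\<C> - {D}. 2 * \<rho> C = card C"
      using ge2 fin(1) D1(2) by (intro ballI sum_mono_inv[of "\<lambda>C. 2 * \<rho> C" "\<C> - {D}" card]) auto
    then have 01: "0 \<le> - F C \<and> - F C \<le> 1" if "C \<in> \<C> - {D}" for C
      using C(2)[of C] that by auto
    have P: "0 \<le> (\<Prod>C\<in>\<C> - {D}. - F C)" "(\<Prod>C\<in>\<C> - {D}. - F C) \<le> 1"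
      by (intro prod_nonneg prod_le_1; use 01 in blast)+
    have f: "f = - F D * (\<Prod>C\<in>\<C> - {D}. - F C)"
      unfolding \<open>f = _\<close> by (rule prod.remove[OF fin(1) D(1)])
    have FD: "0 \<le> - F D" "- F D \<le> real (\<rho> D)" using C(3)[OF D(1) D1(1)] by auto
    have "f \<le> real (\<rho> D) * 1"
      unfolding f using FD P by (intro mult_mono) auto
    also have "\<rho> D \<le> \<rho> Y" using sub[OF D(1)] by (rule rank_mono)
    finally have "f \<le> real (\<rho> Y)" by simp
    moreover have "0 \<le> f" unfolding f using FD(1) P(1) by (rule mult_nonneg_nonneg)
    ultimately show ?thesis by simp
  qed
qed

end

text \<open>Tutte: deleting or contracting an element keeps a matroid connected. So two elements of a connected
  matroid become parallel after contracting some of the others.\<close>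

lemma connected_imp_parallel:
  fixes \<rho> :: "'a set \<Rightarrow> nat"
  assumes "rank_function \<rho>" "finite Y" "rank_function.connected_set \<rho> Y" "e \<in> Y" "g \<in> Y" "e \<noteq> g"
  shows "\<exists>Z. Z \<subseteq> Y - {e, g} \<and> \<rho> (insert e Z) = Suc (\<rho> Z) \<and> \<rho> (insert g Z) = Suc (\<rho> Z) \<and>
    \<rho> (insert e (insert g Z)) = Suc (\<rho> Z)"
  using assms
proof (induction "card Y" arbitrary: Y \<rho> rule: less_induct)
  case less
  interpret rank_function \<rho> by fact
  note conn = connected_setD[OF less.prems(3)]
  show ?case
  proof (cases "Y = {e, g}")
    case True
    have "\<rho> {e, g} < \<rho> {e} + \<rho> {g}"
      using conn[of "{e}"] less.prems(4-6) True by (simp add: insert_Diff_if psubset_eq)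
    moreover have "\<rho> {e} \<le> \<rho> {e, g}" "\<rho> {g} \<le> \<rho> {e, g}" by (rule rank_mono; simp)+
    ultimately have "\<rho> {e} = 1" "\<rho> {g} = 1" "\<rho> {e, g} = 1"
      using rank_insert_le[of e "{}"] rank_insert_le[of g "{}"] by (simp_all add: rank_empty)
    then show ?thesis by (intro exI[of _ "{}"]) (simp add: rank_empty)
  next
    case False
    then obtain x where x: "x \<in> Y" "x \<noteq> e" "x \<noteq> g" using less.prems by auto
    define Y' where "Y' = Y - {x}"
    have Y: "Y = insert x Y'" "x \<notin> Y'" "finite Y'" "card Y' < card Y" "e \<in> Y'" "g \<in> Y'"
      using x less.prems card_Diff1_less[OF less.prems(2) x(1)] by (auto simp: Y'_def simp del: card_Diff_singleton)
    define \<sigma> where "\<sigma> A = \<rho> ({x} \<union> A) - \<rho> {x}" for A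
    interpret S: rank_function \<sigma> unfolding \<sigma>_def by (rule rank_function_contract)
    have "{x} \<subset> Y" using Y by blast
    then have "\<rho> Y < \<rho> {x} + \<rho> Y'" using conn[of "{x}"] by (simp add: Y'_def)
    moreover have "\<rho> Y' \<le> \<rho> Y" using Y(1) by (intro rank_mono) auto
    ultimately have x1: "\<rho> {x} = 1" "\<rho> Y' = \<rho> Y"
      using rank_insert_le[of x "{}"] by (simp_all add: rank_empty)
    have le: "1 \<le> \<rho> (insert x A)" for A using rank_mono[of "{x}" "insert x A"] x1 by simp
    have \<sigma>: "\<rho> (insert x A) = \<sigma> A + 1" for A using le[of A] x1 by (simp add: \<sigma>_def)
    have "connected_set Y' \<or> S.connected_set Y'"
    proof (rule ccontr)
      assume "\<not> ?thesis"
      then obtain A C where A: "A \<subset> Y'" "A \<noteq> {}" "\<rho> A + \<rho> (Y' - A) \<le> \<rho> Y'"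
        and C: "C \<subset> Y'" "C \<noteq> {}" "\<sigma> C + \<sigma> (Y' - C) \<le> \<sigma> Y'"
        using Y(5) by (auto simp: connected_set_def S.connected_set_def not_less)
      have C': "\<rho> (insert x C) + \<rho> (insert x (Y' - C)) \<le> \<rho> Y + 1"
        using C(3) \<sigma>[of Y'] by (simp add: \<sigma> Y(1))
      \<comment> \<open>Uncrossing: the sets \<open>A\<close> and \<open>C\<close> with
        \<open>x\<close> added, and likewise their complements in \<open>Y'\<close>, have ranks with
        total at most \<open>2 * \<rho> Y + 1\<close>. If both intersections were nonempty,
        connectedness of \<open>Y\<close> would give at least \<open>2 * \<rho> Y + 2\<close> after
        submodularity.\<close>
      have cross: "A \<inter> C = {} \<or> (Y' - A) \<inter> (Y' - C) = {}"
        if A: "A \<subset> Y'" "\<rho> A + \<rho> (Y' - A) \<le> \<rho> Y" and C: "C \<subset> Y'" "\<rho> (insert x C) + \<rho> (insert x (Y' - C)) \<le> \<rho> Y + 1"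
        for A C
      proof (rule ccontr)
        assume ne: "\<not> ?thesis"
        have eqs: "Y - A \<inter> C = (Y' - A) \<union> insert x (Y' - C)" "Y - (Y' - A) \<inter> (Y' - C) = A \<union> insert x C"
          "A \<inter> insert x C = A \<inter> C" "(Y' - A) \<inter> insert x (Y' - C) = (Y' - A) \<inter> (Y' - C)"
          using A(1) C(1) Y(1,2) by auto
        have "\<rho> Y < \<rho> (A \<inter> C) + \<rho> (Y - A \<inter> C)"
          using ne A(1) Y(1) by (intro conn) auto
        moreover have "\<rho> Y < \<rho> ((Y' - A) \<inter> (Y' - C)) + \<rho> (Y - (Y' - A) \<inter> (Y' - C))"
          using ne Y(1,2) by (intro conn) auto
        ultimately show False
          using rank_submodular[of A "insert x C"] rank_submodular[of "Y' - A" "insert x (Y' - C)"] A(2) C(2)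
          unfolding eqs by linarith
      qed
      have "A \<inter> C = {} \<or> (Y' - A) \<inter> (Y' - C) = {}"
        using A C(1) C' x1 by (intro cross) auto
      moreover have "(Y' - (Y' - C)) = C" using C by auto
      then have "A \<inter> (Y' - C) = {} \<or> (Y' - A) \<inter> (Y' - (Y' - C)) = {}"
        using A C(1,2) C' x1 by (intro cross) (auto simp: add.commute)
      \<comment> \<open>Among the four intersections of \<open>A\<close> or its complement with
        \<open>C\<close> or its complement, one of each opposite pair is empty; then one of the four
        sets is empty.\<close>
      ultimately show False using A C by blast
    qed
    then show ?thesis
    proof
      assume "connected_set Y'"
      then obtain Z where "Z \<subseteq> Y' - {e, g}" "\<rho> (insert e Z) = Suc (\<rho> Z)" "\<rho> (insert g Z) = Suc (\<rho> Z)"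
          "\<rho> (insert e (insert g Z)) = Suc (\<rho> Z)"
        using less.hyps[OF Y(4) less.prems(1) Y(3) _ Y(5,6) less.prems(6)] by blast
      then show ?thesis using Y(1) by (intro exI[of _ Z]) auto
    next
      assume "S.connected_set Y'"
      then obtain Z where "Z \<subseteq> Y' - {e, g}" "\<sigma> (insert e Z) = Suc (\<sigma> Z)" "\<sigma> (insert g Z) = Suc (\<sigma> Z)"
          "\<sigma> (insert e (insert g Z)) = Suc (\<sigma> Z)"
        using less.hyps[OF Y(4) S.rank_function_axioms Y(3) _ Y(5,6) less.prems(6)] by blast
      then show ?thesis
        using Y(1) x by (intro exI[of _ "insert x Z"]) (auto simp: \<sigma> insert_commute[of _ x])
    qed
  qed
qed

section \<open>Matroid rank, circuits and the number of components\<close>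

context matroid
begin

abbreviation "rk \<equiv> matroid_rank indep"

lemma finite_indep_cards: "finite (card ` {Y. Y \<subseteq> X \<and> indep Y})"
proof (rule finite_imageI)
  show "finite {Y. Y \<subseteq> X \<and> indep Y}"
    by (rule finite_subset[of _ "Pow E"]) (use indep_subset_ground finite_ground in auto)
qed

lemma card_le_rank: "indep Y \<Longrightarrow> Y \<subseteq> X \<Longrightarrow> card Y \<le> rk X"
  unfolding matroid_rank_def using finite_indep_cards by (intro Max_ge) auto

lemma ex_indep_card_rank: "\<exists>Y. Y \<subseteq> X \<and> indep Y \<and> card Y = rk X"
proof -
  have "rk X \<in> card ` {Y. Y \<subseteq> X \<and> indep Y}"
    unfolding matroid_rank_def using finite_indep_cards indep_empty by (intro Max_in) auto
  then show ?thesis by auto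
qed

lemma finite_indep: "indep Y \<Longrightarrow> finite Y"
  using indep_subset_ground finite_ground finite_subset by blast

lemma indep_extend:
  assumes "indep I" "I \<subseteq> X"
  shows "\<exists>J. I \<subseteq> J \<and> J \<subseteq> X \<and> indep J \<and> card J = rk X"
  using assms
proof (induction "rk X - card I" arbitrary: I rule: less_induct)
  case less
  show ?case
  proof (cases "card I < rk X")
    case True
    obtain Y where Y: "Y \<subseteq> X" "indep Y" "card Y = rk X" using ex_indep_card_rank by blast
    then obtain y where y: "y \<in> Y - I" "indep (insert y I)"
      using indep_augment[OF less.prems(1) Y(2)] True by auto
    then have "\<exists>J. insert y I \<subseteq> J \<and> J \<subseteq> X \<and> indep J \<and> card J = rk X"
      using less.prems Y True finite_indep[OF less.prems(1)] by (intro less.hyps) auto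
    then show ?thesis by blast
  next
    case False
    then show ?thesis using less.prems card_le_rank[OF less.prems] by auto
  qed
qed

lemma rank_indep: "indep X \<Longrightarrow> rk X = card X"
  using card_le_rank[of X X] ex_indep_card_rank[of X] card_mono[OF finite_indep] by (metis dual_order.antisym order.refl)

lemma indep_if_rank_card: "finite X \<Longrightarrow> rk X = card X \<Longrightarrow> indep X"
  using ex_indep_card_rank[of X] card_subset_eq by metis

lemma rank_function_matroid_rank: "rank_function rk"
proof
  show "rk {} = 0" using rank_indep[OF indep_empty] by simp
  show mono: "rk A \<le> rk B" if "A \<subseteq> B" for A B
    using ex_indep_card_rank[of A] card_le_rank[of _ B] that by (metis order.trans)
  show "rk (insert a A) \<le> Suc (rk A)" for a A
  proof -
    obtain Y where Y: "Y \<subseteq> insert a A" "indep Y" "card Y = rk (insert a A)" using ex_indep_card_rank by blast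
    have "card (Y - {a}) \<le> rk A"
      using Y by (intro card_le_rank indep_mono[OF Y(2)]) auto
    moreover have "card Y \<le> Suc (card (Y - {a}))"
      using card_Diff_singleton_if[of Y a] by auto
    ultimately show ?thesis using Y(3) by simp
  qed
  show "rk (A \<union> B) + rk (A \<inter> B) \<le> rk A + rk B" for A B
  proof -
    obtain I where I: "I \<subseteq> A \<inter> B" "indep I" "card I = rk (A \<inter> B)" using ex_indep_card_rank by blast
    then obtain J where J: "I \<subseteq> J" "J \<subseteq> A \<union> B" "indep J" "card J = rk (A \<union> B)"
      using indep_extend[of I "A \<union> B"] by auto
    have "card (J \<inter> A) \<le> rk A" "card (J \<inter> B) \<le> rk B"
      by (intro card_le_rank indep_mono[OF J(3)]; auto)+
    moreover have "J \<inter> A \<union> J \<inter> B = J" using J(2) by auto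
    then have "card J + card (J \<inter> A \<inter> (J \<inter> B)) = card (J \<inter> A) + card (J \<inter> B)"
      using card_Un_Int[of "J \<inter> A" "J \<inter> B"] finite_indep[OF J(3)] by simp
    moreover have "card I \<le> card (J \<inter> A \<inter> (J \<inter> B))"
      using I J finite_indep[OF J(3)] by (intro card_mono) auto
    ultimately show ?thesis using I J by simp
  qed
qed

sublocale rank_function rk
  by (rule rank_function_matroid_rank)

lemma rank_remove_not_coloop:
  assumes "e \<in> E" "\<not> is_coloop E indep e"
  shows "rk (E - {e}) = rk E"
proof -
  obtain B where B: "matroid_basis indep B" "e \<notin> B"
    using assms by (auto simp: is_coloop_def)
  then have "indep B" by (simp add: matroid_basis_def)
  then obtain J where J: "B \<subseteq> J" "indep J" "card J = rk E"
    using indep_extend[of B E] indep_subset_ground by auto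
  then have "J = B" using B(1) by (auto simp: matroid_basis_def)
  then have "rk E \<le> rk (E - {e})"
    using J B(2) indep_subset_ground[OF \<open>indep B\<close>] card_le_rank[of B "E - {e}"] by auto
  then show ?thesis using rank_mono[of "E - {e}" E] by auto
qed

lemma rank_not_loop: "e \<in> E \<Longrightarrow> \<not> is_loop E indep e \<Longrightarrow> rk {e} \<noteq> 0"
  using rank_indep[of "{e}"] by (auto simp: is_loop_def)

text \<open>If \<open>I\<close> is a maximal independent subset of \<open>Z\<close>, then adding
  either \<open>e\<close> or \<open>g\<close> keeps it independent while adding both does not. A
  minimal dependent subset of the latter therefore contains both elements.\<close>

lemma common_circuit:
  assumes "connected_set C" "C \<subseteq> E" "e \<in> C" "g \<in> C" "e \<noteq> g"
  shows "\<exists>D. matroid_circuit E indep D \<and> e \<in> D \<and> g \<in> D"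
proof -
  have "finite C" using assms(2) finite_ground finite_subset by blast
  then obtain Z where Z: "Z \<subseteq> C - {e, g}" "rk (insert e Z) = Suc (rk Z)" "rk (insert g Z) = Suc (rk Z)"
      "rk (insert e (insert g Z)) = Suc (rk Z)"
    using connected_imp_parallel[OF rank_function_matroid_rank _ assms(1,3,4,5)] by blast
  obtain I where I: "I \<subseteq> Z" "indep I" "card I = rk Z" using ex_indep_card_rank by blast
  have fin: "finite I" using finite_indep[OF I(2)] .
  have eg: "e \<notin> I" "g \<notin> I" using I(1) Z(1) by auto
  have ind: "indep (insert a I)" if "rk (insert a Z) = Suc (rk Z)" "a \<notin> I" for a
  proof (rule indep_if_rank_card)
    have "rk (insert a I) \<noteq> rk I" using spanned_mono[OF _ I(1), of a] that by auto
    then show "rk (insert a I) = card (insert a I)"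
      using rank_insert_cases[of a I] rank_indep[OF I(2)] that fin by auto
  qed (use fin in simp)
  define W where "W = insert e (insert g I)"
  have W: "finite W" "W \<subseteq> E" using fin I(1) Z(1) assms by (auto simp: W_def)
  have "rk W \<le> Suc (rk Z)"
    unfolding W_def Z(4)[symmetric] using I(1) by (intro rank_mono) auto
  then have "\<not> indep W"
    using rank_indep[of W] fin eg assms(5) I(3) by (auto simp: W_def)
  then have "{D. D \<subseteq> W \<and> \<not> indep D} \<noteq> {}" by auto
  then obtain D where D: "D \<subseteq> W" "\<not> indep D" "\<And>D'. D' \<subseteq> W \<Longrightarrow> \<not> indep D' \<Longrightarrow> D' \<subseteq> D \<Longrightarrow> D = D'"
    using finite_has_minimal[of "{D. D \<subseteq> W \<and> \<not> indep D}"] W(1) by auto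
  have "matroid_circuit E indep D"
    unfolding matroid_circuit_def using D W(2) by blast
  moreover have "e \<in> D" "g \<in> D"
    using D(1,2) indep_mono[OF ind[OF Z(2) eg(1)], of D] indep_mono[OF ind[OF Z(3) eg(2)], of D]
    by (auto simp: W_def)
  ultimately show ?thesis by blast
qed

text \<open>Otherwise all traces of the circuit on the components are proper subsets, hence
  independent, and additivity of the rank makes the circuit itself independent.\<close>

lemma circuit_subset_component:
  assumes \<C>: "component_partition \<C>" "\<Union>\<C> = E" and D: "matroid_circuit E indep D" and C: "C \<in> \<C>" "e \<in> C" "e \<in> D"
  shows "D \<subseteq> C"
proof (rule ccontr)
  assume "\<not> D \<subseteq> C"
  have DE: "D \<subseteq> E" "\<not> indep D" "\<And>A. A \<subset> D \<Longrightarrow> indep A" using D by (auto simp: matroid_circuit_def)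
  have fin: "finite \<C>" "disjoint \<C>" "finite D"
    using \<C> DE(1) finite_ground by (auto simp: component_partition_def intro: finite_subset)
  have proper: "D \<inter> C' \<subset> D" if "C' \<in> \<C>" for C'
    using that C fin(2) \<open>\<not> D \<subseteq> C\<close> by (cases "C' = C") (auto simp: pairwise_def disjnt_def)
  have "rk D = (\<Sum>C'\<in>\<C>. rk (D \<inter> C'))" using \<C> DE(1) by (auto simp: component_partition_def)
  also have "\<dots> = (\<Sum>C'\<in>\<C>. card (D \<inter> C'))"
    using DE(3) proper rank_indep by (intro sum.cong) auto
  also have "\<dots> = card (\<Union>C'\<in>\<C>. D \<inter> C')"
    using fin by (intro card_UN_disjoint[symmetric]) (auto simp: pairwise_def disjnt_def)
  also have "(\<Union>C'\<in>\<C>. D \<inter> C') = D" using \<C>(2) DE(1) by auto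
  finally show False using indep_if_rank_card[OF fin(3)] DE(2) by simp
qed

text \<open>Identifying the circuit relation with membership in a common part also yields its
  transitivity.\<close>

lemma num_components_eq:
  assumes \<C>: "component_partition \<C>" "\<Union>\<C> = E"
  shows "num_components E indep = card \<C>"
proof -
  have disj: "disjoint \<C>" and conn: "\<And>C. C \<in> \<C> \<Longrightarrow> connected_set C"
    using \<C>(1) by (auto simp: component_partition_def)
  have rel: "component_rel E indep = {(e, f). \<exists>C\<in>\<C>. e \<in> C \<and> f \<in> C}" (is "?L = ?R")
  proof
    show "?L \<subseteq> ?R"
    proof clarify
      fix e f assume ef: "(e, f) \<in> component_rel E indep"
      then obtain C where C: "C \<in> \<C>" "e \<in> C" using \<C>(2) by (auto simp: component_rel_def)
      have "f \<in> C"
        using ef C(2) circuit_subset_component[OF \<C> _ C] by (auto simp: component_rel_def)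
      then show "\<exists>C\<in>\<C>. e \<in> C \<and> f \<in> C" using C by blast
    qed
    show "?R \<subseteq> ?L"
    proof (clarsimp simp: component_rel_def)
      fix e f C assume C: "C \<in> \<C>" "e \<in> C" "f \<in> C"
      have "C \<subseteq> E" using C(1) \<C>(2) by auto
      then show "e \<in> E \<and> f \<in> E \<and> (e = f \<or> (\<exists>C. matroid_circuit E indep C \<and> e \<in> C \<and> f \<in> C))"
        using C common_circuit[OF conn[OF C(1)]] by blast
    qed
  qed
  have img: "component_rel E indep `` {e} = C" if C: "C \<in> \<C>" "e \<in> C" for e C
  proof -
    have "C' = C" if "C' \<in> \<C>" "e \<in> C'" for C'
      using that C disj by (auto simp: pairwise_def disjnt_def)
    then show ?thesis unfolding rel using C by blast
  qed
  have "E // component_rel E indep = \<C>"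
  proof
    show "E // component_rel E indep \<subseteq> \<C>"
      using img \<C>(2) by (auto simp: quotient_def)
    show "\<C> \<subseteq> E // component_rel E indep"
    proof
      fix C assume C: "C \<in> \<C>"
      then obtain e where "e \<in> C" using conn by (auto simp: connected_set_def)
      then show "C \<in> E // component_rel E indep"
        using img[OF C] C \<C>(2) by (auto simp: quotient_def)
    qed
  qed
  then show ?thesis by (simp add: num_components_def)
qed

end
section \<open>Evaluation and degree of integer polynomials\<close>

definition monomial_value :: "('a \<Rightarrow> real) \<Rightarrow> ('a \<Rightarrow>\<^sub>0 nat) \<Rightarrow> real" where
  "monomial_value z m = (\<Prod>a\<in>Poly_Mapping.keys m. z a ^ Poly_Mapping.lookup m a)"

definition monomial_degree :: "('a \<Rightarrow>\<^sub>0 nat) \<Rightarrow> nat" where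
  "monomial_degree m = (\<Sum>a\<in>Poly_Mapping.keys m. Poly_Mapping.lookup m a)"

lemma monomial_superset:
  assumes "finite A" "Poly_Mapping.keys m \<subseteq> A"
  shows "monomial_value z m = (\<Prod>a\<in>A. z a ^ Poly_Mapping.lookup m a)"
    and "monomial_degree m = (\<Sum>a\<in>A. Poly_Mapping.lookup m a)"
  unfolding monomial_value_def monomial_degree_def
  using assms by (auto intro!: prod.mono_neutral_left sum.mono_neutral_left simp: in_keys_iff)

lemma monomial_add:
  shows "monomial_value z (m + m') = monomial_value z m * monomial_value z m'"
    and "monomial_degree (m + m') = monomial_degree m + monomial_degree m'"
proof -
  let ?A = "Poly_Mapping.keys m \<union> Poly_Mapping.keys m'"
  have A: "finite ?A" "Poly_Mapping.keys m \<subseteq> ?A" "Poly_Mapping.keys m' \<subseteq> ?A" "Poly_Mapping.keys (m + m') \<subseteq> ?A"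
    using Poly_Mapping.keys_add[of m m'] by auto
  show "monomial_value z (m + m') = monomial_value z m * monomial_value z m'"
    unfolding monomial_superset(1)[OF A(1,2)] monomial_superset(1)[OF A(1,3)] monomial_superset(1)[OF A(1,4)]
    by (simp add: lookup_add power_add prod.distrib)
  show "monomial_degree (m + m') = monomial_degree m + monomial_degree m'"
    unfolding monomial_superset(2)[OF A(1,2)] monomial_superset(2)[OF A(1,3)] monomial_superset(2)[OF A(1,4)]
    by (simp add: lookup_add sum.distrib)
qed

definition mapping_value :: "('a \<Rightarrow> real) \<Rightarrow> (('a \<Rightarrow>\<^sub>0 nat) \<Rightarrow>\<^sub>0 int) \<Rightarrow> real" where
  "mapping_value z f = (\<Sum>m\<in>Poly_Mapping.keys f. of_int (Poly_Mapping.lookup f m) * monomial_value z m)"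

lemma mapping_value_superset:
  "finite M \<Longrightarrow> Poly_Mapping.keys f \<subseteq> M \<Longrightarrow>
    mapping_value z f = (\<Sum>m\<in>M. of_int (Poly_Mapping.lookup f m) * monomial_value z m)"
  unfolding mapping_value_def by (rule sum.mono_neutral_left) (auto simp: in_keys_iff)

lemma mapping_value_add: "mapping_value z (f + g) = mapping_value z f + mapping_value z g"
proof -
  let ?M = "Poly_Mapping.keys f \<union> Poly_Mapping.keys g"
  have M: "finite ?M" "Poly_Mapping.keys f \<subseteq> ?M" "Poly_Mapping.keys g \<subseteq> ?M" "Poly_Mapping.keys (f + g) \<subseteq> ?M"
    using Poly_Mapping.keys_add[of f g] by auto
  show ?thesis
    unfolding mapping_value_superset[OF M(1,2)] mapping_value_superset[OF M(1,3)] mapping_value_superset[OF M(1,4)]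
    by (simp add: lookup_add distrib_right sum.distrib)
qed

lemma mapping_value_single: "mapping_value z (Poly_Mapping.single m c) = of_int c * monomial_value z m"
  by (simp add: mapping_value_def)

lemma mapping_value_sum: "mapping_value z (sum f A) = (\<Sum>a\<in>A. mapping_value z (f a))"
proof (induction A rule: infinite_finite_induct)
  case (insert a A)
  then show ?case by (simp add: mapping_value_add)
qed (simp_all add: mapping_value_def)

lemma mapping_eq_sum_single:
  fixes f :: "'b \<Rightarrow>\<^sub>0 int"
  shows "f = (\<Sum>m\<in>Poly_Mapping.keys f. Poly_Mapping.single m (Poly_Mapping.lookup f m))"
proof (rule poly_mapping_eqI)
  fix k
  have "Poly_Mapping.lookup f k = (if k \<in> Poly_Mapping.keys f then Poly_Mapping.lookup f k else 0)"
    by (simp add: in_keys_iff)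
  then show "Poly_Mapping.lookup f k =
      Poly_Mapping.lookup (\<Sum>m\<in>Poly_Mapping.keys f. Poly_Mapping.single m (Poly_Mapping.lookup f m)) k"
    by (simp add: lookup_sum lookup_single when_def)
qed

lemma mapping_value_mult: "mapping_value z (f * g) = mapping_value z f * mapping_value z g"
proof -
  have "f * g = (\<Sum>m\<in>Poly_Mapping.keys f. \<Sum>m'\<in>Poly_Mapping.keys g.
      Poly_Mapping.single (m + m') (Poly_Mapping.lookup f m * Poly_Mapping.lookup g m'))"
    by (subst mapping_eq_sum_single[of f], subst mapping_eq_sum_single[of g]) (simp add: sum_product mult_single)
  then have "mapping_value z (f * g) = (\<Sum>m\<in>Poly_Mapping.keys f. \<Sum>m'\<in>Poly_Mapping.keys g.
      of_int (Poly_Mapping.lookup f m * Poly_Mapping.lookup g m') * monomial_value z (m + m'))"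
    by (simp only: mapping_value_sum mapping_value_single)
  then show ?thesis
    by (simp add: monomial_add(1) mapping_value_def[of z f] mapping_value_def[of z g] sum_product mult_ac)
qed

definition zpoly_value :: "('a \<Rightarrow> real) \<Rightarrow> 'a zpoly \<Rightarrow> real" where
  "zpoly_value z q = mapping_value z (Rep_zpoly q)"

lemma zpoly_value_simps [simp]:
  "zpoly_value z 0 = 0" "zpoly_value z 1 = 1" "zpoly_value z (zvar a) = z a"
  "zpoly_value z (p + q) = zpoly_value z p + zpoly_value z q"
  "zpoly_value z (p * q) = zpoly_value z p * zpoly_value z q"
  by (simp_all add: zpoly_value_def zero_zpoly.rep_eq one_zpoly.rep_eq plus_zpoly.rep_eq times_zpoly.rep_eq zvar.rep_eq
      mapping_value_add mapping_value_mult mapping_value_single mapping_value_def[of z 0] monomial_value_def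
      flip: single_one)

lemma zpoly_value_uminus [simp]: "zpoly_value z (- p) = - zpoly_value z p"
  using zpoly_value_simps(4)[of z p "- p"] by simp

lemma zpoly_value_diff [simp]: "zpoly_value z (p - q) = zpoly_value z p - zpoly_value z q"
  using zpoly_value_simps(4)[of z p "- q"] by simp

lemma zpoly_value_power [simp]: "zpoly_value z (p ^ k) = zpoly_value z p ^ k"
  by (induction k) auto

lemma zpoly_value_sum: "zpoly_value z (sum f A) = (\<Sum>a\<in>A. zpoly_value z (f a))"
  by (induction A rule: infinite_finite_induct) auto

lemma zpoly_value_prod: "zpoly_value z (prod f A) = (\<Prod>a\<in>A. zpoly_value z (f a))"
  by (induction A rule: infinite_finite_induct) auto

lemma zpoly_value_of_int [simp]: "zpoly_value z (of_int d) = of_int d"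
proof -
  have nat: "zpoly_value z (of_nat k) = of_nat k" for k by (induction k) auto
  show ?thesis by (cases d) (auto simp: nat simp del: of_nat_Suc)
qed

section \<open>Homogeneous integer polynomials as a grading\<close>

definition homogeneous :: "int \<Rightarrow> 'a zpoly \<Rightarrow> bool" where
  "homogeneous d q \<longleftrightarrow> (\<forall>m\<in>Poly_Mapping.keys (Rep_zpoly q). int (monomial_degree m) = d)"

lemma homogeneous_0: "homogeneous d 0"
  by (simp add: homogeneous_def zero_zpoly.rep_eq)

lemma homogeneous_1: "homogeneous 0 1"
  by (simp add: homogeneous_def one_zpoly.rep_eq monomial_degree_def)

lemma homogeneous_zvar: "homogeneous 1 (zvar a)"
  by (simp add: homogeneous_def zvar.rep_eq monomial_degree_def)

lemma homogeneous_add: "homogeneous d p \<Longrightarrow> homogeneous d q \<Longrightarrow> homogeneous d (p + q)"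
  using Poly_Mapping.keys_add[of "Rep_zpoly p" "Rep_zpoly q"] by (auto simp: homogeneous_def plus_zpoly.rep_eq)

lemma homogeneous_uminus: "homogeneous d p \<Longrightarrow> homogeneous d (- p)"
  by (simp add: homogeneous_def uminus_zpoly.rep_eq)

lemma homogeneous_mult: "homogeneous c p \<Longrightarrow> homogeneous d q \<Longrightarrow> homogeneous (c + d) (p * q)"
  using Poly_Mapping.keys_mult[of "Rep_zpoly p" "Rep_zpoly q"]
  by (fastforce simp: homogeneous_def times_zpoly.rep_eq monomial_add(2))

lemma homogeneous_0_int:
  assumes "homogeneous 0 q"
  shows "\<exists>d. q = of_int d"
proof -
  have "m = 0" if "m \<in> Poly_Mapping.keys (Rep_zpoly q)" for m
  proof -
    have "monomial_degree m = 0" using assms that by (simp add: homogeneous_def)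
    then have "Poly_Mapping.keys m = {}" by (fastforce simp: monomial_degree_def in_keys_iff)
    then show ?thesis by (simp only: keys_eq_empty)
  qed
  then have "Rep_zpoly q = Poly_Mapping.single 0 (Poly_Mapping.lookup (Rep_zpoly q) 0)"
    by (intro poly_mapping_eqI) (metis in_keys_iff lookup_single_eq lookup_single_not_eq)
  moreover have "Rep_zpoly (of_int d) = Poly_Mapping.single 0 d" for d
  proof -
    have nat: "Rep_zpoly (of_nat k) = Poly_Mapping.single 0 (int k)" for k
    proof (induction k)
      case (Suc k)
      show ?case
        by (simp only: of_nat_Suc plus_zpoly.rep_eq one_zpoly.rep_eq Suc.IH single_add) (simp only: single_one)
    qed (simp add: zero_zpoly.rep_eq)
    show ?thesis
    proof (cases d)
      case (neg k)
      have "Rep_zpoly (of_int (- int (Suc k))) = - Poly_Mapping.single 0 (int (Suc k))"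
        by (simp only: of_int_minus of_int_of_nat_eq uminus_zpoly.rep_eq nat)
      then show ?thesis using neg by (simp only: single_uminus)
    qed (simp only: of_int_of_nat_eq nat)
  qed
  ultimately show ?thesis by (metis Rep_zpoly_inject)
qed

text \<open>The denominator 1 matters: membership says that a fraction is a polynomial with integer
  coefficients.\<close>

definition fract_grading :: "int \<Rightarrow> 'a zpoly fract set" where
  "fract_grading d = {Fract q 1 | q. homogeneous d q}"

lemma grading_fract_grading: "grading (fract_grading :: int \<Rightarrow> 'a zpoly fract set)"
  unfolding grading_def
proof (intro conjI allI ballI)
  show "(1 :: 'a zpoly fract) \<in> fract_grading 0"
    using homogeneous_1 by (auto simp: fract_grading_def One_fract_def)
  show "(0 :: 'a zpoly fract) \<in> fract_grading d" for d
    using homogeneous_0 by (auto simp: fract_grading_def Zero_fract_def)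
  show "- x \<in> fract_grading d" if "x \<in> fract_grading d" for d and x :: "'a zpoly fract"
    using that homogeneous_uminus by (fastforce simp: fract_grading_def)
  show "x + y \<in> fract_grading d" if "x \<in> fract_grading d" "y \<in> fract_grading d" for d and x y :: "'a zpoly fract"
    using that homogeneous_add by (fastforce simp: fract_grading_def)
  show "x * y \<in> fract_grading (c + d)" if "x \<in> fract_grading c" "y \<in> fract_grading d" for c d and x y :: "'a zpoly fract"
    using that homogeneous_mult by (fastforce simp: fract_grading_def)
qed

text \<open>This allows \<open>p\<close> to be a further variable of degree 1 in
  \<open>end_sum_graded\<close>, so that the degree of each coefficient of a power of
  \<open>p\<close> is known.\<close>

lemma grading_graded_poly:
  fixes R :: "int \<Rightarrow> 'k::comm_ring_1 set"
  assumes R: "grading R"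
  shows "grading (\<lambda>d. {q. graded_poly R d q})"
  unfolding grading_def
proof (intro conjI allI ballI)
  show "1 \<in> {q. graded_poly R 0 q}"
    by (auto simp: graded_poly_def coeff_1 grading_one[OF R] grading_zero[OF R])
  show "p * q \<in> {q. graded_poly R (c + d) q}" if "p \<in> {q. graded_poly R c q}" "q \<in> {q. graded_poly R d q}" for c d p q
  proof -
    have "coeff p k * coeff q (i - k) \<in> R (c + d - int i)" if "k \<le> i" for i k
    proof -
      have "coeff p k \<in> R (c - int k)" "coeff q (i - k) \<in> R (d - int (i - k))"
        using \<open>p \<in> _\<close> \<open>q \<in> _\<close> by (simp_all only: graded_poly_def mem_Collect_eq)
      moreover have "c - int k + (d - int (i - k)) = c + d - int i" using that by simp
      ultimately show ?thesis by (metis grading_mult[OF R])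
    qed
    then show ?thesis
      by (auto simp: graded_poly_def coeff_mult intro!: grading_sum[OF R])
  qed
qed (auto simp: graded_poly_def intro: grading_zero[OF R] grading_uminus[OF R] grading_add[OF R])

section \<open>Elementary symmetric polynomials\<close>

text \<open>Indexed by subsets instead of list positions, since the order within
  \<open>x_list\<close> and \<open>y_list\<close> does not affect the value.\<close>

definition elem_sym_on :: "('a \<Rightarrow> 'b::comm_ring_1) \<Rightarrow> nat \<Rightarrow> 'a set \<Rightarrow> 'b" where
  "elem_sym_on f k C = (\<Sum>S | S \<subseteq> C \<and> card S = k. \<Prod>c\<in>S. f c)"

lemma elem_sym_map:
  assumes "distinct ys"
  shows "elem_sym k (map f ys) = elem_sym_on f k (set ys)"
proof -
  have inj: "inj_on ((!) ys) S" if "S \<subseteq> {..<length ys}" for S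
    using inj_on_nth[OF assms, of S] that by auto
  have "elem_sym k (map f ys) = (\<Sum>S | S \<subseteq> {..<length ys} \<and> card S = k. \<Prod>c\<in>(!) ys ` S. f c)"
    unfolding elem_sym_def length_map
  proof (rule sum.cong[OF refl])
    fix S assume "S \<in> {S. S \<subseteq> {..<length ys} \<and> card S = k}"
    then have S: "S \<subseteq> {..<length ys}" by simp
    then have "(\<Prod>i\<in>S. map f ys ! i) = (\<Prod>i\<in>S. f (ys ! i))" by (intro prod.cong) auto
    then show "(\<Prod>i\<in>S. map f ys ! i) = (\<Prod>c\<in>(!) ys ` S. f c)"
      using inj[OF S] by (simp add: prod.reindex)
  qed
  also have "\<dots> = elem_sym_on f k (set ys)"
    unfolding elem_sym_on_def
  proof (rule sum.reindex_bij_witness[of _ "\<lambda>T. {i. i < length ys \<and> ys ! i \<in> T}" "\<lambda>S. (!) ys ` S"])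
    fix S assume "S \<in> {S. S \<subseteq> {..<length ys} \<and> card S = k}"
    then show "{i. i < length ys \<and> ys ! i \<in> (!) ys ` S} = S" "(!) ys ` S \<in> {S. S \<subseteq> set ys \<and> card S = k}"
      using assms inj[of S] by (auto simp: nth_eq_iff_index_eq card_image)
  next
    fix T assume T: "T \<in> {T. T \<subseteq> set ys \<and> card T = k}"
    show eq: "(!) ys ` {i. i < length ys \<and> ys ! i \<in> T} = T"
    proof
      show "T \<subseteq> (!) ys ` {i. i < length ys \<and> ys ! i \<in> T}"
      proof
        fix c assume c: "c \<in> T"
        then have "c \<in> set ys" using T by auto
        then obtain i where "i < length ys" "ys ! i = c" by (auto simp: in_set_conv_nth)
        then show "c \<in> (!) ys ` {i. i < length ys \<and> ys ! i \<in> T}" using c by auto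
      qed
    qed auto
    have "card {i. i < length ys \<and> ys ! i \<in> T} = card ((!) ys ` {i. i < length ys \<and> ys ! i \<in> T})"
      by (rule card_image[symmetric], rule inj) auto
    then show "{i. i < length ys \<and> ys ! i \<in> T} \<in> {S. S \<subseteq> {..<length ys} \<and> card S = k}"
      using T eq by auto
  qed auto
  finally show ?thesis .
qed

lemma elem_sym_on_0 [simp]: "finite C \<Longrightarrow> elem_sym_on f 0 C = 1"
proof -
  assume "finite C"
  then have "{S. S \<subseteq> C \<and> card S = 0} = {{}}" by (auto simp: finite_subset)
  then show ?thesis unfolding elem_sym_on_def by (simp only:) simp
qed

lemma elem_sym_on_card: "finite C \<Longrightarrow> elem_sym_on f (card C) C = (\<Prod>c\<in>C. f c)"
proof -
  assume "finite C"
  then have "{S. S \<subseteq> C \<and> card S = card C} = {C}" using card_subset_eq[of C] by blast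
  then show ?thesis by (simp add: elem_sym_on_def)
qed

lemma elem_sym_on_gt:
  assumes "finite C" "card C < k"
  shows "elem_sym_on f k C = 0"
proof -
  have "card S \<noteq> k" if "S \<subseteq> C" for S using card_mono[OF assms(1) that] assms(2) by simp
  then have "{S. S \<subseteq> C \<and> card S = k} = {}" by auto
  then show ?thesis unfolding elem_sym_on_def by (simp only:) simp
qed

lemma elem_sym_on_insert:
  assumes "finite C" "a \<notin> C"
  shows "elem_sym_on f (Suc k) (insert a C) = elem_sym_on f (Suc k) C + f a * elem_sym_on f k C"
proof -
  have "{S. S \<subseteq> insert a C \<and> card S = Suc k} = {S. S \<subseteq> C \<and> card S = Suc k} \<union> insert a ` {S. S \<subseteq> C \<and> card S = k}" (is "?L = ?A \<union> ?B")
  proof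
    show "?L \<subseteq> ?A \<union> ?B"
    proof
      fix S assume S: "S \<in> ?L"
      show "S \<in> ?A \<union> ?B"
      proof (cases "a \<in> S")
        case True
        then have "S = insert a (S - {a})" "S - {a} \<in> {S. S \<subseteq> C \<and> card S = k}"
          using S assms(1) by (auto simp: card_Diff_singleton)
        then show ?thesis by blast
      qed (use S in auto)
    qed
    show "?A \<union> ?B \<subseteq> ?L"
    proof -
      have "card (insert a S) = Suc (card S)" if "S \<subseteq> C" for S
        using that assms finite_subset[OF that assms(1)] by (intro card_insert_disjoint) auto
      then show ?thesis by auto
    qed
  qed
  moreover have "finite ?A" "finite ?B" using assms(1) by auto
  moreover have "?A \<inter> ?B = {}" using assms(2) by auto
  moreover have "inj_on (insert a) {S. S \<subseteq> C \<and> card S = k}"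
    using assms(2) by (intro inj_onI) (metis (no_types, lifting) insert_ident mem_Collect_eq subsetD)
  moreover have "(\<Prod>c\<in>insert a S. f c) = f a * (\<Prod>c\<in>S. f c)" if "S \<subseteq> C" for S
    using that assms finite_subset[OF that assms(1)] by (intro prod.insert) auto
  ultimately show ?thesis
    by (simp add: elem_sym_on_def sum.union_disjoint sum.reindex sum_distrib_left)
qed

lemma prod_add_elem_sym:
  assumes "finite C"
  shows "(\<Prod>c\<in>C. f c + b) = (\<Sum>k\<le>card C. elem_sym_on f k C * b ^ (card C - k))"
proof -
  have "(\<Prod>c\<in>C. f c + b) = (\<Sum>S\<in>Pow C. prod f S * b ^ (card C - card S))"
    using assms by (subst prod_add) (auto intro!: sum.cong simp: card_Diff_subset finite_subset)
  also have "\<dots> = (\<Sum>k\<le>card C. \<Sum>S | S \<in> Pow C \<and> card S = k. prod f S * b ^ (card C - card S))"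
    using assms by (intro sum.group[symmetric]) (auto intro: card_mono)
  also have "\<dots> = (\<Sum>k\<le>card C. elem_sym_on f k C * b ^ (card C - k))"
    by (intro sum.cong refl) (auto simp: elem_sym_on_def sum_distrib_right intro!: sum.cong)
  finally show ?thesis .
qed

lemma prod_pCons_const: "(\<Prod>c\<in>S. [:f c:]) = [:\<Prod>c\<in>S. f c:]"
  by (induction S rule: infinite_finite_induct) (auto simp: one_pCons mult.commute)

lemma prod_pCons_0: "(\<Prod>c\<in>S. [:0, f c:]) = monom (\<Prod>c\<in>S. f c) (card S)"
proof -
  have "[:0, a:] = monom a 1" for a :: 'a by (simp add: monom_altdef)
  then show ?thesis
    by (induction S rule: infinite_finite_induct) (simp_all add: mult_monom)
qed

lemma coeff_prod_linear:
  fixes f :: "'a \<Rightarrow> 'b::comm_ring_1"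
  assumes "finite C" "m \<le> card C"
  shows "coeff (\<Prod>c\<in>C. [:f c, - 1:]) m = (- 1) ^ m * elem_sym_on f (card C - m) C"
proof -
  have "(\<Sum>S\<in>A. [:g S:]) = [:\<Sum>S\<in>A. g S:]" for g :: "'a set \<Rightarrow> 'b" and A
    by (induction A rule: infinite_finite_induct) auto
  then have es: "elem_sym_on (\<lambda>c. [:f c:]) k C = [:elem_sym_on f k C:]" for k
    by (simp add: elem_sym_on_def prod_pCons_const)
  have "[:0, - 1:] ^ k = (monom ((- 1) ^ k) k :: 'b poly)" for k :: nat
    using monom_power[of "- 1 :: 'b" 1 k] by (simp add: monom_Suc monom_0)
  then have "(\<Prod>c\<in>C. [:f c:] + [:0, - 1:]) = (\<Sum>k\<le>card C. smult (elem_sym_on f k C) (monom ((- 1) ^ (card C - k)) (card C - k)))"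
    unfolding prod_add_elem_sym[OF assms(1)] by (simp add: es)
  then have "coeff (\<Prod>c\<in>C. [:f c, - 1:]) m = (\<Sum>k\<le>card C. if card C - k = m then elem_sym_on f k C * (- 1) ^ m else 0)"
    by (simp add: coeff_sum) (intro sum.cong; simp)
  also have "\<dots> = (\<Sum>k\<in>{card C - m}. if card C - k = m then elem_sym_on f k C * (- 1) ^ m else 0)"
    using assms(2) by (intro sum.mono_neutral_right) auto
  finally show ?thesis using assms(2) by (simp add: mult.commute)
qed

text \<open>Here the variable stands for the scale \<open>x\<close> in \<open>x * f c - 1\<close>,
  whereas in \<open>coeff_prod_linear\<close> it stands for the parameter \<open>p\<close> in
  \<open>f c - p\<close>.\<close>

lemma coeff_prod_linear_reversed:
  fixes f :: "'a \<Rightarrow> 'b::comm_ring_1"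
  assumes "finite C" "k \<le> card C"
  shows "coeff (\<Prod>c\<in>C. [:- 1, f c:]) k = (- 1) ^ (card C - k) * elem_sym_on f k C"
proof -
  have "(\<Sum>S | S \<subseteq> C \<and> card S = j. monom (\<Prod>c\<in>S. f c) (card S)) = monom (elem_sym_on f j C) j" for j
  proof -
    have "(\<Sum>S | S \<subseteq> C \<and> card S = j. monom (\<Prod>c\<in>S. f c) (card S)) = (\<Sum>S | S \<subseteq> C \<and> card S = j. monom (\<Prod>c\<in>S. f c) j)"
      by (intro sum.cong) auto
    also have "\<dots> = monom (elem_sym_on f j C) j"
      unfolding elem_sym_on_def by (rule monom_sum[symmetric])
    finally show ?thesis .
  qed
  then have es: "elem_sym_on (\<lambda>c. [:0, f c:]) j C = monom (elem_sym_on f j C) j" for j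
    by (subst elem_sym_on_def) (simp add: prod_pCons_0)
  have "[:- 1:] ^ j = [:(- 1) ^ j :: 'b:]" for j :: nat
    by (induction j) (auto simp: one_pCons)
  then have "(\<Prod>c\<in>C. [:0, f c:] + [:- 1:]) = (\<Sum>j\<le>card C. monom (elem_sym_on f j C) j * [:(- 1) ^ (card C - j):])"
    unfolding prod_add_elem_sym[OF assms(1)] by (simp add: es)
  then have "coeff (\<Prod>c\<in>C. [:- 1, f c:]) k = (\<Sum>j\<le>card C. (- 1) ^ (card C - j) * (if j = k then elem_sym_on f j C else 0))"
    by (simp add: coeff_sum mult.commute)
  also have "\<dots> = (\<Sum>j\<in>{k}. (- 1) ^ (card C - j) * (if j = k then elem_sym_on f j C else 0))"
    using assms(2) by (intro sum.mono_neutral_right) auto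
  finally show ?thesis by simp
qed

text \<open>Dividing \<open>\<Prod>c\<in>C. (1 + f c * t)\<close> by \<open>1 + f l * t\<close>.\<close>

lemma sum_powers_elem_sym:
  assumes "finite C" "l \<in> C"
  shows "(\<Sum>j<Suc k. (- f l) ^ j * elem_sym_on f (Suc k - j - 1) C) = elem_sym_on f k (C - {l})"
proof (induction k)
  case (Suc k)
  have C: "insert l (C - {l}) = C" using assms(2) by auto
  have "(\<Sum>j<Suc (Suc k). (- f l) ^ j * elem_sym_on f (Suc (Suc k) - j - 1) C) =
      elem_sym_on f (Suc k) C + (\<Sum>j<Suc k. (- f l) ^ Suc j * elem_sym_on f (Suc (Suc k) - Suc j - 1) C)"
    by (subst sum.lessThan_Suc_shift) simp
  also have "(\<Sum>j<Suc k. (- f l) ^ Suc j * elem_sym_on f (Suc (Suc k) - Suc j - 1) C) =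
      - f l * (\<Sum>j<Suc k. (- f l) ^ j * elem_sym_on f (Suc k - j - 1) C)"
    unfolding sum_distrib_left by (intro sum.cong) (auto simp: mult_ac)
  also have "\<dots> = - f l * elem_sym_on f k (C - {l})" by (simp only: Suc.IH)
  also have "elem_sym_on f (Suc k) C = elem_sym_on f (Suc k) (C - {l}) + f l * elem_sym_on f k (C - {l})"
    using elem_sym_on_insert[of "C - {l}" l f k] assms(1) unfolding C by simp
  finally show ?case by simp
qed (use assms in simp)

section \<open>Sums over permutations\<close>

lemma sum_permutations_of_set_last:
  assumes "finite Y" "Y \<noteq> {}"
  shows "(\<Sum>w\<in>permutations_of_set Y. f w) = (\<Sum>a\<in>Y. \<Sum>w\<in>permutations_of_set (Y - {a}). f (w @ [a]))"
proof -
  have "(\<Sum>a\<in>Y. \<Sum>w\<in>permutations_of_set (Y - {a}). f (w @ [a])) =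
      (\<Sum>(a, w)\<in>Sigma Y (\<lambda>a. permutations_of_set (Y - {a})). f (w @ [a]))"
    using assms by (intro sum.Sigma) auto
  also have "\<dots> = (\<Sum>w\<in>permutations_of_set Y. f w)"
  proof (rule sum.reindex_bij_witness[of _ "\<lambda>w. (last w, butlast w)" "\<lambda>(a, w). w @ [a]"])
    fix w assume w: "w \<in> permutations_of_set Y"
    then have "w \<noteq> []" using assms by (auto dest: permutations_of_setD)
    then have eq: "butlast w @ [last w] = w" by simp
    then show "(case (last w, butlast w) of (a, w) \<Rightarrow> w @ [a]) = w" by simp
    have "set (butlast w @ [last w]) = Y" "distinct (butlast w @ [last w])"
      unfolding eq using permutations_of_setD[OF w] by auto
    then show "(last w, butlast w) \<in> Sigma Y (\<lambda>a. permutations_of_set (Y - {a}))"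
      by (auto intro!: permutations_of_setI)
  next
    fix p assume "p \<in> Sigma Y (\<lambda>a. permutations_of_set (Y - {a}))"
    then show "(case p of (a, w) \<Rightarrow> w @ [a]) \<in> permutations_of_set Y"
      using permutations_of_setD by (fastforce intro!: permutations_of_setI)
  qed auto
  finally show ?thesis by simp
qed

lemma end_sum_permutations:
  assumes "finite Y" "Y \<noteq> {}"
  shows "end_sum h u X Y \<phi> = (\<Sum>w\<in>permutations_of_set Y. (\<Prod>i<length w. h (w ! i) (X \<union> set (take i w))) *
    \<phi> (last w) * (\<Prod>i<length w - 1. u (w ! i) (w ! Suc i)))"
  using assms
proof (induction "card Y" arbitrary: Y \<phi> rule: less_induct)
  case less
  have "h a (X \<union> (Y - {a})) * \<phi> a * end_sum h u X (Y - {a}) (\<lambda>b. u b a) =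
      (\<Sum>w\<in>permutations_of_set (Y - {a}). (\<Prod>i<length (w @ [a]). h ((w @ [a]) ! i) (X \<union> set (take i (w @ [a])))) *
        \<phi> (last (w @ [a])) * (\<Prod>i<length (w @ [a]) - 1. u ((w @ [a]) ! i) ((w @ [a]) ! Suc i)))" if a: "a \<in> Y" for a
  proof -
    have prod_h: "(\<Prod>i<length (w @ [a]). h ((w @ [a]) ! i) (X \<union> set (take i (w @ [a])))) =
        h a (X \<union> (Y - {a})) * (\<Prod>i<length w. h (w ! i) (X \<union> set (take i w)))" if "w \<in> permutations_of_set (Y - {a})" for w
    proof -
      have "(\<Prod>i<length w. h ((w @ [a]) ! i) (X \<union> set (take i (w @ [a])))) = (\<Prod>i<length w. h (w ! i) (X \<union> set (take i w)))"
        by (intro prod.cong) (auto simp: nth_append)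
      then show ?thesis using permutations_of_setD(1)[OF that] by (simp add: mult.commute)
    qed
    show ?thesis
    proof (cases "Y - {a} = {}")
      case True
      show ?thesis using prod_h unfolding True by (simp add: permutations_of_set_empty)
    next
      case False
      have IH: "end_sum h u X (Y - {a}) (\<lambda>b. u b a) = (\<Sum>w\<in>permutations_of_set (Y - {a}).
          (\<Prod>i<length w. h (w ! i) (X \<union> set (take i w))) * u (last w) a * (\<Prod>i<length w - 1. u (w ! i) (w ! Suc i)))"
        using less.prems(1) a False by (intro less.hyps card_Diff1_less) auto
      have "(\<Prod>i<length (w @ [a]) - 1. u ((w @ [a]) ! i) ((w @ [a]) ! Suc i)) =
          u (last w) a * (\<Prod>i<length w - 1. u (w ! i) (w ! Suc i))" if "w \<in> permutations_of_set (Y - {a})" for w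
      proof -
        have "w \<noteq> []" using permutations_of_setD(1)[OF that] False by (metis list.set(1))
        then obtain k where k: "length w = Suc k" by (cases w) auto
        have "(\<Prod>i<k. u ((w @ [a]) ! i) ((w @ [a]) ! Suc i)) = (\<Prod>i<k. u (w ! i) (w ! Suc i))"
          using k by (intro prod.cong) (auto simp: nth_append)
        then show ?thesis using k \<open>w \<noteq> []\<close> by (simp add: nth_append last_conv_nth mult.commute)
      qed
      then show ?thesis
        unfolding IH sum_distrib_left using prod_h by (intro sum.cong) (auto simp: mult_ac)
    qed
  qed
  then show ?case
    unfolding end_sum_rec[OF less.prems] sum_permutations_of_set_last[OF less.prems] by (intro sum.cong) auto
qed

section \<open>The coefficient of \<open>t ^ r\<close>\<close>

context matroid
begin

definition cobasis :: "'a list \<Rightarrow> 'a set" where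
  "cobasis w = E - greedy_basis indep w"

lemma finite_cobasis [simp]: "finite (cobasis w)"
  using finite_ground by (simp add: cobasis_def)

lemma nth_in_greedy_basis_iff:
  assumes "w \<in> permutations_of_set E" "i < length w"
  shows "w ! i \<in> greedy_basis indep w \<longleftrightarrow> rk (insert (w ! i) (set (take i w))) \<noteq> rk (set (take i w))"
proof -
  have d: "distinct w" using permutations_of_setD[OF assms(1)] by simp
  have take: "set (take (Suc k) w) = insert (w ! k) (set (take k w))" if "k < length w" for k
    using that by (simp add: take_Suc_conv_app_nth)
  have "w ! i \<in> greedy_basis indep w \<longleftrightarrow> rk (set (take (Suc i) w)) > rk (set (take i w))"
    using assms(2) d by (auto simp: greedy_basis_def nth_eq_iff_index_eq)
  then show ?thesis
    using rank_insert_cases[of "w ! i" "set (take i w)"] by (auto simp: take[OF assms(2)])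
qed

lemma prod_rank_weight_permutation:
  assumes w: "w \<in> permutations_of_set E"
  shows "(\<Prod>i<length w. rank_weight rk g (w ! i) ({} \<union> set (take i w))) = (\<Prod>c\<in>cobasis w. g c)"
proof -
  have "(\<Prod>i<length w. rank_weight rk g (w ! i) ({} \<union> set (take i w))) =
      (\<Prod>i<length w. if w ! i \<in> greedy_basis indep w then 1 else g (w ! i))"
    using nth_in_greedy_basis_iff[OF w] by (intro prod.cong) (auto simp: rank_weight_def)
  also have "\<dots> = (\<Prod>c\<in>E. if c \<in> greedy_basis indep w then 1 else g c)"
    using permutations_of_setD[OF w] by (intro prod.reindex_bij_betw bij_betw_nth) auto
  also have "\<dots> = (\<Prod>c\<in>cobasis w. if c \<in> greedy_basis indep w then 1 else g c)"
    unfolding cobasis_def using finite_ground by (intro prod.mono_neutral_right) auto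
  also have "\<dots> = (\<Prod>c\<in>cobasis w. g c)"
    by (intro prod.cong) (auto simp: cobasis_def)
  finally show ?thesis .
qed

lemma card_cobasis:
  assumes w: "w \<in> permutations_of_set E"
  shows "card (cobasis w) + rk E = card E"
proof -
  let ?B = "greedy_basis indep w"
  have wE: "set w = E" "distinct w" using permutations_of_setD[OF w] by auto
  have "k \<le> length w \<Longrightarrow> (\<Sum>i<k. if w ! i \<in> ?B then 1 else 0) = rk (set (take k w))" for k
  proof (induction k)
    case (Suc k)
    then have "set (take (Suc k) w) = insert (w ! k) (set (take k w))"
      by (simp add: take_Suc_conv_app_nth)
    then show ?case
      using Suc nth_in_greedy_basis_iff[OF w, of k] rank_insert_cases[of "w ! k" "set (take k w)"] by auto
  qed (simp add: rank_empty)
  from this[of "length w"] have "(\<Sum>i<length w. if w ! i \<in> ?B then 1 else 0) = rk E"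
    using wE by simp
  also have "(\<Sum>i<length w. if w ! i \<in> ?B then 1 else 0) = (\<Sum>c\<in>E. if c \<in> ?B then 1 else 0 :: nat)"
    using wE by (intro sum.reindex_bij_betw bij_betw_nth) auto
  also have "\<dots> = card (E \<inter> ?B)"
    using finite_ground by (simp add: sum.If_cases)
  finally show ?thesis
    using card_Int_Diff[OF finite_ground, of ?B] by (simp add: cobasis_def)
qed

text \<open>The predecessors of the last element span it when it is not a coloop. Consequently the
  pole at the last element always cancels against a weight.\<close>

lemma last_in_cobasis:
  assumes w: "w \<in> permutations_of_set E" and "E \<noteq> {}" "\<And>e. e \<in> E \<Longrightarrow> rk (E - {e}) = rk E"
  shows "last w \<in> cobasis w"
proof -
  have wE: "set w = E" "distinct w" using permutations_of_setD[OF w] by auto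
  then have "w \<noteq> []" using assms(2) by auto
  have w': "w = butlast w @ [last w]" using \<open>w \<noteq> []\<close> by simp
  define k where "k = length w - 1"
  have k: "k < length w" "w ! k = last w" "take k w = butlast w"
    using \<open>w \<noteq> []\<close> by (auto simp: k_def last_conv_nth butlast_conv_take)
  have "distinct (butlast w @ [last w])" "set (butlast w @ [last w]) = E"
    using wE w' by auto
  then have "set (butlast w) = E - {last w}" "last w \<in> E" by auto
  then show ?thesis
    using nth_in_greedy_basis_iff[OF w k(1)] assms(3)[of "last w"]
    by (auto simp: k cobasis_def insert_absorb)
qed

lemma end_sum_cobasis:
  assumes "E \<noteq> {}"
  shows "end_sum (rank_weight rk g) u {} E \<phi> = (\<Sum>w\<in>permutations_of_set E.
    (\<Prod>c\<in>cobasis w. g c) * \<phi> (last w) * (\<Prod>i<length w - 1. u (w ! i) (w ! Suc i)))"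
  unfolding end_sum_permutations[OF finite_ground assms]
  by (intro sum.cong refl) (simp only: prod_rank_weight_permutation)

text \<open>The classes of the summand \<open>i = r\<close> of \<open>g_poly\<close>;
  \<open>rk E - rk E\<close> is left unsimplified so that they match that summand literally.\<close>

definition omega_class :: "nat \<Rightarrow> 'a list \<Rightarrow> 'a zpoly" where
  "omega_class j w = alpha_class w ^ j * elem_sym (rk E - j - 1) (map uminus (y_list indep w))
     * elem_sym (rk E - rk E) (x_list indep w) * elem_sym (card E - rk E) (y_list indep w)"

lemma omega_class_eq:
  assumes w: "w \<in> permutations_of_set E"
  shows "omega_class j w = (- zvar (last w)) ^ j * elem_sym_on zvar (rk E - j - 1) (cobasis w) * (\<Prod>c\<in>cobasis w. - zvar c)"
proof -
  let ?ys = "filter (\<lambda>e. e \<notin> greedy_basis indep w) (rev w)" and ?xs = "filter (\<lambda>e. e \<in> greedy_basis indep w) w"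
  have wE: "set w = E" "distinct w" using permutations_of_setD[OF w] by auto
  have ys: "distinct ?ys" "set ?ys = cobasis w" using wE by (auto simp: cobasis_def)
  have "map uminus (y_list indep w) = map zvar ?ys" by (simp add: y_list_def)
  then have 1: "elem_sym (rk E - j - 1) (map uminus (y_list indep w)) = elem_sym_on zvar (rk E - j - 1) (cobasis w)"
    using elem_sym_map[OF ys(1), of _ zvar] ys(2) by simp
  have 2: "elem_sym (rk E - rk E) (x_list indep w) = 1"
    using elem_sym_map[of ?xs 0 zvar] wE finite_ground by (simp add: x_list_def)
  have "card E - rk E = card (cobasis w)" using card_cobasis[OF w] by simp
  then have 3: "elem_sym (card E - rk E) (y_list indep w) = (\<Prod>c\<in>cobasis w. - zvar c)"
    using elem_sym_map[OF ys(1), of _ "\<lambda>e. - zvar e"] ys(2) by (simp add: y_list_def elem_sym_on_card)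
  show ?thesis unfolding omega_class_def 1 2 3 by (simp add: alpha_class_def)
qed

end

section \<open>Fractions of polynomials and their values at real points\<close>

lemma zvar_diff_nonzero: "a \<noteq> b \<Longrightarrow> zvar a - zvar b \<noteq> 0"
proof
  assume "a \<noteq> b" "zvar a - zvar b = 0"
  then have "zpoly_value (\<lambda>e. if e = a then 1 else 0) (zvar a - zvar b) = 0" by simp
  then show False using \<open>a \<noteq> b\<close> by simp
qed

lemma Fract_1_add: "Fract (p + q) 1 = Fract p 1 + Fract (q :: 'b::idom) 1"
  by simp

lemma Fract_1_mult: "Fract (p * q) 1 = Fract p 1 * Fract (q :: 'b::idom) 1"
  by simp

lemma Fract_1_prod: "Fract (prod f A) 1 = (\<Prod>a\<in>A. Fract (f a :: 'b::idom) 1)"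
  by (induction A rule: infinite_finite_induct) (simp_all add: Fract_1_mult fract_collapse del: mult_fract)

lemma Fract_1_sum: "Fract (sum f A) 1 = (\<Sum>a\<in>A. Fract (f a :: 'b::idom) 1)"
  by (induction A rule: infinite_finite_induct) (simp_all add: Fract_1_add fract_collapse del: add_fract)

lemma Fract_1_power: "Fract (q ^ k) 1 = Fract (q :: 'b::idom) 1 ^ k"
  by (induction k) (simp_all add: Fract_1_mult fract_collapse del: mult_fract)

lemma Fract_elem_sym_on: "Fract (elem_sym_on f k C) 1 = elem_sym_on (\<lambda>c. Fract (f c :: 'b::idom) 1) k C"
  by (simp add: elem_sym_on_def Fract_1_sum Fract_1_prod)

lemma permutations_nth_neq:
  assumes "w \<in> permutations_of_set E" "i < length w - 1"
  shows "w ! i \<noteq> w ! Suc i" "w ! i \<in> E" "w ! Suc i \<in> E"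
  using assms permutations_of_setD[OF assms(1)] by (auto simp: nth_eq_iff_index_eq)

text \<open>Evaluation makes sense only for fractions whose denominator does not vanish at
  \<open>z\<close>; the induction carries along a common denominator with this property.\<close>

lemma zpoly_value_sum_Fract:
  assumes "finite W" "\<And>w. w \<in> W \<Longrightarrow> zpoly_value z (P w) \<noteq> 0"
    and "(\<Sum>w\<in>W. Fract (N w) (P w)) = of_int d"
  shows "(\<Sum>w\<in>W. zpoly_value z (N w) / zpoly_value z (P w)) = of_int d"
proof -
  have "\<exists>A B. (\<Sum>w\<in>W. Fract (N w) (P w)) = Fract A B \<and> zpoly_value z B \<noteq> 0 \<and>
      (\<Sum>w\<in>W. zpoly_value z (N w) / zpoly_value z (P w)) = zpoly_value z A / zpoly_value z B"
    using assms(1,2)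
  proof (induction W rule: finite_induct)
    case empty
    show ?case by (rule exI[of _ 0], rule exI[of _ 1]) (simp add: fract_collapse)
  next
    case (insert w W)
    then obtain A B where AB: "(\<Sum>w\<in>W. Fract (N w) (P w)) = Fract A B" "zpoly_value z B \<noteq> 0"
      "(\<Sum>w\<in>W. zpoly_value z (N w) / zpoly_value z (P w)) = zpoly_value z A / zpoly_value z B" by auto
    have "P w \<noteq> 0" "B \<noteq> 0" "zpoly_value z (P w) \<noteq> 0" using AB(2) insert.prems[of w] by auto
    then show ?case
      using insert.hyps AB by - (rule exI[of _ "N w * B + A * P w"], rule exI[of _ "P w * B"], simp add: add_frac_eq)
  qed
  then obtain A B where AB: "Fract A B = of_int d" "zpoly_value z B \<noteq> 0"
    "(\<Sum>w\<in>W. zpoly_value z (N w) / zpoly_value z (P w)) = zpoly_value z A / zpoly_value z B"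
    using assms(3) by auto
  have "B \<noteq> 0" using AB(2) by auto
  then have "A = of_int d * B" using AB(1) by (simp add: of_int_fract_zpoly eq_fract)
  then show ?thesis using AB(2,3) by simp
qed

context matroid
begin

text \<open>The coefficients of powers of \<open>p\<close> in the sum with the weights \<open>z c * (z c - p)\<close> are the sums that define
  \<open>g_poly\<close>, and by homogeneity the relevant coefficient has degree 0.\<close>

lemma perm_deg_omega_class_int:
  assumes "E \<noteq> {}" "j < rk E"
  shows "\<exists>d. perm_deg E (omega_class j) = of_int d"
proof (cases "rk E - j - 1 \<le> card E - rk E")
  case False
  \<comment> \<open>The index of the elementary symmetric polynomial exceeds the size of the
    cobasis.\<close>
  have "omega_class j w = 0" if "w \<in> permutations_of_set E" for w
    using False card_cobasis[OF that] by (simp add: omega_class_eq[OF that] elem_sym_on_gt)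
  then have "perm_deg E (omega_class j) = of_int 0"
    by (simp add: perm_deg_def Zero_fract_def[symmetric] fract_collapse)
  then show ?thesis by blast
next
  case True
  define Z :: "'a \<Rightarrow> 'a zpoly fract" where "Z a = Fract (zvar a) 1" for a
  have Zd: "Z a - Z b \<noteq> 0" if "a \<noteq> b" for a b
    using zvar_diff_nonzero[OF that] by (simp add: Z_def Zero_fract_def eq_fract)
  let ?R = "\<lambda>d. {q. graded_poly (fract_grading :: int \<Rightarrow> 'a zpoly fract set) d q}"
  note H = grading_fract_grading[where ?'a = 'a]
  note R = grading_graded_poly[OF H]
  define u :: "'a \<Rightarrow> 'a \<Rightarrow> 'a zpoly fract poly" where "u a b = [:1 / (Z a - Z b):]" for a b
  \<comment> \<open>The parameter \<open>p\<close> is the variable \<open>[:0, 1:]\<close>. At the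
    last element \<open>monom 1 j\<close> gives \<open>alpha_class w ^ j\<close> up to sign.\<close>
  define G where "G = end_sum (rank_weight rk (\<lambda>a. [:Z a:] * ([:Z a:] - [:0, 1:]))) u {} E (\<lambda>b. poly (monom 1 j) [:Z b:])"
  \<comment> \<open>In the product of the \<open>Z c - p\<close> over the cobasis,
    \<open>p ^ m\<close> goes with the elementary symmetric polynomial of degree
    \<open>rk E - j - 1\<close>. The same \<open>m\<close> makes the degree
    \<open>card E + 1 - 2 * rk E + j - m\<close> equal to 0.\<close>
  define m where "m = card E - rk E - (rk E - j - 1)"
  have coeffG: "coeff G m = (\<Sum>w\<in>permutations_of_set E. (- 1) ^ m * ((\<Prod>c\<in>cobasis w. Z c) * Z (last w) ^ j *
      (\<Prod>i<length w - 1. 1 / (Z (w ! i) - Z (w ! Suc i))) * elem_sym_on Z (rk E - j - 1) (cobasis w)))"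
    unfolding G_def end_sum_cobasis[OF assms(1)] coeff_sum
  proof (rule sum.cong[OF refl])
    fix w assume w: "w \<in> permutations_of_set E"
    have pow: "[:Z (last w):] ^ j = [:Z (last w) ^ j:]" by (simp add: poly_const_pow)
    have "(\<Prod>c\<in>cobasis w. [:Z c:] * ([:Z c:] - [:0, 1:])) = [:\<Prod>c\<in>cobasis w. Z c:] * (\<Prod>c\<in>cobasis w. [:Z c, - 1:])"
    proof -
      have "[:Z c:] * ([:Z c:] - [:0, 1:]) = [:Z c:] * [:Z c, - 1:]" for c by simp
      then show ?thesis by (simp only: prod.distrib prod_pCons_const)
    qed
    moreover have "coeff (\<Prod>c\<in>cobasis w. [:Z c, - 1:]) m = (- 1) ^ m * elem_sym_on Z (rk E - j - 1) (cobasis w)"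
    proof -
      have "m \<le> card (cobasis w)" "card (cobasis w) - m = rk E - j - 1"
        using card_cobasis[OF w] True unfolding m_def by linarith+
      then show ?thesis using coeff_prod_linear[of "cobasis w" m Z] by simp
    qed
    ultimately show "coeff ((\<Prod>c\<in>cobasis w. [:Z c:] * ([:Z c:] - [:0, 1:])) * poly (monom 1 j) [:Z (last w):] *
        (\<Prod>i<length w - 1. u (w ! i) (w ! Suc i))) m =
      (- 1) ^ m * ((\<Prod>c\<in>cobasis w. Z c) * Z (last w) ^ j *
        (\<Prod>i<length w - 1. 1 / (Z (w ! i) - Z (w ! Suc i))) * elem_sym_on Z (rk E - j - 1) (cobasis w))"
      by (simp add: u_def prod_pCons_const poly_monom pow mult_ac)
  qed
  have "perm_deg E (omega_class j) = (\<Sum>w\<in>permutations_of_set E. (- 1) ^ (j + (card E - rk E)) * ((\<Prod>c\<in>cobasis w. Z c) * Z (last w) ^ j *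
      (\<Prod>i<length w - 1. 1 / (Z (w ! i) - Z (w ! Suc i))) * elem_sym_on Z (rk E - j - 1) (cobasis w)))"
    unfolding perm_deg_def
  proof (rule sum.cong[OF refl])
    fix w assume w: "w \<in> permutations_of_set E"
    let ?D = "\<Prod>i<length w - 1. zvar (w ! i) - zvar (w ! Suc i)"
    have card_C: "card (cobasis w) = card E - rk E" using card_cobasis[OF w] by simp
    have "Fract (omega_class j w) ?D = Fract (omega_class j w) 1 * (1 / Fract ?D 1)"
      by (simp add: One_fract_def)
    also have "1 / Fract ?D 1 = (\<Prod>i<length w - 1. 1 / (Z (w ! i) - Z (w ! Suc i)))"
      unfolding Fract_1_prod by (simp add: prod_dividef Z_def)
    also have "Fract (omega_class j w) 1 = (- Z (last w)) ^ j * elem_sym_on Z (rk E - j - 1) (cobasis w) * (\<Prod>c\<in>cobasis w. - Z c)"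
      unfolding omega_class_eq[OF w] Fract_1_mult Fract_1_power Fract_elem_sym_on Fract_1_prod
      by (simp add: Z_def[abs_def])
    finally show "Fract (omega_class j w) ?D = (- 1) ^ (j + (card E - rk E)) * ((\<Prod>c\<in>cobasis w. Z c) * Z (last w) ^ j *
      (\<Prod>i<length w - 1. 1 / (Z (w ! i) - Z (w ! Suc i))) * elem_sym_on Z (rk E - j - 1) (cobasis w))"
      by (simp add: prod_uminus card_C power_add power_minus[of "Z (last w)"] mult_ac)
  qed
  also have "\<dots> = (- 1) ^ (j + (card E - rk E)) * ((- 1) ^ m * coeff G m)"
    unfolding coeffG by (simp add: sum_distrib_left power_mult_distrib[symmetric] flip: mult.assoc)
  finally have eq: "perm_deg E (omega_class j) = (- 1) ^ (j + (card E - rk E)) * ((- 1) ^ m * coeff G m)" .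
  have "G \<in> ?R (int (card E) + 1 - 2 * (int (rk ({} \<union> E)) - int (rk {})) + int j)"
    unfolding G_def
  proof (rule end_sum_graded[OF R])
    have 0: "(0 :: 'a zpoly fract) \<in> fract_grading d" and 1: "(1 :: 'a zpoly fract) \<in> fract_grading 0" for d
      using grading_zero[OF H] grading_one[OF H] by auto
    show "[:0, 1:] \<in> ?R 1"
      using 0 1 by (simp add: graded_poly_pCons) (simp add: graded_poly_def)
    have "Z a \<in> fract_grading 1" for a
      unfolding fract_grading_def Z_def by (rule CollectI, rule exI[of _ "zvar a"]) (simp add: homogeneous_zvar)
    then show "[:Z a:] \<in> ?R 1" for a
      using 0 by (simp add: graded_poly_pCons) (simp add: graded_poly_def)
    show "graded_poly ?R (int j) (monom 1 j)"
      using grading_zero[OF R] grading_one[OF R] by (simp add: graded_poly_def[of ?R])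
    show "inverse_differences (\<lambda>a. [:Z a:]) u E"
      using Zd by (simp add: inverse_differences_def u_def one_pCons)
  qed (use finite_ground assms in auto)
  then have "coeff G m \<in> fract_grading (int (card E) + 1 - 2 * int (rk E) + int j - int m)"
    by (simp add: graded_poly_def rank_empty)
  moreover have "int (card E) + 1 - 2 * int (rk E) + int j - int m = 0"
    using True assms(2) rank_le_card[OF finite_ground, of "{}"] by (simp add: m_def rank_empty)
  ultimately obtain d where "coeff G m = of_int d"
    using homogeneous_0_int by (fastforce simp: fract_grading_def of_int_fract_zpoly)
  then have "perm_deg E (omega_class j) = of_int ((- 1) ^ (j + (card E - rk E)) * ((- 1) ^ m * d))"
    unfolding eq by simp
  then show ?thesis by blast
qed

text \<open>In \<open>g_poly\<close> each power of the variable is multiplied by an integer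
  constant, so only the summand \<open>i = r\<close> reaches the coefficient in question.\<close>

lemma omega_invariant_eq_sum:
  assumes "E \<noteq> {}" "\<not> (\<exists>e. is_loop E indep e \<or> is_coloop E indep e)" "0 < rk E"
  shows "omega_invariant E indep = (- 1) ^ num_components E indep * ((- 1) ^ rk E * (\<Sum>j<rk E. int_value (perm_deg E (omega_class j))))"
proof -
  define s where "s i = (\<Sum>j<i. int_value (perm_deg E (\<lambda>w. alpha_class w ^ j * elem_sym (i - j - 1) (map uminus (y_list indep w))
            * elem_sym (rk E - i) (x_list indep w) * elem_sym (card E - rk E) (y_list indep w))))" for i
  have const: "(\<Sum>j\<in>J. [:f j :: int:]) = [:\<Sum>j\<in>J. f j:]" for f and J :: "nat set"
    by (induction J rule: infinite_finite_induct) auto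
  have pow: "(- [:0, 1:]) ^ i = (monom ((- 1) ^ i) i :: int poly)" for i
    using monom_power[of "- 1 :: int" 1 i] by (simp add: monom_Suc monom_0)
  have "g_poly E indep = (- 1) ^ num_components E indep * (\<Sum>i=1..rk E. (- [:0, 1:]) ^ i * [:s i:])"
    using assms(1,2) by (simp add: g_poly_def Let_def const s_def)
  also have "(- 1 :: int poly) ^ num_components E indep = [:(- 1) ^ num_components E indep:]"
    by (simp add: minus_one_power_iff) (simp add: one_pCons)
  finally have "omega_invariant E indep = (- 1) ^ num_components E indep * (\<Sum>i=1..rk E. coeff ((- [:0, 1:]) ^ i * [:s i:]) (rk E))"
    by (simp add: omega_invariant_def coeff_sum)
  also have "(\<Sum>i=1..rk E. coeff ((- [:0, 1:]) ^ i * [:s i:]) (rk E)) = (\<Sum>i=1..rk E. if i = rk E then (- 1) ^ i * s i else 0)"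
    unfolding pow by (intro sum.cong) (auto simp: smult_monom)
  also have "(\<Sum>i=1..rk E. if i = rk E then (- 1) ^ i * s i else 0) = (- 1) ^ rk E * s (rk E)"
    using assms(3) by simp
  finally show ?thesis by (simp add: s_def omega_class_def[abs_def])
qed

text \<open>An integer value may be read off at any real point with distinct coordinates. The sum
  over \<open>j\<close> is then the division of \<open>sum_powers_elem_sym\<close> by the factor of
  the last element, which lies in the cobasis.\<close>

lemma sum_int_value_omega_class:
  fixes z :: "'a \<Rightarrow> real"
  assumes "E \<noteq> {}" "0 < rk E" "inj_on z E" "\<And>e. e \<in> E \<Longrightarrow> rk (E - {e}) = rk E"
  shows "real_of_int (\<Sum>j<rk E. int_value (perm_deg E (omega_class j))) = (- 1) ^ (card E - rk E) *
    (\<Sum>w\<in>permutations_of_set E. (\<Prod>c\<in>cobasis w. z c) * (\<Prod>i<length w - 1. 1 / (z (w ! i) - z (w ! Suc i))) *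
       elem_sym_on z (rk E - 1) (cobasis w - {last w}))"
proof -
  define D where "D w = (\<Prod>i<length w - 1. 1 / (z (w ! i) - z (w ! Suc i)))" for w
  have "real_of_int (int_value (perm_deg E (omega_class j))) = (\<Sum>w\<in>permutations_of_set E.
      (- z (last w)) ^ j * elem_sym_on z (rk E - j - 1) (cobasis w) * (\<Prod>c\<in>cobasis w. - z c) * D w)" if "j < rk E" for j
  proof -
    obtain d where d: "perm_deg E (omega_class j) = of_int d"
      using perm_deg_omega_class_int[OF assms(1) \<open>j < rk E\<close>] by blast
    have "(\<Sum>w\<in>permutations_of_set E. zpoly_value z (omega_class j w) /
        zpoly_value z (\<Prod>i<length w - 1. zvar (w ! i) - zvar (w ! Suc i))) = of_int d"
    proof (rule zpoly_value_sum_Fract)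
      show "zpoly_value z (\<Prod>i<length w - 1. zvar (w ! i) - zvar (w ! Suc i)) \<noteq> 0" if w: "w \<in> permutations_of_set E" for w
      proof -
        have "z (w ! i) \<noteq> z (w ! Suc i)" if "i < length w - 1" for i
          using permutations_nth_neq[OF w that] inj_onD[OF assms(3)] by blast
        then show ?thesis by (simp add: zpoly_value_prod)
      qed
      show "(\<Sum>w\<in>permutations_of_set E. Fract (omega_class j w) (\<Prod>i<length w - 1. zvar (w ! i) - zvar (w ! Suc i))) = of_int d"
        using d by (simp add: perm_deg_def)
    qed simp
    moreover have "zpoly_value z (elem_sym_on zvar k C) = elem_sym_on z k C" for k C
      by (simp add: elem_sym_on_def zpoly_value_sum zpoly_value_prod)
    then have "zpoly_value z (omega_class j w) / zpoly_value z (\<Prod>i<length w - 1. zvar (w ! i) - zvar (w ! Suc i)) =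
        (- z (last w)) ^ j * elem_sym_on z (rk E - j - 1) (cobasis w) * (\<Prod>c\<in>cobasis w. - z c) * D w"
      if "w \<in> permutations_of_set E" for w
      by (simp add: omega_class_eq[OF that] zpoly_value_prod D_def prod_dividef)
    ultimately show ?thesis unfolding d by simp
  qed
  then have "real_of_int (\<Sum>j<rk E. int_value (perm_deg E (omega_class j))) = (\<Sum>j<rk E. \<Sum>w\<in>permutations_of_set E.
      (- z (last w)) ^ j * elem_sym_on z (rk E - j - 1) (cobasis w) * (\<Prod>c\<in>cobasis w. - z c) * D w)"
    by simp
  also have "\<dots> = (\<Sum>w\<in>permutations_of_set E. (\<Sum>j<rk E. (- z (last w)) ^ j * elem_sym_on z (rk E - j - 1) (cobasis w)) *
      (\<Prod>c\<in>cobasis w. - z c) * D w)"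
    by (subst sum.swap) (simp add: sum_distrib_right)
  also have "\<dots> = (\<Sum>w\<in>permutations_of_set E. (- 1) ^ (card E - rk E) * ((\<Prod>c\<in>cobasis w. z c) * D w *
       elem_sym_on z (rk E - 1) (cobasis w - {last w})))"
  proof (rule sum.cong[OF refl])
    fix w assume w: "w \<in> permutations_of_set E"
    have "(\<Sum>j<rk E. (- z (last w)) ^ j * elem_sym_on z (rk E - j - 1) (cobasis w)) = elem_sym_on z (rk E - 1) (cobasis w - {last w})"
      using sum_powers_elem_sym[OF finite_cobasis last_in_cobasis[OF w assms(1,4)], of z "rk E - 1"] assms(2) by simp
    moreover have "card (cobasis w) = card E - rk E" using card_cobasis[OF w] by simp
    ultimately show "(\<Sum>j<rk E. (- z (last w)) ^ j * elem_sym_on z (rk E - j - 1) (cobasis w)) * (\<Prod>c\<in>cobasis w. - z c) * D w =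
        (- 1) ^ (card E - rk E) * ((\<Prod>c\<in>cobasis w. z c) * D w * elem_sym_on z (rk E - 1) (cobasis w - {last w}))"
      by (simp add: prod_uminus mult_ac)
  qed
  finally show ?thesis by (simp add: D_def sum_distrib_left)
qed

text \<open>Replacing \<open>z\<close> by \<open>x * z\<close> does not change the sum, so only one power of \<open>x\<close> occurs in its expansion.\<close>

lemma real_sum_eq_elem_sym:
  fixes z :: "'a \<Rightarrow> real"
  assumes "E \<noteq> {}" "0 < rk E" "2 * rk E \<le> card E" "inj_on z E" "\<And>a. a \<in> E \<Longrightarrow> 2 \<le> z a"
    and nl: "\<And>e. e \<in> E \<Longrightarrow> rk {e} \<noteq> 0" "\<And>e. e \<in> E \<Longrightarrow> rk (E - {e}) = rk E"
  shows "real_sum rk z {} E (\<lambda>b. 1 / (z b - 1)) = (- 1) ^ card E *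
    (\<Sum>w\<in>permutations_of_set E. (\<Prod>c\<in>cobasis w. z c) * (\<Prod>i<length w - 1. 1 / (z (w ! i) - z (w ! Suc i))) *
       elem_sym_on z (rk E - 1) (cobasis w - {last w}))"
proof -
  define F where "F = real_sum rk z {} E (\<lambda>b. 1 / (z b - 1))"
  define D where "D w = (\<Prod>i<length w - 1. 1 / (z (w ! i) - z (w ! Suc i)))" for w
  \<comment> \<open>\<open>P\<close> is the sum at the coordinates \<open>x * z\<close>, as a
    polynomial in \<open>x\<close>, after the pole has been cancelled and the power of
    \<open>x\<close> common to all orderings has been taken out.\<close>
  define P where "P = (\<Sum>w\<in>permutations_of_set E. smult ((\<Prod>c\<in>cobasis w. z c) * D w) (\<Prod>c\<in>cobasis w - {last w}. [:- 1, z c:]))"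
  have z1: "z a \<noteq> 1" "1 \<le> z a" if "a \<in> E" for a using assms(5)[OF that] by auto
  have "eventually (\<lambda>x. real_sum rk (\<lambda>a. if a \<in> {} then z a else x * z a) {} E
      (\<lambda>b. 1 / ((if b \<in> {} then z b else x * z b) - 1)) = F) at_top"
    unfolding F_def by (intro eventually_real_sum_scale finite_ground assms(1,4) nl z1)
  then have "eventually (\<lambda>x. poly (P - monom F (rk E - 1)) x = 0) at_top"
    using eventually_gt_at_top[of 1]
  proof eventually_elim
    case (elim x)
    have "F = (\<Sum>w\<in>permutations_of_set E. (\<Prod>c\<in>cobasis w. x * z c * (x * z c - 1)) * (1 / (x * z (last w) - 1)) *
        (\<Prod>i<length w - 1. 1 / (x * z (w ! i) - x * z (w ! Suc i))))"
      using elim(1) end_sum_cobasis[OF assms(1), of "\<lambda>a. x * z a * (x * z a - 1)" "\<lambda>a b. 1 / (x * z a - x * z b)"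
          "\<lambda>b. 1 / (x * z b - 1)"] by simp
    then have "F * x ^ (card E - 1) = (\<Sum>w\<in>permutations_of_set E. (\<Prod>c\<in>cobasis w. x * z c * (x * z c - 1)) * (1 / (x * z (last w) - 1)) *
        (\<Prod>i<length w - 1. 1 / (x * z (w ! i) - x * z (w ! Suc i))) * x ^ (card E - 1))"
      by (simp only: sum_distrib_right)
    also have "\<dots> = (\<Sum>w\<in>permutations_of_set E. x ^ (card E - rk E) * poly (smult ((\<Prod>c\<in>cobasis w. z c) * D w) (\<Prod>c\<in>cobasis w - {last w}. [:- 1, z c:])) x)"
    proof (rule sum.cong[OF refl])
      fix w assume w: "w \<in> permutations_of_set E"
      note l = last_in_cobasis[OF w assms(1) nl(2)]
      have "2 \<le> z (last w)" using l assms(5) by (auto simp: cobasis_def)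
      then have "1 < x * z (last w)" using elim(2) mult_strict_mono[of 1 x 1 "z (last w)"] by simp
      then have 1: "(\<Prod>c\<in>cobasis w. x * z c - 1) * (1 / (x * z (last w) - 1)) = (\<Prod>c\<in>cobasis w - {last w}. x * z c - 1)"
        by (simp add: prod.remove[OF finite_cobasis l])
      have 2: "(\<Prod>c\<in>cobasis w. x * z c * (x * z c - 1)) = x ^ (card E - rk E) * (\<Prod>c\<in>cobasis w. z c) * (\<Prod>c\<in>cobasis w. x * z c - 1)"
      proof -
        have "card (cobasis w) = card E - rk E" using card_cobasis[OF w] by simp
        then show ?thesis by (simp add: prod.distrib)
      qed
      have 3: "(\<Prod>i<length w - 1. 1 / (x * z (w ! i) - x * z (w ! Suc i))) * x ^ (card E - 1) = D w"
      proof -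
        have "length w = card E" using w by (simp add: length_finite_permutations_of_set)
        moreover have "(\<Prod>i<length w - 1. 1 / (x * z (w ! i) - x * z (w ! Suc i))) = (\<Prod>i<length w - 1. 1 / x * (1 / (z (w ! i) - z (w ! Suc i))))"
          by (intro prod.cong) (auto simp: right_diff_distrib[symmetric])
        then have "(\<Prod>i<length w - 1. 1 / (x * z (w ! i) - x * z (w ! Suc i))) = (1 / x) ^ (length w - 1) * D w"
          by (simp only: prod.distrib D_def prod_constant card_lessThan)
        ultimately show ?thesis using elim(2) by (simp add: power_one_over)
      qed
      have 4: "poly (smult ((\<Prod>c\<in>cobasis w. z c) * D w) (\<Prod>c\<in>cobasis w - {last w}. [:- 1, z c:])) x =
          (\<Prod>c\<in>cobasis w. z c) * D w * (\<Prod>c\<in>cobasis w - {last w}. x * z c - 1)"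
        by (simp add: poly_prod)
      show "(\<Prod>c\<in>cobasis w. x * z c * (x * z c - 1)) * (1 / (x * z (last w) - 1)) *
        (\<Prod>i<length w - 1. 1 / (x * z (w ! i) - x * z (w ! Suc i))) * x ^ (card E - 1) =
        x ^ (card E - rk E) * poly (smult ((\<Prod>c\<in>cobasis w. z c) * D w) (\<Prod>c\<in>cobasis w - {last w}. [:- 1, z c:])) x"
        unfolding 2 4 unfolding 1[symmetric] 3[symmetric] by (simp only: mult_ac)
    qed
    also have "\<dots> = x ^ (card E - rk E) * poly P x"
      by (simp only: P_def poly_sum sum_distrib_left)
    also have "x ^ (card E - 1) = x ^ (card E - rk E) * x ^ (rk E - 1)"
      using assms(2,3) by (simp flip: power_add)
    finally show ?case using elim(2) by (simp add: poly_monom)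
  qed
  then obtain N where N: "\<And>x. N \<le> x \<Longrightarrow> poly (P - monom F (rk E - 1)) x = 0"
    by (auto simp: eventually_at_top_linorder)
  have "P - monom F (rk E - 1) = 0"
  proof (rule ccontr)
    assume "P - monom F (rk E - 1) \<noteq> 0"
    then have "finite {x. poly (P - monom F (rk E - 1)) x = 0}" by (rule poly_roots_finite)
    then have "finite {N..}" by (rule finite_subset[rotated]) (use N in auto)
    then show False by (simp add: infinite_Ici)
  qed
  then have "F = coeff P (rk E - 1)" by simp
  also have "\<dots> = (\<Sum>w\<in>permutations_of_set E. (\<Prod>c\<in>cobasis w. z c) * D w *
      ((- 1) ^ card E * elem_sym_on z (rk E - 1) (cobasis w - {last w})))"
    unfolding P_def coeff_sum coeff_smult
  proof (rule sum.cong[OF refl])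
    fix w assume w: "w \<in> permutations_of_set E"
    have "card (cobasis w - {last w}) + 1 + rk E = card E"
      using card_cobasis[OF w] card_Suc_Diff1[OF finite_cobasis last_in_cobasis[OF w assms(1) nl(2)]] by simp
    \<comment> \<open>By \<open>2 * rk E \<le> card E\<close> the index does not exceed the number
      of factors; the \<open>card E - 2 * rk E\<close> factors that contribute \<open>- 1\<close>
      give the sign.\<close>
    then have "rk E - 1 \<le> card (cobasis w - {last w})" "card (cobasis w - {last w}) - (rk E - 1) = card E - 2 * rk E"
      using assms(2,3) by linarith+
    moreover have "(- 1 :: real) ^ (card E - 2 * rk E) = (- 1) ^ card E"
      using assms(3) by (simp add: minus_one_power_iff)
    ultimately have "coeff (\<Prod>c\<in>cobasis w - {last w}. [:- 1, z c:]) (rk E - 1) = (- 1) ^ card E * elem_sym_on z (rk E - 1) (cobasis w - {last w})"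
      using coeff_prod_linear_reversed[of "cobasis w - {last w}" "rk E - 1" z] by simp
    then show "(\<Prod>c\<in>cobasis w. z c) * D w * coeff (\<Prod>c\<in>cobasis w - {last w}. [:- 1, z c:]) (rk E - 1) =
       (\<Prod>c\<in>cobasis w. z c) * D w * ((- 1) ^ card E * elem_sym_on z (rk E - 1) (cobasis w - {last w}))" by simp
  qed
  finally show ?thesis by (simp add: F_def D_def sum_distrib_left mult_ac)
qed

text \<open>The signs match: \<open>(- 1) ^ rk E\<close> from the power of \<open>- t\<close> and
  \<open>(- 1) ^ (card E - rk E)\<close> from the entries of \<open>y_list\<close> multiply to the
  \<open>(- 1) ^ card E\<close> of \<open>real_sum_eq_elem_sym\<close>.\<close>

lemma omega_invariant_eq_real_sum:
  fixes z :: "'a \<Rightarrow> real"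
  assumes "E \<noteq> {}" "\<not> (\<exists>e. is_loop E indep e \<or> is_coloop E indep e)" "2 * rk E \<le> card E"
    and z: "inj_on z E" "\<And>a. a \<in> E \<Longrightarrow> 2 \<le> z a"
  shows "of_int (omega_invariant E indep) = (- 1) ^ num_components E indep * real_sum rk z {} E (\<lambda>b. 1 / (z b - 1))"
proof -
  have nl: "rk {e} \<noteq> 0" "rk (E - {e}) = rk E" if "e \<in> E" for e
    using that assms(2) rank_not_loop rank_remove_not_coloop by auto
  obtain e where "e \<in> E" using assms(1) by auto
  then have r: "0 < rk E" using nl(1)[of e] rank_mono[of "{e}" E] by auto
  have "rk E \<le> card E" using rank_le_card[OF finite_ground, of "{}"] by (simp add: rank_empty)
  then have sign: "(- 1 :: real) ^ rk E * (- 1) ^ (card E - rk E) = (- 1) ^ card E"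
    by (simp flip: power_add)
  define S where "S = (\<Sum>w\<in>permutations_of_set E. (\<Prod>c\<in>cobasis w. z c) * (\<Prod>i<length w - 1. 1 / (z (w ! i) - z (w ! Suc i))) *
       elem_sym_on z (rk E - 1) (cobasis w - {last w}))"
  have "real_of_int (\<Sum>j<rk E. int_value (perm_deg E (omega_class j))) = (- 1) ^ (card E - rk E) * S"
    unfolding S_def by (rule sum_int_value_omega_class[OF assms(1) r z(1)]) (rule nl)
  moreover have "real_sum rk z {} E (\<lambda>b. 1 / (z b - 1)) = (- 1) ^ card E * S"
    unfolding S_def by (rule real_sum_eq_elem_sym[OF assms(1) r assms(3) z nl])
  ultimately have "(- 1) ^ rk E * real_of_int (\<Sum>j<rk E. int_value (perm_deg E (omega_class j))) = real_sum rk z {} E (\<lambda>b. 1 / (z b - 1))"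
    by (simp only: mult.assoc[symmetric] sign)
  then show ?thesis
    by (simp only: omega_invariant_eq_sum[OF assms(1,2) r] of_int_mult of_int_power of_int_minus of_int_1)
qed

end
theorem theorem1p7:
  fixes E :: "'a set" and indep :: "'a set \<Rightarrow> bool" and n r :: nat
  assumes "matroid E indep"
    and "n = card E"
    and "r = matroid_rank indep E"
  shows "(n = 2 * r \<longrightarrow> omega_invariant E indep = 0 \<or> omega_invariant E indep = 1) \<and>
         (n = 2 * r + 1 \<longrightarrow> 0 \<le> omega_invariant E indep \<and> omega_invariant E indep \<le> int r)"
proof -
  interpret matroid E indep by fact
  consider "E = {}" | "E \<noteq> {}" "\<exists>e. is_loop E indep e \<or> is_coloop E indep e"
    | "E \<noteq> {}" "\<not> (\<exists>e. is_loop E indep e \<or> is_coloop E indep e)" by blast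
  then show ?thesis
  proof cases
    case 1
    \<comment> \<open>For the empty matroid the polynomial is 1 and the rank 0, so the invariant is
      1, in accordance with \<open>n = 2 * r\<close>.\<close>
    then show ?thesis
      by (auto simp: omega_invariant_def g_poly_def rank_empty coeff_1 assms(2,3))
  next
    case 2
    then show ?thesis by (auto simp: omega_invariant_def g_poly_def)
  next
    case 3
    obtain f :: "'a \<Rightarrow> nat" where f: "inj_on f E"
      using finite_imp_inj_to_nat_seg[OF finite_ground] by auto
    \<comment> \<open>Coordinates of at least 2 stay away from the pole at 1 and from their
      reflections \<open>1 - z\<close>.\<close>
    define z where "z a = real (f a) + 2" for a
    have z: "inj_on z E" "\<And>a. a \<in> E \<Longrightarrow> 2 \<le> z a"
      using f by (auto simp: z_def inj_on_def)
    obtain \<C> where \<C>: "component_partition \<C>" "\<Union>\<C> = E"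
      using ex_component_partition[OF finite_ground] by blast
    have nl: "rk {e} \<noteq> 0" "rk (E - {e}) = rk E" if "e \<in> E" for e
      using that 3(2) rank_not_loop rank_remove_not_coloop by auto
    have eq: "of_int (omega_invariant E indep) = (- 1) ^ card \<C> * real_sum rk z {} E (\<lambda>b. 1 / (z b - 1))"
      if "2 * r \<le> n"
      using omega_invariant_eq_real_sum[OF 3 _ z] that by (simp add: assms(2,3) num_components_eq[OF \<C>])
    have "real_of_int (omega_invariant E indep) = 0 \<or> real_of_int (omega_invariant E indep) = 1" if "n = 2 * r"
      using eq real_sum_bounds(1)[OF \<C> z nl] that unfolding assms(2,3) by simp
    moreover have "0 \<le> real_of_int (omega_invariant E indep) \<and> real_of_int (omega_invariant E indep) \<le> real r" if "n = 2 * r + 1"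
      using eq real_sum_bounds(2)[OF \<C> z nl] that unfolding assms(2,3) by simp
    ultimately show ?thesis by auto
  qed
qed

end
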